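(* Let $d\geq 3$ and $n\geq d+1$ be integers, and let $K_n$ be the complete graph on $n$ vertices. Then \[ a_d(K_n)\leq \frac{2n}{3(d-1)}+\frac{1}{3}. \]
   Context: For a graph $G=(V,E)$ and a map $p:V\to\mathbb{R}^d$, for distinct $u,v\in V$ let $d_{uv}=\frac{p(u)-p(v)}{\|p(u)-p(v)\|}$ if $p(u)\neq p(v)$ and $d_{uv}=0$ otherwise. The normalized rigidity matrix $R(G,p)$ is the $d|V|\times|E|$ real matrix whose column indexed by the edge $\{u,v\}$ is $(1_u-1_v)\otimes d_{uv}$, where $\{1_u\}$ is the standard basis of $\mathbb{R}^{|V|}$ and $\otimes$ is the Kronecker product. The stiffness matrix is $L(G,p)=R(G,p)R(G,p)^t$. For a symmetric matrix $M$, $\lambda_i(M)$ denotes its $i$-th smallest eigenvalue. The $d$-dimensional algebraic connectivity of $G$ is $a_d(G)=\sup\{\lambda_{\binom{d+1}{2}+1}(L(G,p)) : p:V\to\mathbb{R}^d\}$. *)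

theory Defs
  imports
    "HOL-Computational_Algebra.Polynomial"
    "Jordan_Normal_Form.Char_Poly"
begin

text \<open>
  A graph on \<open>n\<close> vertices has vertex set \<open>{0..<n}\<close> and is given by its set
  \<open>E :: nat set set\<close> of edges, each edge being a two-element set \<open>{u, v}\<close>.
  Points of \<open>d\<close>-dimensional Euclidean space are elements of \<open>carrier_vec d\<close>.
\<close>

definition complete_graph_edges :: "nat \<Rightarrow> nat set set" where
  "complete_graph_edges n = {e. e \<subseteq> {0..<n} \<and> card e = 2}"

text \<open>
  Every edge \<open>{u, v}\<close> is listed exactly once, as the pair with \<open>u < v\<close>.  Exchanging \<open>u\<close> and
  \<open>v\<close> does not change the column \<open>(1\<^sub>u - 1\<^sub>v) \<otimes> d\<^sub>u\<^sub>v\<close> below, and reordering the edges permutes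
  the columns of the rigidity matrix \<open>R\<close>, which does not change \<open>R R\<^sup>t\<close>.
\<close>

definition edge_list :: "nat \<Rightarrow> nat set set \<Rightarrow> (nat \<times> nat) list" where
  "edge_list n E = [(u, v). u \<leftarrow> [0..<n], v \<leftarrow> [Suc u..<n], {u, v} \<in> E]"

definition eucl_norm :: "real vec \<Rightarrow> real" where
  "eucl_norm x = sqrt (x \<bullet> x)"

definition edge_direction :: "nat \<Rightarrow> (nat \<Rightarrow> real vec) \<Rightarrow> nat \<Rightarrow> nat \<Rightarrow> real vec" where
  "edge_direction d p u v =
     (if p u \<noteq> p v then (1 / eucl_norm (p u - p v)) \<cdot>\<^sub>v (p u - p v) else 0\<^sub>v d)"

definition kronecker_vec :: "real vec \<Rightarrow> real vec \<Rightarrow> real vec" where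
  "kronecker_vec a b =
     vec (dim_vec a * dim_vec b) (\<lambda>i. a $ (i div dim_vec b) * b $ (i mod dim_vec b))"

definition rigidity_matrix :: "nat \<Rightarrow> nat \<Rightarrow> nat set set \<Rightarrow> (nat \<Rightarrow> real vec) \<Rightarrow> real mat" where
  "rigidity_matrix d n E p =
     mat_of_cols (d * n)
       (map (\<lambda>(u, v). kronecker_vec (unit_vec n u - unit_vec n v) (edge_direction d p u v))
         (edge_list n E))"

definition stiffness_matrix :: "nat \<Rightarrow> nat \<Rightarrow> nat set set \<Rightarrow> (nat \<Rightarrow> real vec) \<Rightarrow> real mat" where
  "stiffness_matrix d n E p = rigidity_matrix d n E p * transpose_mat (rigidity_matrix d n E p)"

text \<open>
  Eigenvalues are counted with multiplicity, and \<open>i\<close> starts from 1.  The definition is meant for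
  real symmetric matrices, whose characteristic polynomial splits over the reals, so that the
  sorted list has as many entries as the matrix has rows.
\<close>

definition nth_smallest_eigenvalue :: "nat \<Rightarrow> real mat \<Rightarrow> real" where
  "nth_smallest_eigenvalue i M = sorted_list_of_multiset (proots (char_poly M)) ! (i - 1)"

text \<open>
  The set below is nonempty, and, when \<open>(d + 1) choose 2 < d * n\<close>, bounded (the eigenvalues of
  the positive semidefinite stiffness matrix are at most its trace, hence at most
  \<open>2 * card E\<close>), so the supremum in the reals is the actual supremum.
\<close>

definition algebraic_connectivity :: "nat \<Rightarrow> nat \<Rightarrow> nat set set \<Rightarrow> real" where
  "algebraic_connectivity d n E =
     (SUP p \<in> {p. \<forall>v \<in> {0..<n}. p v \<in> carrier_vec d}.
        nth_smallest_eigenvalue (((d + 1) choose 2) + 1) (stiffness_matrix d n E p))"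

end

theory Submission
  imports "HOL-Analysis.Analysis" Defs "Jordan_Normal_Form.Schur_Decomposition"
begin

text \<open>
  Let \<open>\<alpha> > 0\<close> be the eigenvalue in question and \<open>T\<close> the set of the \<open>d n - (d + 1 choose 2)\<close> largest
  eigenvalues, so that the number of edges exceeds \<open>card T\<close> by \<open>k (k + 1) / 2\<close> with \<open>k = n - d - 1\<close>.
  The strains of the eigenvectors in \<open>T\<close> span a space of edge vectors \<open>x\<close> on which
  \<open>\<alpha> |x|\<^sup>2 \<le> |R x|\<^sup>2\<close>, and this space misses only \<open>k (k + 1) / 2\<close> dimensions.

  If \<open>k = 0\<close>, the inequality holds for every \<open>x\<close>; summing it over the three four-cycles on four
  vertices, with the edge lengths taken with alternating signs, gives \<open>\<alpha> \<le> 1\<close>.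

  If \<open>n \<ge> 3 k + 3\<close>, or \<open>n = 5\<close> and \<open>k = 1\<close>, there are masses \<open>m\<close> for which \<open>m u * (\<Sum>v. m v * |p u - p v|\<^sup>2)\<close> does not depend
  on \<open>u\<close>: they minimise \<open>\<Sum>u v. m u * m v * |p u - p v|\<^sup>2\<close> subject to \<open>\<Prod>u. m u = 1\<close>, the minimum
  existing because no point carries half of the vertices.  Testing the inequality, averaged with its
  loss from the missing dimensions, on stresses built from these masses bounds \<open>\<alpha>\<close>.

  Otherwise let \<open>w u\<close> be the unit vector at \<open>p u\<close> pointing away from the geometric
  median of the points.  Taking the trace of the stiffness matrix over the displacements orthogonal to \<open>w u\<close> at
  each vertex \<open>u\<close> bounds a multiple of \<open>\<alpha>\<close> by \<open>\<Sum>u v. |d u v|\<^sup>2 - \<langle>w u, d u v\<rangle>\<^sup>2\<close>, and each pair contributes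
  at most an affine function of \<open>\<langle>w u, w v\<rangle>\<close>, whose sum is controlled since the \<open>w u\<close> add up
  to zero, apart from a correction when the median is one of the points.
\<close>

section \<open>The spectral theorem for real symmetric matrices\<close>

text \<open>Over the complex numbers the polynomial factors, and moving the matrix across the
  Hermitian form of an eigenvector shows that every root equals its conjugate. So the list inside
  \<open>nth_smallest_eigenvalue\<close> really has \<open>n\<close> entries.\<close>

lemma symmetric_char_poly_splits:
  fixes A :: "real mat"
  assumes A: "A \<in> carrier_mat n n" and sym: "transpose_mat A = A"
  shows "char_poly A = (\<Prod>e\<leftarrow>sorted_list_of_multiset (proots (char_poly A)). [:- e, 1:])"
    and "length (sorted_list_of_multiset (proots (char_poly A))) = n"
proof -
  let ?c = "map_mat complex_of_real A"
  have C: "?c \<in> carrier_mat n n" using A by simp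
  have hom: "char_poly ?c = map_poly complex_of_real (char_poly A)"
    by (rule of_real_hom.char_poly_hom[OF A])
  obtain as where as: "char_poly ?c = (\<Prod>a\<leftarrow>as. [:- a, 1:])" and len: "length as = n"
    using char_poly_factorized[OF C] by blast
  have real: "a \<in> \<real>" if "a \<in> set as" for a
  proof -
    have "poly (char_poly ?c) a = 0"
      unfolding as using that by (auto simp: poly_prod_list prod_list_zero_iff)
    then have "eigenvalue ?c a"
      using eigenvalue_root_char_poly[OF C] by simp
    then obtain v where v: "v \<in> carrier_vec n" "v \<noteq> 0\<^sub>v n" "?c *\<^sub>v v = a \<cdot>\<^sub>v v"
      unfolding eigenvalue_def eigenvector_def using A by auto
    have cc: "conjugate (?c *\<^sub>v v) = ?c *\<^sub>v conjugate v"
    proof (rule eq_vecI)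
      fix i assume i: "i < dim_vec (?c *\<^sub>v conjugate v)"
      then have i': "i < n" using A by simp
      show "conjugate (?c *\<^sub>v v) $ i = (?c *\<^sub>v conjugate v) $ i"
        using i' v(1) A by (simp add: scalar_prod_def sum_conjugate cnj_sum)
    qed (use A v in auto)
    have symC: "transpose_mat ?c = ?c" using sym by (simp add: map_mat_transpose)
    have "a * (v \<bullet>c v) = (a \<cdot>\<^sub>v v) \<bullet>c v"
      using v by simp
    also have "\<dots> = (?c *\<^sub>v v) \<bullet> conjugate v" using v by simp
    also have "\<dots> = (transpose_mat ?c *\<^sub>v v) \<bullet> conjugate v" using symC by simp
    also have "\<dots> = v \<bullet> (?c *\<^sub>v conjugate v)"
      by (rule transpose_vec_mult_scalar) (use v C in auto)
    also have "\<dots> = v \<bullet>c (a \<cdot>\<^sub>v v)" using cc v by simp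
    also have "\<dots> = cnj a * (v \<bullet>c v)" using v by (simp add: conjugate_smult_vec)
    finally have "a * (v \<bullet>c v) = cnj a * (v \<bullet>c v)" .
    moreover have "v \<bullet>c v \<noteq> 0" using v by (simp add: conjugate_square_eq_0_vec)
    ultimately have "a = cnj a" by simp
    then show ?thesis by (simp add: Reals_cnj_iff)
  qed
  \<comment> \<open>Since all roots are real, taking real parts loses nothing; injectivity of the
    coefficient embedding then carries the factorisation back to real polynomials.\<close>
  define rs where "rs = map Re as"
  have as_rs: "as = map complex_of_real rs"
    unfolding rs_def map_map using real by (auto intro!: map_idI[symmetric] simp: complex_is_Real_iff complex_eq_iff)
  interpret h: map_poly_inj_idom_hom complex_of_real ..
  have "map_poly complex_of_real (\<Prod>e\<leftarrow>rs. [:- e, 1:]) = (\<Prod>a\<leftarrow>as. [:- a, 1:])"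
    unfolding as_rs
  proof (induct rs)
    case (Cons r rs)
    have "map_poly complex_of_real (\<Prod>e\<leftarrow>r # rs. [:- e, 1:])
      = map_poly complex_of_real [:- r, 1:] * map_poly complex_of_real (\<Prod>e\<leftarrow>rs. [:- e, 1:])"
      by (simp only: list.map prod_list.Cons h.hom_mult)
    also have "map_poly complex_of_real [:- r, 1:] = [:- complex_of_real r, 1:]" by simp
    finally show ?case by (simp only: list.map prod_list.Cons Cons.hyps)
  qed simp
  then have "map_poly complex_of_real (char_poly A) = map_poly complex_of_real (\<Prod>e\<leftarrow>rs. [:- e, 1:])"
    unfolding hom[symmetric] as by simp
  then have cp: "char_poly A = (\<Prod>e\<leftarrow>rs. [:- e, 1:])" by simp
  have pr: "proots (char_poly A) = mset rs"
  proof -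
    have "(\<Sum>p\<leftarrow>map (\<lambda>e. [:- e, 1:]) rs. proots p) = mset rs" by (induct rs) auto
    moreover have "0 \<notin> set (map (\<lambda>e. [:- e, 1:]) rs)" by auto
    ultimately show ?thesis unfolding cp
      using proots_prod_list[of "map (\<lambda>e. [:- e, 1:]) rs", unfolded list.map_ident] by (simp only: simp_thms)
  qed
  let ?es = "sorted_list_of_multiset (proots (char_poly A))"
  have ms: "mset ?es = mset rs" using pr by simp
  have "(\<Prod>e\<leftarrow>?es. [:- e, 1:]) = (\<Prod>e\<leftarrow>rs. [:- e, 1::real:])"
    unfolding prod_mset_prod_list[symmetric] mset_map ms ..
  then show "char_poly A = (\<Prod>e\<leftarrow>?es. [:- e, 1:])" using cp by simp
  show "length ?es = n" using arg_cong[OF ms, of size] len as_rs unfolding size_mset by simp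
qed

text \<open>Gram-Schmidt on a basis that begins with \<open>v\<close> keeps \<open>v\<close> in
  front. It only yields orthogonal vectors, so they are normalised afterwards, which is where
  \<open>c\<close> comes from.\<close>

lemma orthonormal_completion:
  fixes v :: "real vec"
  assumes v: "v \<in> carrier_vec n" "v \<noteq> 0\<^sub>v n"
  obtains N c where "N \<in> carrier_mat n n" "transpose_mat N * N = 1\<^sub>m n" "col N 0 = c \<cdot>\<^sub>v v"
proof -
  interpret cof_vec_space n "TYPE(real)" .
  define b where "b = basis_completion v"
  define ws where "ws = gram_schmidt n b"
  from basis_completion[OF v, folded b_def]
  have dist_b: "distinct b" and indep: "\<not> lin_dep (set b)" and b: "set b \<subseteq> carrier_vec n"
    and hdb: "hd b = v" and len_b: "length b = n" by auto
  have n0: "n \<noteq> 0" using v by (metis carrier_vecD eq_vecI index_zero_vec(2) not_less_zero)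
  obtain vs where bv: "b = v # vs" using hdb len_b n0 by (cases b) auto
  from gram_schmidt_result[OF b dist_b indep refl, folded ws_def]
  have ws: "set ws \<subseteq> carrier_vec n" "corthogonal ws" "length ws = n"
    by (auto simp: len_b)
  have hdws: "hd ws = v" unfolding ws_def bv using gram_schmidt_hd[OF v(1)] by simp
  have ws0: "ws ! 0 = v" using hdws ws(3) n0 by (metis hd_conv_nth length_0_conv)
  have wsc: "ws ! i \<in> carrier_vec n" if "i < n" for i using ws that by auto
  have orth: "ws ! i \<bullet> ws ! j = 0 \<longleftrightarrow> i \<noteq> j" if "i < n" "j < n" for i j
    using corthogonalD[OF ws(2), of i j] that ws(3) by simp
  have nn: "0 \<le> w \<bullet> w" for w :: "real vec"
    by (simp add: scalar_prod_def sum_nonneg)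
  define us where "us = map (\<lambda>w. (1 / sqrt (w \<bullet> w)) \<cdot>\<^sub>v w) ws"
  define N where "N = mat_of_cols n us"
  have N: "N \<in> carrier_mat n n" unfolding N_def us_def using ws(3) by auto
  have coln: "col N i = (1 / sqrt (ws ! i \<bullet> ws ! i)) \<cdot>\<^sub>v (ws ! i)" if "i < n" for i
    unfolding N_def using that ws(3) wsc[OF that] by (subst col_mat_of_cols) (auto simp: us_def)
  have "transpose_mat N * N = 1\<^sub>m n"
  proof (rule eq_matI)
    fix i j assume ij: "i < dim_row (1\<^sub>m n)" "j < dim_col (1\<^sub>m n)"
    then have ij': "i < n" "j < n" by auto
    have "(transpose_mat N * N) $$ (i, j) = col N i \<bullet> col N j"
      using N ij' by simp
    also have "\<dots> = (1 / sqrt (ws ! i \<bullet> ws ! i)) * (1 / sqrt (ws ! j \<bullet> ws ! j)) * (ws ! i \<bullet> ws ! j)"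
      using coln[OF ij'(1)] coln[OF ij'(2)] wsc[OF ij'(1)] wsc[OF ij'(2)]
      by (simp add: smult_scalar_prod_distrib[of _ n] scalar_prod_smult_distrib[of _ n])
    also have "\<dots> = 1\<^sub>m n $$ (i, j)"
    proof (cases "i = j")
      case True
      have "ws ! i \<bullet> ws ! i > 0" using orth[of i i] nn[of "ws ! i"] ij' by (simp add: less_le)
      then show ?thesis using True ij' by (simp add: field_simps flip: real_sqrt_mult)
    qed (use orth ij' in auto)
    finally show "(transpose_mat N * N) $$ (i, j) = 1\<^sub>m n $$ (i, j)" .
  qed (use N in auto)
  then show thesis using that[OF N _ ] coln[of 0] n0 ws0 by auto
qed

lemma four_block_1_cong:
  assumes "B \<in> carrier_mat m m" "C \<in> carrier_mat m m"
  shows "four_block_mat (mat 1 1 (\<lambda>_. x)) (0\<^sub>m 1 m) (0\<^sub>m m 1) B * four_block_mat (mat 1 1 (\<lambda>_. y)) (0\<^sub>m 1 m) (0\<^sub>m m 1) C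
    = four_block_mat (mat 1 1 (\<lambda>_. x * y :: real)) (0\<^sub>m 1 m) (0\<^sub>m m 1) (B * C)"
proof -
  have "mat 1 1 (\<lambda>_. x) * mat 1 1 (\<lambda>_. y) = mat 1 1 (\<lambda>_. x * y)"
    by (rule eq_matI) (auto simp: scalar_prod_def)
  then show ?thesis
    by (subst mult_four_block_mat[of _ 1 1 _ m _ m _ _ 1 _ m]) (use assms in auto)
qed

lemma transpose_four_block_1:
  assumes "B \<in> carrier_mat m m"
  shows "transpose_mat (four_block_mat (mat 1 1 (\<lambda>_. x :: real)) (0\<^sub>m 1 m) (0\<^sub>m m 1) B)
    = four_block_mat (mat 1 1 (\<lambda>_. x)) (0\<^sub>m 1 m) (0\<^sub>m m 1) (transpose_mat B)"
  by (rule eq_matI) (use assms in auto)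

lemma four_block_1_one: "four_block_mat (mat 1 1 (\<lambda>_. 1 :: real)) (0\<^sub>m 1 m) (0\<^sub>m m 1) (1\<^sub>m m) = 1\<^sub>m (Suc m)"
  by (rule eq_matI) auto

lemma four_block_1_diag: "four_block_mat (mat 1 1 (\<lambda>_. e :: real)) (0\<^sub>m 1 m) (0\<^sub>m m 1) (mat_diag m (\<lambda>i. es ! i)) = mat_diag (Suc m) (\<lambda>i. (e # es) ! i)"
  by (rule eq_matI) (auto simp: mat_diag_def nth_Cons')

text \<open>Induction on \<open>es\<close>: in an orthonormal basis starting with an eigenvector for
  \<open>e\<close>, symmetry clears the first row along with the first column, and the remaining
  block has the remaining factors as its characteristic polynomial. The diagonal keeps the order of
  \<open>es\<close>, so a sorted list gives sorted eigenvalues.\<close>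

lemma symmetric_diagonalizable:
  fixes A :: "real mat"
  assumes "A \<in> carrier_mat n n" and "transpose_mat A = A"
    and "char_poly A = (\<Prod>e\<leftarrow>es. [:- e, 1:])"
  shows "\<exists>P\<in>carrier_mat n n. transpose_mat P * P = 1\<^sub>m n \<and>
    transpose_mat P * A * P = mat_diag n (\<lambda>i. es ! i)"
  using assms
proof (induction es arbitrary: n A)
  case Nil
  then have "n = 0" using degree_monic_char_poly[of A n] by auto
  then show ?case by (intro bexI[of _ "1\<^sub>m 0"]) (auto intro!: eq_matI simp: mat_diag_def)
next
  case (Cons e es)
  note A = Cons.prems(1) and sym = Cons.prems(2)
  have cp: "char_poly A = [:- e, 1:] * (\<Prod>e\<leftarrow>es. [:- e, 1:])" using Cons.prems(3) by simp
  have "poly (char_poly A) e = 0" unfolding cp by simp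
  then have "eigenvalue A e" using eigenvalue_root_char_poly[OF A] by simp
  then obtain v where v: "v \<in> carrier_vec n" "v \<noteq> 0\<^sub>v n" and ev: "A *\<^sub>v v = e \<cdot>\<^sub>v v"
    unfolding eigenvalue_def eigenvector_def using A by auto
  obtain N c where N: "N \<in> carrier_mat n n" and NN: "transpose_mat N * N = 1\<^sub>m n" and N0: "col N 0 = c \<cdot>\<^sub>v v"
    using orthonormal_completion[OF v] .
  have "n \<noteq> 0" using v by (metis carrier_vecD eq_vecI index_zero_vec(2) not_less_zero)
  then obtain m where n: "n = Suc m" by (cases n) auto
  define A' where "A' = transpose_mat N * A * N"
  have A': "A' \<in> carrier_mat n n" unfolding A'_def using N A by auto
  have symA': "transpose_mat A' = A'"
    unfolding A'_def using N A sym
    by (simp add: transpose_mult[of _ n n _ n] assoc_mult_mat[of _ n n _ n _ n])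
  have col0: "A' $$ (i, 0) = (if i = 0 then e else 0)" if i: "i < n" for i
  proof -
    have "A' $$ (i, 0) = (transpose_mat N * (A * N)) $$ (i, 0)"
      unfolding A'_def using N A by (simp add: assoc_mult_mat[of _ n n _ n _ n])
    also have "\<dots> = col N i \<bullet> col (A * N) 0" using N A i n by simp
    also have "col (A * N) 0 = A *\<^sub>v col N 0" using N A n by (simp add: col_mult2)
    also have "\<dots> = e \<cdot>\<^sub>v col N 0" unfolding N0 using A v ev
      by (simp add: mult_mat_vec[of _ n n] smult_smult_assoc mult.commute)
    also have "col N i \<bullet> (e \<cdot>\<^sub>v col N 0) = e * (transpose_mat N * N) $$ (i, 0)"
      using N i n by simp
    finally show ?thesis unfolding NN using i n by simp
  qed
  have row0: "A' $$ (0, i) = (if i = 0 then e else 0)" if i: "i < n" for i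
    using col0[OF i] arg_cong[OF symA', of "\<lambda>M. M $$ (0, i)"] A' i n by simp
  define A3 where "A3 = mat m m (\<lambda>(i, j). A' $$ (Suc i, Suc j))"
  have A3: "A3 \<in> carrier_mat m m" unfolding A3_def by simp
  have blk: "A' = four_block_mat (mat 1 1 (\<lambda>_. e)) (0\<^sub>m 1 m) (0\<^sub>m m 1) A3"
    by (rule eq_matI) (use A' n col0 row0 in \<open>auto simp: A3_def\<close>)
  have sym3: "transpose_mat A3 = A3"
  proof (rule eq_matI)
    fix i j assume "i < dim_row A3" "j < dim_col A3"
    then show "transpose_mat A3 $$ (i, j) = A3 $$ (i, j)"
      using arg_cong[OF symA', of "\<lambda>M. M $$ (Suc i, Suc j)"] A' n by (simp add: A3_def)
  qed (use A3 in auto)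
  have NN': "N * transpose_mat N = 1\<^sub>m n"
    using mat_mult_left_right_inverse[OF _ N NN] N by simp
  have "similar_mat A' A"
    unfolding similar_mat_def
    by (intro exI[of _ "transpose_mat N"] exI[of _ N] similar_mat_witI[of _ _ n]) (use NN NN' N A A' in \<open>auto simp: A'_def\<close>)
  then have "char_poly A' = char_poly A" by (rule char_poly_similar)
  moreover have "char_poly A' = char_poly (mat 1 1 (\<lambda>_. e)) * char_poly A3"
    unfolding blk by (rule char_poly_four_block_zeros_col[OF _ _ A3]) auto
  moreover have "char_poly (mat 1 1 (\<lambda>_. e)) = [:- e, 1:]"
    by (simp add: char_poly_defs det_def sign_def)
  ultimately have "char_poly A3 = (\<Prod>e\<leftarrow>es. [:- e, 1:])"
    unfolding cp by (metis mult_cancel_left pCons_eq_0_iff zero_neq_one)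
  from Cons.IH[OF A3 sym3 this] obtain P3 where P3: "P3 \<in> carrier_mat m m"
    and P3P3: "transpose_mat P3 * P3 = 1\<^sub>m m" and P3A: "transpose_mat P3 * A3 * P3 = mat_diag m (\<lambda>i. es ! i)"
    by auto
  define F where "F = four_block_mat (mat 1 1 (\<lambda>_. 1 :: real)) (0\<^sub>m 1 m) (0\<^sub>m m 1) P3"
  have F: "F \<in> carrier_mat n n" unfolding F_def n using P3 by auto
  have Ft: "transpose_mat F = four_block_mat (mat 1 1 (\<lambda>_. 1 :: real)) (0\<^sub>m 1 m) (0\<^sub>m m 1) (transpose_mat P3)"
    unfolding F_def by (rule transpose_four_block_1[OF P3])
  have FF: "transpose_mat F * F = 1\<^sub>m n"
  proof -
    have Pt: "transpose_mat P3 \<in> carrier_mat m m" using P3 by simp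
    show ?thesis
      unfolding Ft unfolding F_def n four_block_1_cong[OF Pt P3] P3P3 mult_1 four_block_1_one ..
  qed
  have FA: "transpose_mat F * A' * F = mat_diag n (\<lambda>i. (e # es) ! i)"
  proof -
    have Pt: "transpose_mat P3 \<in> carrier_mat m m" "transpose_mat P3 * A3 \<in> carrier_mat m m"
      using P3 A3 by simp_all
    show ?thesis
      unfolding Ft unfolding F_def n blk four_block_1_cong[OF Pt(1) A3] four_block_1_cong[OF Pt(2) P3]
        P3A mult_1 mult_1_right four_block_1_diag ..
  qed
  show ?case
  proof (intro bexI[of _ "N * F"] conjI)
    have "transpose_mat (N * F) * (N * F) = transpose_mat F * (transpose_mat N * N) * F"
      using N F by (simp add: transpose_mult[of _ n n _ n] assoc_mult_mat[of _ n n _ n _ n])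
    then show "transpose_mat (N * F) * (N * F) = 1\<^sub>m n" using F by (simp add: NN FF)
    have "transpose_mat (N * F) * A * (N * F) = transpose_mat F * A' * F"
      unfolding A'_def using N F A by (simp add: transpose_mult[of _ n n _ n] assoc_mult_mat[of _ n n _ n _ n])
    then show "transpose_mat (N * F) * A * (N * F) = mat_diag n (\<lambda>i. (e # es) ! i)" using FA by simp
  qed (use N F in auto)
qed

section \<open>Bessel inequalities\<close>

lemma orthonormal_residual:
  fixes f :: "'i \<Rightarrow> 'e \<Rightarrow> real"
  assumes fin: "finite I"
    and orth: "\<And>i j. i \<in> I \<Longrightarrow> j \<in> I \<Longrightarrow> (\<Sum>e\<in>E. f i e * f j e) = (if i = j then 1 else 0)"
  shows "(\<Sum>e\<in>E. (x e - (\<Sum>i\<in>I. (\<Sum>e'\<in>E. f i e' * x e') * f i e))\<^sup>2)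
    = (\<Sum>e\<in>E. (x e)\<^sup>2) - (\<Sum>i\<in>I. (\<Sum>e\<in>E. f i e * x e)\<^sup>2)"
proof -
  define c where "c i = (\<Sum>e\<in>E. f i e * x e)" for i
  have s1: "(\<Sum>e\<in>E. x e * (\<Sum>i\<in>I. c i * f i e)) = (\<Sum>i\<in>I. (c i)\<^sup>2)"
  proof -
    have "(\<Sum>e\<in>E. x e * (\<Sum>i\<in>I. c i * f i e)) = (\<Sum>i\<in>I. \<Sum>e\<in>E. c i * (f i e * x e))"
      by (subst sum.swap) (simp add: sum_distrib_left mult_ac)
    also have "\<dots> = (\<Sum>i\<in>I. (c i)\<^sup>2)"
      by (simp add: sum_distrib_left[symmetric] c_def[symmetric] power2_eq_square)
    finally show ?thesis .
  qed
  have s2: "(\<Sum>e\<in>E. (\<Sum>i\<in>I. c i * f i e)\<^sup>2) = (\<Sum>i\<in>I. (c i)\<^sup>2)"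
  proof -
    have "(\<Sum>e\<in>E. (\<Sum>i\<in>I. c i * f i e)\<^sup>2) = (\<Sum>e\<in>E. \<Sum>i\<in>I. \<Sum>j\<in>I. c i * c j * (f i e * f j e))"
      by (simp add: power2_eq_square sum_product mult_ac)
    also have "\<dots> = (\<Sum>i\<in>I. \<Sum>j\<in>I. \<Sum>e\<in>E. c i * c j * (f i e * f j e))"
      by (subst sum.swap, rule sum.cong[OF refl], subst sum.swap, rule refl)
    also have "\<dots> = (\<Sum>i\<in>I. \<Sum>j\<in>I. c i * c j * (if i = j then 1 else 0))"
      by (intro sum.cong refl) (simp add: sum_distrib_left[symmetric] orth)
    also have "\<dots> = (\<Sum>i\<in>I. (c i)\<^sup>2)"
      using fin by (simp add: power2_eq_square if_distrib[of "(*) _"] cong: if_cong)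
    finally show ?thesis .
  qed
  have "(\<Sum>e\<in>E. (x e - (\<Sum>i\<in>I. c i * f i e))\<^sup>2)
      = (\<Sum>e\<in>E. (x e)\<^sup>2) - 2 * (\<Sum>e\<in>E. x e * (\<Sum>i\<in>I. c i * f i e)) + (\<Sum>e\<in>E. (\<Sum>i\<in>I. c i * f i e)\<^sup>2)"
    by (simp add: power2_diff sum.distrib sum_subtractf sum_distrib_left mult_ac)
  then show ?thesis unfolding s1 s2 unfolding c_def by simp
qed

lemma bessel_inequality:
  fixes f :: "'i \<Rightarrow> 'e \<Rightarrow> real"
  assumes "finite I"
    and "\<And>i j. i \<in> I \<Longrightarrow> j \<in> I \<Longrightarrow> (\<Sum>e\<in>E. f i e * f j e) = (if i = j then 1 else 0)"
  shows "(\<Sum>i\<in>I. (\<Sum>e\<in>E. f i e * x e)\<^sup>2) \<le> (\<Sum>e\<in>E. (x e)\<^sup>2)"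
proof -
  have "0 \<le> (\<Sum>e\<in>E. (x e - (\<Sum>i\<in>I. (\<Sum>e'\<in>E. f i e' * x e') * f i e))\<^sup>2)"
    by (intro sum_nonneg) auto
  then show ?thesis using orthonormal_residual[where I=I and f=f and E=E and x=x, OF assms] by simp
qed

text \<open>The error term bounds the part of the family \<open>x\<close> lying in the orthogonal complement of the
  \<open>f i\<close>: its coordinates are inner products with the rows of the complementary projection.\<close>

lemma captured_energy_lower_bound:
  fixes f :: "'i \<Rightarrow> 'e \<Rightarrow> real" and x :: "'s \<Rightarrow> 'e \<Rightarrow> real"
  assumes fin: "finite I" "finite E"
    and orth: "\<And>i j. i \<in> I \<Longrightarrow> j \<in> I \<Longrightarrow> (\<Sum>e\<in>E. f i e * f j e) = (if i = j then 1 else 0)"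
    and frame: "\<And>g. (\<Sum>s\<in>S. (\<Sum>e\<in>E. g e * x s e)\<^sup>2) \<le> \<beta> * (\<Sum>e\<in>E. (g e)\<^sup>2)"
  shows "(\<Sum>s\<in>S. \<Sum>e\<in>E. (x s e)\<^sup>2) - \<beta> * (real (card E) - real (card I))
    \<le> (\<Sum>s\<in>S. \<Sum>i\<in>I. (\<Sum>e\<in>E. f i e * x s e)\<^sup>2)"
proof -
  define r where "r e e' = (if e' = e then 1 else 0) - (\<Sum>i\<in>I. f i e * f i e')" for e e'
  have rr: "(\<Sum>e'\<in>E. (r e e')\<^sup>2) = 1 - (\<Sum>i\<in>I. (f i e)\<^sup>2)" if e: "e \<in> E" for e
    using orthonormal_residual[OF fin(1) orth, of "\<lambda>e'. if e' = e then 1 else 0"] fin e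
    by (simp add: r_def if_distrib[of "(*) _"] if_distrib[of "\<lambda>z. z\<^sup>2"] cong: if_cong)
  \<comment> \<open>The squared row norms of a projection add up to its trace, here the number of
    missing dimensions.\<close>
  have tr: "(\<Sum>e\<in>E. 1 - (\<Sum>i\<in>I. (f i e)\<^sup>2)) = real (card E) - real (card I)"
  proof -
    have "(\<Sum>e\<in>E. \<Sum>i\<in>I. (f i e)\<^sup>2) = (\<Sum>i\<in>I. 1)"
      by (subst sum.swap) (intro sum.cong refl, simp add: orth power2_eq_square)
    then show ?thesis by (simp add: sum_subtractf)
  qed
  have rx: "(\<Sum>e\<in>E. (\<Sum>e'\<in>E. r e e' * x s e')\<^sup>2)
      = (\<Sum>e\<in>E. (x s e)\<^sup>2) - (\<Sum>i\<in>I. (\<Sum>e\<in>E. f i e * x s e)\<^sup>2)" for s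
  proof -
    have "(\<Sum>e'\<in>E. r e e' * x s e') = x s e - (\<Sum>i\<in>I. (\<Sum>e'\<in>E. f i e' * x s e') * f i e)"
      if "e \<in> E" for e
    proof -
      have "(\<Sum>e'\<in>E. (\<Sum>i\<in>I. f i e * f i e') * x s e') = (\<Sum>i\<in>I. (\<Sum>e'\<in>E. f i e' * x s e') * f i e)"
        unfolding sum_distrib_right by (subst sum.swap) (simp add: mult_ac)
      then show ?thesis using fin that
        by (simp add: r_def left_diff_distrib sum_subtractf if_distrib[of "\<lambda>z. z * _"] cong: if_cong)
    qed
    then show ?thesis using orthonormal_residual[OF fin(1) orth, of "x s"] by simp
  qed
  have "(\<Sum>s\<in>S. \<Sum>e\<in>E. (x s e)\<^sup>2) - (\<Sum>s\<in>S. \<Sum>i\<in>I. (\<Sum>e\<in>E. f i e * x s e)\<^sup>2)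
      = (\<Sum>e\<in>E. \<Sum>s\<in>S. (\<Sum>e'\<in>E. r e e' * x s e')\<^sup>2)"
    by (subst sum.swap) (simp add: rx sum_subtractf)
  also have "\<dots> \<le> (\<Sum>e\<in>E. \<beta> * (\<Sum>e'\<in>E. (r e e')\<^sup>2))"
    by (intro sum_mono frame)
  also have "\<dots> = \<beta> * (real (card E) - real (card I))"
    unfolding sum_distrib_left[symmetric] tr[symmetric] by (simp add: rr)
  finally show ?thesis by simp
qed

section \<open>Stresses and strains\<close>

lemma sum_lessThan_pairs_symmetric:
  fixes h :: "nat \<Rightarrow> nat \<Rightarrow> real"
  assumes sym: "\<And>u v. u < n \<Longrightarrow> v < n \<Longrightarrow> h u v = h v u" and diag: "\<And>u. u < n \<Longrightarrow> h u u = 0"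
  shows "(\<Sum>u<n. \<Sum>v<n. h u v) = 2 * (\<Sum>(u, v)\<in>{(u, v). u < v \<and> v < n}. h u v)"
proof -
  let ?E = "{(u, v). u < v \<and> v < n}" and ?E' = "{(u, v). v < u \<and> u < n}" and ?D = "{(u, v). u = v \<and> u < n}"
  have fin: "finite ?E" "finite ?E'" "finite ?D"
    by (rule finite_subset[of _ "{..<n} \<times> {..<n}"]; auto)+
  have "(\<Sum>u<n. \<Sum>v<n. h u v) = (\<Sum>(u, v)\<in>{..<n} \<times> {..<n}. h u v)"
    by (simp add: sum.cartesian_product)
  also have "{..<n} \<times> {..<n} = ?E \<union> ?E' \<union> ?D" by auto
  also have "(\<Sum>(u, v)\<in>?E \<union> ?E' \<union> ?D. h u v)
      = (\<Sum>(u, v)\<in>?E. h u v) + (\<Sum>(u, v)\<in>?E'. h u v) + (\<Sum>(u, v)\<in>?D. h u v)"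
    using fin by (subst sum.union_disjoint; (subst sum.union_disjoint)?) auto
  also have "(\<Sum>(u, v)\<in>?D. h u v) = 0" by (rule sum.neutral) (use diag in auto)
  also have "(\<Sum>(u, v)\<in>?E'. h u v) = (\<Sum>(u, v)\<in>?E. h u v)"
    by (rule sum.reindex_bij_witness[of _ prod.swap prod.swap]) (use sym in auto)
  finally show ?thesis by simp
qed

locale bar_framework =
  fixes n d :: nat and q :: "nat \<Rightarrow> nat \<Rightarrow> real"
  assumes n_pos: "0 < n"
begin

definition len :: "nat \<Rightarrow> nat \<Rightarrow> real" where
  "len u v = sqrt (\<Sum>a<d. (q u a - q v a)\<^sup>2)"

text \<open>Division by zero yields the zero vector for coinciding points, in agreement with
  \<open>edge_direction\<close>.\<close>

definition dir :: "nat \<Rightarrow> nat \<Rightarrow> nat \<Rightarrow> real" where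
  "dir u v a = (q u a - q v a) / len u v"

definition edges :: "(nat \<times> nat) set" where
  "edges = {(u, v). u < v \<and> v < n}"

text \<open>The rigidity matrix applied to an edge vector, which is stored as a symmetric function
  on ordered pairs; \<open>strain\<close> is the transposed matrix applied to a
  displacement.\<close>

definition force :: "(nat \<Rightarrow> nat \<Rightarrow> real) \<Rightarrow> nat \<Rightarrow> nat \<Rightarrow> real" where
  "force x u a = (\<Sum>v<n. x u v * dir u v a)"

definition strain :: "(nat \<Rightarrow> nat \<Rightarrow> real) \<Rightarrow> nat \<Rightarrow> nat \<Rightarrow> real" where
  "strain y u v = (\<Sum>a<d. dir u v a * (y u a - y v a))"

lemma finite_edges [simp]: "finite edges"
  by (rule finite_subset[of _ "{..<n} \<times> {..<n}"]) (auto simp: edges_def)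

lemma card_edges: "card edges = n * (n - 1) div 2"
proof -
  have "(\<Sum>u<n. \<Sum>v<n. if u = v then 0 else 1 :: real) = 2 * real (card edges)"
    by (subst sum_lessThan_pairs_symmetric) (auto simp: edges_def split_def intro!: sum.cong)
  moreover have "(\<Sum>u<n. \<Sum>v<n. if u = v then 0 else 1 :: real) = real n * (real n - 1)"
  proof -
    have "(\<Sum>v<n. if u = v then 0 else 1 :: real) = real n - 1" if "u < n" for u
    proof -
      have "(\<Sum>v<n. if u = v then 0 else 1 :: real) = (\<Sum>v<n. 1 - (if u = v then 1 else 0))"
        by (intro sum.cong) auto
      then show ?thesis using that by (simp add: sum_subtractf)
    qed
    then show ?thesis by simp
  qed
  ultimately have "real (n * (n - 1)) = real (2 * card edges)"
    using n_pos by (simp add: of_nat_diff)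
  then have "n * (n - 1) = 2 * card edges" by (simp only: of_nat_eq_iff)
  then show ?thesis by simp
qed

lemma len_sym: "len u v = len v u"
  unfolding len_def by (intro arg_cong[of _ _ sqrt] sum.cong) (auto simp: power2_commute)

lemma len_nonneg [simp]: "0 \<le> len u v" unfolding len_def by (simp add: sum_nonneg)

lemma len_same [simp]: "len u u = 0" unfolding len_def by simp

lemma len_sq: "(len u v)\<^sup>2 = (\<Sum>a<d. (q u a - q v a)\<^sup>2)"
  unfolding len_def by (simp add: sum_nonneg)

lemma len_eq_0_iff: "len u v = 0 \<longleftrightarrow> (\<forall>a<d. q u a = q v a)"
  unfolding len_def by (auto simp: sum_nonneg_eq_0_iff)

lemma dir_antisym: "dir v u a = - dir u v a"
  unfolding dir_def len_sym[of v u] by (simp add: diff_divide_distrib)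

lemma dir_same [simp]: "dir u u a = 0" unfolding dir_def by simp

lemma len_dir: "a < d \<Longrightarrow> len u v * dir u v a = q u a - q v a"
  unfolding dir_def using len_eq_0_iff[of u v] by auto

lemma dir_sq_sum: "(\<Sum>a<d. (dir u v a)\<^sup>2) = (if len u v = 0 then 0 else 1)"
  by (auto simp: dir_def power_divide sum_divide_distrib[symmetric] len_sq[symmetric])

lemma strain_sym: "strain y v u = strain y u v"
  unfolding strain_def by (intro sum.cong refl) (simp add: dir_antisym[of v u] algebra_simps)

lemma strain_same [simp]: "strain y u u = 0" unfolding strain_def by simp

text \<open>Adjointness of the rigidity matrix and its transpose: \<open>strain\<close> is a
  difference over the two ends of an edge, and antisymmetry of \<open>dir\<close> turns the second
  half into a copy of the first.\<close>

lemma strain_force_duality: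
  assumes sym: "\<And>u v. u < n \<Longrightarrow> v < n \<Longrightarrow> x u v = x v u"
  shows "(\<Sum>(u, v)\<in>edges. strain y u v * x u v) = (\<Sum>u<n. \<Sum>a<d. y u a * force x u a)"
proof -
  have "2 * (\<Sum>(u, v)\<in>edges. strain y u v * x u v) = (\<Sum>u<n. \<Sum>v<n. strain y u v * x u v)"
    unfolding edges_def by (subst sum_lessThan_pairs_symmetric) (auto simp: strain_sym sym)
  also have "\<dots> = (\<Sum>u<n. \<Sum>v<n. \<Sum>a<d. y u a * (x u v * dir u v a)) - (\<Sum>u<n. \<Sum>v<n. \<Sum>a<d. y v a * (x u v * dir u v a))"
    unfolding strain_def sum_subtractf[symmetric] sum_distrib_right
    by (intro sum.cong refl) (simp add: algebra_simps)
  also have "(\<Sum>u<n. \<Sum>v<n. \<Sum>a<d. y v a * (x u v * dir u v a)) = - (\<Sum>u<n. \<Sum>v<n. \<Sum>a<d. y u a * (x u v * dir u v a))"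
  proof -
    have "(\<Sum>u<n. \<Sum>v<n. \<Sum>a<d. y v a * (x u v * dir u v a)) = (\<Sum>v<n. \<Sum>u<n. \<Sum>a<d. y v a * (x u v * dir u v a))"
      by (rule sum.swap)
    also have "\<dots> = (\<Sum>v<n. \<Sum>u<n. \<Sum>a<d. - (y v a * (x v u * dir v u a)))"
    proof (intro sum.cong refl)
      fix u v a assume "v \<in> {..<n}" "u \<in> {..<n}"
      then show "y v a * (x u v * dir u v a) = - (y v a * (x v u * dir v u a))"
        using dir_antisym[of u v a] sym[of u v] by simp
    qed
    finally show ?thesis by (simp add: sum_negf)
  qed
  also have "(\<Sum>u<n. \<Sum>v<n. \<Sum>a<d. y u a * (x u v * dir u v a)) = (\<Sum>u<n. \<Sum>a<d. y u a * force x u a)"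
    unfolding force_def sum_distrib_left by (rule sum.cong[OF refl], rule sum.swap)
  finally show ?thesis by simp
qed

end

section \<open>Frameworks with an eigenbasis, and bounds from stresses\<close>

text \<open>\<open>z i\<close> is an orthonormal eigenbasis of the stiffness matrix, and \<open>T\<close> a set of indices of
  eigenvalues that are at least \<open>\<alpha>\<close>.\<close>

locale eigen_framework = bar_framework +
  fixes z :: "nat \<Rightarrow> nat \<Rightarrow> nat \<Rightarrow> real" and lam :: "nat \<Rightarrow> real" and I T :: "nat set" and \<alpha> :: real
  assumes fin_I: "finite I" and T_sub: "T \<subseteq> I" and \<alpha>_pos: "0 < \<alpha>"
    and orthonormal: "\<And>i j. i \<in> I \<Longrightarrow> j \<in> I \<Longrightarrow> (\<Sum>u<n. \<Sum>a<d. z i u a * z j u a) = (if i = j then 1 else 0)"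
    and complete: "\<And>u v a b. u < n \<Longrightarrow> v < n \<Longrightarrow> a < d \<Longrightarrow> b < d \<Longrightarrow>
      (\<Sum>i\<in>I. z i u a * z i v b) = (if u = v \<and> a = b then 1 else 0)"
    and eigen: "\<And>i u a. i \<in> I \<Longrightarrow> u < n \<Longrightarrow> a < d \<Longrightarrow> force (strain (z i)) u a = lam i * z i u a"
    and large: "\<And>i. i \<in> T \<Longrightarrow> \<alpha> \<le> lam i"
begin

lemma fin_T [simp]: "finite T" using T_sub fin_I finite_subset by blast

lemma strain_orthogonal:
  assumes "i \<in> I" "j \<in> I"
  shows "(\<Sum>(u, v)\<in>edges. strain (z i) u v * strain (z j) u v) = (if i = j then lam j else 0)"
proof -
  have "(\<Sum>(u, v)\<in>edges. strain (z i) u v * strain (z j) u v) = (\<Sum>u<n. \<Sum>a<d. z i u a * force (strain (z j)) u a)"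
    by (rule strain_force_duality) (rule strain_sym)
  also have "\<dots> = (\<Sum>u<n. \<Sum>a<d. lam j * (z i u a * z j u a))"
    by (intro sum.cong refl) (simp add: eigen assms)
  also have "\<dots> = lam j * (if i = j then 1 else 0)"
    by (simp add: sum_distrib_left[symmetric] orthonormal assms)
  finally show ?thesis by simp
qed

lemma lam_nonneg: "i \<in> I \<Longrightarrow> 0 \<le> lam i"
proof -
  assume i: "i \<in> I"
  have "0 \<le> (\<Sum>(u, v)\<in>edges. strain (z i) u v * strain (z i) u v)"
    by (intro sum_nonneg) auto
  then show ?thesis using strain_orthogonal[OF i i] by simp
qed

text \<open>For \<open>lam i > 0\<close> these are the right singular vectors of the rigidity
  matrix.\<close>

definition mode :: "nat \<Rightarrow> nat \<times> nat \<Rightarrow> real" where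
  "mode i = (\<lambda>(u, v). strain (z i) u v / sqrt (lam i))"

lemma mode_orthonormal:
  assumes "i \<in> T" "j \<in> T"
  shows "(\<Sum>e\<in>edges. mode i e * mode j e) = (if i = j then 1 else 0)"
proof -
  have pos: "0 < lam i" "0 < lam j" using large[of i] large[of j] \<alpha>_pos assms by auto
  have "(\<Sum>e\<in>edges. mode i e * mode j e)
      = (\<Sum>(u, v)\<in>edges. strain (z i) u v * strain (z j) u v) / (sqrt (lam i) * sqrt (lam j))"
    unfolding sum_divide_distrib by (intro sum.cong refl) (auto simp: mode_def)
  then show ?thesis using strain_orthogonal[of i j] assms subsetD[OF T_sub] pos by auto
qed

text \<open>By duality, \<open>z i\<close> pairs with \<open>force x\<close> as
  \<open>sqrt (lam i)\<close> times the pairing of \<open>mode i\<close> with \<open>x\<close>.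
  Bessel's inequality for the \<open>z i\<close> then bounds the force energy from below by the part
  of \<open>x\<close> that the modes in \<open>T\<close> see.\<close>

lemma force_energy_ge:
  assumes sym: "\<And>u v. u < n \<Longrightarrow> v < n \<Longrightarrow> x u v = x v u"
  shows "\<alpha> * (\<Sum>i\<in>T. (\<Sum>e\<in>edges. mode i e * x (fst e) (snd e))\<^sup>2) \<le> (\<Sum>u<n. \<Sum>a<d. (force x u a)\<^sup>2)"
proof -
  let ?V = "{..<n} \<times> {..<d}"
  have "(\<Sum>i\<in>T. (\<Sum>e\<in>?V. z i (fst e) (snd e) * force x (fst e) (snd e))\<^sup>2) \<le> (\<Sum>e\<in>?V. (force x (fst e) (snd e))\<^sup>2)"
  proof (rule bessel_inequality[OF fin_T])
    fix i j assume "i \<in> T" "j \<in> T"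
    then show "(\<Sum>e\<in>?V. z i (fst e) (snd e) * z j (fst e) (snd e)) = (if i = j then 1 else 0)"
      using orthonormal[of i j] T_sub by (auto simp: sum.cartesian_product split_def subset_iff)
  qed
  then have B: "(\<Sum>i\<in>T. (\<Sum>u<n. \<Sum>a<d. z i u a * force x u a)\<^sup>2) \<le> (\<Sum>u<n. \<Sum>a<d. (force x u a)\<^sup>2)"
    by (simp add: sum.cartesian_product split_def)
  have "\<alpha> * (\<Sum>e\<in>edges. mode i e * x (fst e) (snd e))\<^sup>2 \<le> (\<Sum>u<n. \<Sum>a<d. z i u a * force x u a)\<^sup>2"
    if "i \<in> T" for i
  proof -
    have pos: "0 < lam i" using large[OF that] \<alpha>_pos by simp
    have "(\<Sum>e\<in>edges. mode i e * x (fst e) (snd e)) = (\<Sum>u<n. \<Sum>a<d. z i u a * force x u a) / sqrt (lam i)"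
    proof -
      have "(\<Sum>e\<in>edges. mode i e * x (fst e) (snd e)) = (\<Sum>(u, v)\<in>edges. strain (z i) u v * x u v) / sqrt (lam i)"
        unfolding sum_divide_distrib by (intro sum.cong refl) (auto simp: mode_def)
      then show ?thesis using strain_force_duality[where x=x and y="z i", OF sym] by simp
    qed
    then have "lam i * (\<Sum>e\<in>edges. mode i e * x (fst e) (snd e))\<^sup>2 = (\<Sum>u<n. \<Sum>a<d. z i u a * force x u a)\<^sup>2"
      using pos by (simp add: power_divide)
    moreover have "\<alpha> * (\<Sum>e\<in>edges. mode i e * x (fst e) (snd e))\<^sup>2 \<le> lam i * (\<Sum>e\<in>edges. mode i e * x (fst e) (snd e))\<^sup>2"
      by (rule mult_right_mono[OF large[OF that]]) simp
    ultimately show ?thesis by simp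
  qed
  then show ?thesis unfolding sum_distrib_left by (intro order.trans[OF sum_mono B])
qed

text \<open>A single stress might lie entirely in the missing dimensions. Averaging over a family
  with upper frame bound \<open>\<beta>\<close> limits the loss to \<open>\<beta>\<close> per
  missing dimension.\<close>

proposition stress_family_bound:
  assumes sym: "\<And>s u v. s \<in> S \<Longrightarrow> u < n \<Longrightarrow> v < n \<Longrightarrow> x s u v = x s v u"
    and frame: "\<And>g. (\<Sum>s\<in>S. (\<Sum>e\<in>edges. g e * x s (fst e) (snd e))\<^sup>2) \<le> \<beta> * (\<Sum>e\<in>edges. (g e)\<^sup>2)"
  shows "\<alpha> * ((\<Sum>s\<in>S. \<Sum>e\<in>edges. (x s (fst e) (snd e))\<^sup>2) - \<beta> * (real (card edges) - real (card T)))
    \<le> (\<Sum>s\<in>S. \<Sum>u<n. \<Sum>a<d. (force (x s) u a)\<^sup>2)"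
proof -
  have "(\<Sum>s\<in>S. \<Sum>e\<in>edges. (x s (fst e) (snd e))\<^sup>2) - \<beta> * (real (card edges) - real (card T))
      \<le> (\<Sum>s\<in>S. \<Sum>i\<in>T. (\<Sum>e\<in>edges. mode i e * x s (fst e) (snd e))\<^sup>2)"
    by (rule captured_energy_lower_bound[OF fin_T finite_edges mode_orthonormal frame])
  then have "\<alpha> * ((\<Sum>s\<in>S. \<Sum>e\<in>edges. (x s (fst e) (snd e))\<^sup>2) - \<beta> * (real (card edges) - real (card T)))
      \<le> \<alpha> * (\<Sum>s\<in>S. \<Sum>i\<in>T. (\<Sum>e\<in>edges. mode i e * x s (fst e) (snd e))\<^sup>2)"
    using \<alpha>_pos by simp
  also have "\<dots> \<le> (\<Sum>s\<in>S. \<Sum>u<n. \<Sum>a<d. (force (x s) u a)\<^sup>2)"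
    unfolding sum_distrib_left[of \<alpha> _ S] by (intro sum_mono force_energy_ge sym)
  finally show ?thesis .
qed

text \<open>Strains vanish on edges of length zero, so the orthonormal modes live on the other
  edges, and counting dimensions there bounds their number. This later restricts coinciding
  vertices.\<close>

lemma card_T_le: "card T \<le> card {e \<in> edges. len (fst e) (snd e) \<noteq> 0}"
proof -
  let ?E = "{e \<in> edges. len (fst e) (snd e) \<noteq> 0}"
  have zero: "mode i e = 0" if "e \<in> edges - ?E" for i e
    using that by (auto simp: mode_def strain_def dir_def split_def)
  have row: "(\<Sum>i\<in>T. (mode i e)\<^sup>2) \<le> 1" if "e \<in> edges" for e
    using bessel_inequality[OF fin_T mode_orthonormal, of "\<lambda>e'. if e' = e then 1 else 0"] that
    by (simp add: if_distrib[of "(*) _"] if_distrib[of "\<lambda>x. x\<^sup>2"] cong: if_cong)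
  have "real (card T) = (\<Sum>i\<in>T. \<Sum>e\<in>edges. (mode i e)\<^sup>2)"
    by (simp add: mode_orthonormal power2_eq_square)
  also have "\<dots> = (\<Sum>e\<in>edges. \<Sum>i\<in>T. (mode i e)\<^sup>2)" by (rule sum.swap)
  also have "\<dots> = (\<Sum>e\<in>?E. \<Sum>i\<in>T. (mode i e)\<^sup>2)"
    by (rule sum.mono_neutral_right) (use zero in auto)
  also have "\<dots> \<le> (\<Sum>e\<in>?E. 1)" by (intro sum_mono row) auto
  finally show ?thesis by simp
qed

section \<open>Trace over displacements orthogonal to a field of unit vectors\<close>

lemma weighted_block:
  assumes "u < n" "a < d" "b < d"
  shows "(\<Sum>i\<in>I. lam i * z i u a * z i u b) = (\<Sum>v<n. dir u v a * dir u v b)"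
proof -
  have "(\<Sum>i\<in>I. lam i * z i u a * z i u b) = (\<Sum>i\<in>I. force (strain (z i)) u a * z i u b)"
    by (intro sum.cong refl) (simp add: eigen assms)
  also have "\<dots> = (\<Sum>i\<in>I. \<Sum>v<n. \<Sum>c<d. dir u v a * dir u v c * (z i u c * z i u b - z i v c * z i u b))"
    by (simp add: force_def strain_def sum_distrib_left sum_distrib_right algebra_simps)
  also have "\<dots> = (\<Sum>v<n. \<Sum>c<d. \<Sum>i\<in>I. dir u v a * dir u v c * (z i u c * z i u b - z i v c * z i u b))"
    by (subst sum.swap, rule sum.cong[OF refl], subst sum.swap, rule refl)
  also have "\<dots> = (\<Sum>v<n. \<Sum>c<d. dir u v a * dir u v c * (if c = b then 1 else 0))"
  proof (intro sum.cong refl)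
    fix v c assume "v \<in> {..<n}" "c \<in> {..<d}"
    then show "(\<Sum>i\<in>I. dir u v a * dir u v c * (z i u c * z i u b - z i v c * z i u b)) = dir u v a * dir u v c * (if c = b then 1 else 0)"
      using assms by (cases "u = v") (simp_all add: sum_distrib_left[symmetric] sum_subtractf complete)
  qed
  also have "\<dots> = (\<Sum>v<n. dir u v a * dir u v b)"
    using assms by (simp add: if_distrib[of "(*) _"] cong: if_cong)
  finally show ?thesis .
qed

text \<open>The forces of a symmetric stress cancel in total, so an eigenvector of positive
  eigenvalue is orthogonal to all translations.\<close>

lemma sum_eigenvector_eq_0:
  assumes "i \<in> T" "a < d"
  shows "(\<Sum>u<n. z i u a) = 0"
proof -
  have "lam i * (\<Sum>u<n. z i u a) = (\<Sum>u<n. force (strain (z i)) u a)"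
    unfolding sum_distrib_left by (intro sum.cong refl) (use assms T_sub in \<open>auto simp: eigen\<close>)
  also have "\<dots> = 0"
  proof -
    have "(\<Sum>u<n. \<Sum>v<n. strain (z i) u v * dir u v a) = (\<Sum>v<n. \<Sum>u<n. strain (z i) u v * dir u v a)"
      by (rule sum.swap)
    also have "\<dots> = (\<Sum>v<n. \<Sum>u<n. - (strain (z i) v u * dir v u a))"
      by (intro sum.cong refl) (metis dir_antisym mult_minus_right strain_sym)
    finally show ?thesis by (simp add: sum_negf force_def)
  qed
  finally have "lam i * (\<Sum>u<n. z i u a) = 0" .
  then show ?thesis using large[OF assms(1)] \<alpha>_pos by auto
qed

text \<open>The right-hand side is the trace of the stiffness matrix over the displacements that are
  orthogonal to \<open>w u\<close> at each \<open>u\<close>. The directions \<open>w u\<close> span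
  \<open>n\<close> dimensions, but they take at most \<open>n - 1\<close> from the eigenvectors in
  \<open>T\<close>, because these are orthogonal to translations.\<close>

proposition transversal_trace_bound:
  assumes unit: "\<And>u. u < n \<Longrightarrow> (\<Sum>a<d. (w u a)\<^sup>2) = 1"
  shows "\<alpha> * (real (card T) - (real n - 1))
    \<le> (\<Sum>u<n. \<Sum>v<n. (\<Sum>a<d. (dir u v a)\<^sup>2) - (\<Sum>a<d. w u a * dir u v a)\<^sup>2)"
proof -
  define g where "g i u = (\<Sum>a<d. w u a * z i u a)" for i u
  have g1: "(\<Sum>u<n. (g i u)\<^sup>2) \<le> 1" if "i \<in> I" for i
  proof -
    have "(g i u)\<^sup>2 \<le> (\<Sum>a<d. (z i u a)\<^sup>2)" if "u < n" for u
      using Cauchy_Schwarz_ineq_sum[of "w u" "z i u" "{..<d}"] unit[OF that] by (simp add: g_def)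
    then have "(\<Sum>u<n. (g i u)\<^sup>2) \<le> (\<Sum>u<n. \<Sum>a<d. (z i u a)\<^sup>2)" by (intro sum_mono) auto
    also have "\<dots> = 1" using orthonormal[OF that that] by (simp add: power2_eq_square)
    finally show ?thesis .
  qed
  have gT: "(\<Sum>i\<in>T. (g i u)\<^sup>2) \<le> 1 - 1 / real n" if u: "u < n" for u
  proof -
    \<comment> \<open>The displacement \<open>w u\<close> at the vertex \<open>u\<close>, minus its
      mean over all vertices. Eigenvectors in \<open>T\<close> do not notice the subtraction, which
      lowers the squared norm from \<open>1\<close> to \<open>1 - 1 / n\<close>.\<close>
    define x where "x = (\<lambda>(v, a). w u a * ((if v = u then 1 else 0) - 1 / real n))"
    let ?V = "{..<n} \<times> {..<d}"
    have "(\<Sum>i\<in>T. (\<Sum>e\<in>?V. z i (fst e) (snd e) * x e)\<^sup>2) \<le> (\<Sum>e\<in>?V. (x e)\<^sup>2)"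
    proof (rule bessel_inequality[OF fin_T])
      fix i j assume "i \<in> T" "j \<in> T"
      then show "(\<Sum>e\<in>?V. z i (fst e) (snd e) * z j (fst e) (snd e)) = (if i = j then 1 else 0)"
        using orthonormal[of i j] T_sub by (auto simp: sum.cartesian_product split_def subset_iff)
    qed
    also have "(\<Sum>e\<in>?V. (x e)\<^sup>2) = (\<Sum>v<n. \<Sum>a<d. (w u a)\<^sup>2 * ((if v = u then 1 else 0) - 1 / real n)\<^sup>2)"
      by (simp add: x_def sum.cartesian_product split_def power_mult_distrib)
    also have "\<dots> = (\<Sum>v<n. ((if v = u then 1 else 0) - 1 / real n)\<^sup>2)"
      by (simp add: sum_distrib_right[symmetric] unit[OF u])
    also have "\<dots> = (\<Sum>v<n. (if v = u then 1 - 2 / real n else 0) + 1 / (real n)\<^sup>2)"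
      by (intro sum.cong refl) (simp add: power2_eq_square field_simps)
    also have "\<dots> = 1 - 1 / real n"
      using u by (simp add: sum.distrib power2_eq_square)
    finally have "(\<Sum>i\<in>T. (\<Sum>e\<in>?V. z i (fst e) (snd e) * x e)\<^sup>2) \<le> 1 - 1 / real n" .
    moreover have "(\<Sum>e\<in>?V. z i (fst e) (snd e) * x e) = g i u" if i: "i \<in> T" for i
    proof -
      have "(\<Sum>e\<in>?V. z i (fst e) (snd e) * x e) = (\<Sum>a<d. \<Sum>v<n. z i v a * (w u a * ((if v = u then 1 else 0) - 1 / real n)))"
        by (subst sum.swap) (simp add: x_def sum.cartesian_product split_def)
      also have "\<dots> = (\<Sum>a<d. w u a * ((\<Sum>v<n. if v = u then z i v a else 0) - (\<Sum>v<n. z i v a) / real n))"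
        unfolding sum_divide_distrib sum_subtractf[symmetric] sum_distrib_left
        by (intro sum.cong refl) (simp add: algebra_simps)
      also have "\<dots> = g i u"
        unfolding g_def using u by (intro sum.cong refl) (simp add: sum_eigenvector_eq_0[OF i])
      finally show ?thesis .
    qed
    ultimately show ?thesis by simp
  qed
  have "\<alpha> * (real (card T) - (real n - 1)) = \<alpha> * ((\<Sum>i\<in>T. 1) - (\<Sum>u<n. 1 - 1 / real n))"
    using n_pos by (simp add: field_simps)
  also have "\<dots> \<le> \<alpha> * ((\<Sum>i\<in>T. 1) - (\<Sum>u<n. \<Sum>i\<in>T. (g i u)\<^sup>2))"
    using \<alpha>_pos by (intro mult_left_mono diff_left_mono sum_mono gT) auto
  also have "\<dots> = (\<Sum>i\<in>T. \<alpha> * (1 - (\<Sum>u<n. (g i u)\<^sup>2)))"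
    by (subst sum.swap) (simp add: sum_subtractf flip: sum_distrib_left)
  also have "\<dots> \<le> (\<Sum>i\<in>T. lam i * (1 - (\<Sum>u<n. (g i u)\<^sup>2)))"
    by (intro sum_mono mult_right_mono) (use large g1 T_sub in auto)
  \<comment> \<open>Indices outside \<open>T\<close> only add nonnegative terms, and the sum over
    all of \<open>I\<close> is a trace that the diagonal blocks evaluate.\<close>
  also have "\<dots> \<le> (\<Sum>i\<in>I. lam i * (1 - (\<Sum>u<n. (g i u)\<^sup>2)))"
    by (intro sum_mono2 fin_I T_sub mult_nonneg_nonneg lam_nonneg) (use g1 in auto)
  also have "\<dots> = (\<Sum>i\<in>I. lam i * (\<Sum>u<n. \<Sum>a<d. (z i u a)\<^sup>2)) - (\<Sum>i\<in>I. lam i * (\<Sum>u<n. (g i u)\<^sup>2))"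
    unfolding sum_subtractf[symmetric]
    by (intro sum.cong refl) (use orthonormal in \<open>simp add: power2_eq_square right_diff_distrib\<close>)
  also have "(\<Sum>i\<in>I. lam i * (\<Sum>u<n. \<Sum>a<d. (z i u a)\<^sup>2)) = (\<Sum>u<n. \<Sum>a<d. \<Sum>i\<in>I. lam i * z i u a * z i u a)"
    unfolding sum_distrib_left
    by (subst sum.swap, rule sum.cong[OF refl], subst sum.swap) (simp add: power2_eq_square mult.assoc)
  also have "\<dots> = (\<Sum>u<n. \<Sum>v<n. \<Sum>a<d. (dir u v a)\<^sup>2)"
    by (rule sum.cong[OF refl], subst (2) sum.swap) (simp add: weighted_block power2_eq_square)
  also have "(\<Sum>i\<in>I. lam i * (\<Sum>u<n. (g i u)\<^sup>2)) = (\<Sum>u<n. \<Sum>v<n. (\<Sum>a<d. w u a * dir u v a)\<^sup>2)"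
  proof -
    have "(\<Sum>i\<in>I. lam i * (\<Sum>u<n. (g i u)\<^sup>2)) = (\<Sum>u<n. \<Sum>i\<in>I. lam i * (g i u)\<^sup>2)"
      unfolding sum_distrib_left by (rule sum.swap)
    also have "\<dots> = (\<Sum>u<n. \<Sum>v<n. (\<Sum>a<d. w u a * dir u v a)\<^sup>2)"
    proof (rule sum.cong[OF refl])
      fix u assume "u \<in> {..<n}"
      then have u: "u < n" by simp
      have "(\<Sum>i\<in>I. lam i * (g i u)\<^sup>2) = (\<Sum>i\<in>I. \<Sum>a<d. \<Sum>b<d. w u a * w u b * (lam i * z i u a * z i u b))"
        unfolding g_def power2_eq_square sum_product unfolding sum_distrib_left by (intro sum.cong refl) (simp add: mult_ac)
      also have "\<dots> = (\<Sum>a<d. \<Sum>b<d. \<Sum>i\<in>I. w u a * w u b * (lam i * z i u a * z i u b))"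
        by (subst sum.swap, rule sum.cong[OF refl], subst sum.swap, rule refl)
      also have "\<dots> = (\<Sum>a<d. \<Sum>b<d. \<Sum>v<n. w u a * w u b * (dir u v a * dir u v b))"
        unfolding sum_distrib_left[symmetric]
        by (rule sum.cong[OF refl], rule sum.cong[OF refl]) (simp add: weighted_block u)
      also have "\<dots> = (\<Sum>v<n. \<Sum>a<d. \<Sum>b<d. w u a * w u b * (dir u v a * dir u v b))"
        by (subst (2) sum.swap, subst sum.swap, rule refl)
      also have "\<dots> = (\<Sum>v<n. (\<Sum>a<d. w u a * dir u v a)\<^sup>2)"
        unfolding power2_eq_square sum_product by (intro sum.cong refl) (simp add: mult_ac)
      finally show "(\<Sum>i\<in>I. lam i * (g i u)\<^sup>2) = (\<Sum>v<n. (\<Sum>a<d. w u a * dir u v a)\<^sup>2)" .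
    qed
    finally show ?thesis .
  qed
  finally show ?thesis by (simp add: sum_subtractf)
qed

end

section \<open>Balanced masses\<close>

locale balanced_masses = bar_framework +
  fixes m :: "nat \<Rightarrow> real" and \<kappa> :: real
  assumes m_pos: "\<And>u. u < n \<Longrightarrow> 0 < m u" and m_sum: "(\<Sum>u<n. m u) = 1"
    and balanced: "\<And>u. u < n \<Longrightarrow> m u * (\<Sum>v<n. m v * (len u v)\<^sup>2) = \<kappa>"
    and noncoincident: "\<exists>u<n. \<exists>v<n. len u v \<noteq> 0"
begin

definition y :: "nat \<Rightarrow> nat \<Rightarrow> real" where
  "y u a = q u a - (\<Sum>v<n. m v * q v a)"

definition r2 :: "nat \<Rightarrow> real" where "r2 u = (\<Sum>a<d. (y u a)\<^sup>2)"

definition V :: real where "V = (\<Sum>u<n. m u * r2 u)"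

lemma y_diff: "y u a - y v a = q u a - q v a" unfolding y_def by simp

lemma centered: "(\<Sum>u<n. m u * y u a) = 0"
  by (simp add: y_def right_diff_distrib sum_subtractf flip: sum_distrib_right) (simp add: m_sum)

lemma len_sq_y: "(len u v)\<^sup>2 = (\<Sum>a<d. (y u a - y v a)\<^sup>2)" by (simp add: len_sq y_diff)

lemma len_sq_r2: "(len u v)\<^sup>2 = r2 u + r2 v - 2 * (\<Sum>a<d. y u a * y v a)"
  unfolding len_sq_y r2_def by (simp add: power2_diff sum.distrib sum_subtractf sum_distrib_left mult.assoc)

lemma r2_nonneg: "0 \<le> r2 u" unfolding r2_def by (intro sum_nonneg) auto

lemma sum_weighted_inner:
  assumes "\<And>a. (\<Sum>v<n. w v * y v a) = c a"
  shows "(\<Sum>v<n. w v * (\<Sum>a<d. y u a * y v a)) = (\<Sum>a<d. y u a * c a)"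
proof -
  have "(\<Sum>v<n. w v * (\<Sum>a<d. y u a * y v a)) = (\<Sum>v<n. \<Sum>a<d. y u a * (w v * y v a))"
    by (simp add: sum_distrib_left mult_ac)
  also have "\<dots> = (\<Sum>a<d. \<Sum>v<n. y u a * (w v * y v a))" by (rule sum.swap)
  also have "\<dots> = (\<Sum>a<d. y u a * c a)" by (simp add: assms flip: sum_distrib_left)
  finally show ?thesis .
qed

lemma star_sum: "(\<Sum>v<n. m v * (len u v)\<^sup>2) = r2 u + V"
proof -
  have "(\<Sum>v<n. m v * (len u v)\<^sup>2) = (\<Sum>v<n. m v * r2 u + m v * r2 v - 2 * (m v * (\<Sum>a<d. y u a * y v a)))"
    by (intro sum.cong refl) (simp add: len_sq_r2 algebra_simps)
  also have "\<dots> = r2 u + V - 2 * (\<Sum>v<n. m v * (\<Sum>a<d. y u a * y v a))"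
    by (simp add: sum.distrib sum_subtractf V_def m_sum flip: sum_distrib_left sum_distrib_right)
  also have "(\<Sum>v<n. m v * (\<Sum>a<d. y u a * y v a)) = 0"
    using sum_weighted_inner[OF centered] by simp
  finally show ?thesis by simp
qed

text \<open>\<open>star_sum\<close> turns the balance condition into constancy of
  \<open>m u * (r2 u + V)\<close>, and summing over \<open>u\<close> identifies the constant. Each
  mass is thus determined by its distance from the barycentre.\<close>

lemma mass_radius:
  assumes "u < n" shows "m u * (r2 u + V) = 2 * V / real n"
proof -
  have \<kappa>: "m v * (r2 v + V) = \<kappa>" if "v < n" for v using balanced[OF that] by (simp add: star_sum)
  have "real n * \<kappa> = (\<Sum>v<n. m v * (r2 v + V))" using \<kappa> by simp
  also have "\<dots> = 2 * V" by (simp add: distrib_left sum.distrib V_def m_sum flip: sum_distrib_right)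
  finally show ?thesis using \<kappa>[OF assms] n_pos by (simp add: field_simps)
qed

lemma V_pos: "0 < V"
proof -
  have nn: "0 \<le> m u * r2 u" if "u < n" for u using m_pos[OF that] r2_nonneg[of u] by simp
  have "V \<noteq> 0"
  proof
    assume "V = 0"
    then have "\<forall>u\<in>{..<n}. m u * r2 u = 0"
      unfolding V_def by (subst (asm) sum_nonneg_eq_0_iff) (use nn in auto)
    then have "r2 u = 0" if "u < n" for u using m_pos[of u] that by force
    then have "y u a = 0" if "u < n" "a < d" for u a
      using that unfolding r2_def by (subst (asm) sum_nonneg_eq_0_iff) auto
    then have "(len u v)\<^sup>2 = 0" if "u < n" "v < n" for u v using that by (simp add: len_sq_y)
    then show False using noncoincident by auto
  qed
  moreover have "0 \<le> V" unfolding V_def by (intro sum_nonneg) (use nn in auto)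
  ultimately show ?thesis by simp
qed

lemma mass_le: assumes "u < n" shows "m u \<le> 2 / real n"
proof -
  have "m u * V \<le> m u * (r2 u + V)"
    using m_pos[OF assms] r2_nonneg by (intro mult_left_mono) auto
  then have "m u * V \<le> 2 / real n * V" by (simp add: mass_radius[OF assms])
  then show ?thesis by (rule mult_right_le_imp_le[OF _ V_pos])
qed

text \<open>Up to a constant, \<open>m u * m v * (len u v)\<^sup>2\<close> is the squared chordal distance of the images of
  the two points under a stereographic projection, which explains the uniform bound.\<close>

lemma weight_le:
  assumes "u < n" "v < n"
  shows "m u * m v * (len u v)\<^sup>2 \<le> 4 * V / (real n)\<^sup>2"
proof -
  let ?p = "\<Sum>a<d. y u a * y v a"
  have cs: "?p\<^sup>2 \<le> r2 u * r2 v"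
    unfolding r2_def by (rule Cauchy_Schwarz_ineq_sum)
  have "0 \<le> (V + ?p)\<^sup>2" by simp
  then have "- 2 * V * ?p \<le> V\<^sup>2 + r2 u * r2 v" using cs by (simp add: power2_sum)
  then have "V * (len u v)\<^sup>2 \<le> (r2 u + V) * (r2 v + V)"
    unfolding len_sq_r2 by (simp add: algebra_simps power2_eq_square)
  then have "m u * m v * (V * (len u v)\<^sup>2) \<le> m u * m v * ((r2 u + V) * (r2 v + V))"
    using m_pos assms by (intro mult_left_mono) (auto simp: less_imp_le)
  also have "\<dots> = (m u * (r2 u + V)) * (m v * (r2 v + V))" by simp
  also have "\<dots> = V * (4 * V / (real n)\<^sup>2)"
    unfolding mass_radius[OF assms(1)] mass_radius[OF assms(2)] by (simp add: power2_eq_square)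
  finally have "V * (m u * m v * (len u v)\<^sup>2) \<le> V * (4 * V / (real n)\<^sup>2)" by (simp add: mult_ac)
  then show ?thesis by (rule mult_left_le_imp_le[OF _ V_pos])
qed

definition S2 :: real where "S2 = (\<Sum>u<n. (m u)\<^sup>2)"

lemma S2_ge: "1 / real n \<le> S2"
proof -
  have "(\<Sum>u<n. m u * 1)\<^sup>2 \<le> (\<Sum>u<n. (m u)\<^sup>2) * (\<Sum>u<n. 1\<^sup>2)" by (rule Cauchy_Schwarz_ineq_sum)
  then show ?thesis using n_pos by (simp add: m_sum S2_def field_simps)
qed

lemma sum_m_sq_r2: "(\<Sum>u<n. (m u)\<^sup>2 * r2 u) = 2 * V / real n - V * S2"
proof -
  have "(\<Sum>u<n. (m u)\<^sup>2 * r2 u) = (\<Sum>u<n. m u * (2 * V / real n) - V * (m u)\<^sup>2)"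
    by (intro sum.cong refl) (simp add: mass_radius[symmetric] power2_eq_square algebra_simps)
  also have "\<dots> = (\<Sum>u<n. m u) * (2 * V / real n) - V * S2"
    by (simp only: sum_subtractf S2_def sum_distrib_left sum_distrib_right)
  finally show ?thesis by (simp add: m_sum)
qed

text \<open>The one term of the total stress energy that the balance condition does not evaluate;
  the divisor makes it invariant under scaling of the points.\<close>

definition W :: real where "W = (\<Sum>u<n. \<Sum>v<n. (m u)\<^sup>2 * (m v)\<^sup>2 * (len u v)\<^sup>2) / (2 * V)"

lemma W_nonneg: "0 \<le> W" unfolding W_def using V_pos by (intro divide_nonneg_pos sum_nonneg) auto

text \<open>\<open>t\<close> measures how unequal the masses are. Expanding the squared lengths
  leaves the squared norm of \<open>c\<close> as the only unknown. Since \<open>y\<close> is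
  centred, \<open>c\<close> sees only the deviations \<open>m v - 1 / n\<close>, and Cauchy-Schwarz
  with weights \<open>m\<close>, together with \<open>mass_le\<close>, bounds it.\<close>

lemma W_ge:
  defines "t \<equiv> S2 - 1 / real n"
  shows "1 / (real n)\<^sup>2 - t\<^sup>2 - 2 * t / real n \<le> W"
proof -
  define c where "c a = (\<Sum>v<n. (m v)\<^sup>2 * y v a)" for a
  have "(\<Sum>u<n. \<Sum>v<n. (m u)\<^sup>2 * (m v)\<^sup>2 * (len u v)\<^sup>2)
      = (\<Sum>u<n. \<Sum>v<n. (m u)\<^sup>2 * r2 u * (m v)\<^sup>2 + (m u)\<^sup>2 * ((m v)\<^sup>2 * r2 v) - 2 * ((m u)\<^sup>2 * ((m v)\<^sup>2 * (\<Sum>a<d. y u a * y v a))))"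
    by (intro sum.cong refl) (simp add: len_sq_r2 algebra_simps)
  also have "\<dots> = (\<Sum>u<n. (m u)\<^sup>2 * r2 u) * S2 + S2 * (\<Sum>u<n. (m u)\<^sup>2 * r2 u)
      - 2 * (\<Sum>u<n. (m u)\<^sup>2 * (\<Sum>v<n. (m v)\<^sup>2 * (\<Sum>a<d. y u a * y v a)))"
    by (simp add: sum.distrib sum_subtractf S2_def flip: sum_distrib_left sum_distrib_right)
  also have "(\<Sum>u<n. (m u)\<^sup>2 * (\<Sum>v<n. (m v)\<^sup>2 * (\<Sum>a<d. y u a * y v a))) = (\<Sum>a<d. (c a)\<^sup>2)"
  proof -
    have "(\<Sum>u<n. (m u)\<^sup>2 * (\<Sum>v<n. (m v)\<^sup>2 * (\<Sum>a<d. y u a * y v a))) = (\<Sum>u<n. \<Sum>a<d. (m u)\<^sup>2 * y u a * c a)"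
    proof -
      have "(\<Sum>v<n. (m v)\<^sup>2 * (\<Sum>a<d. y u a * y v a)) = (\<Sum>a<d. y u a * c a)" for u
        by (rule sum_weighted_inner) (simp add: c_def)
      then show ?thesis by (simp add: sum_distrib_left mult.assoc)
    qed
    also have "\<dots> = (\<Sum>a<d. \<Sum>u<n. (m u)\<^sup>2 * y u a * c a)" by (rule sum.swap)
    also have "\<dots> = (\<Sum>a<d. (c a)\<^sup>2)"
    proof -
      have "(\<Sum>u<n. (m u)\<^sup>2 * y u a * c a) = c a * c a" for a
        unfolding sum_distrib_right[symmetric] by (simp add: c_def)
      then show ?thesis by (simp add: power2_eq_square[of "c _"])
    qed
    finally show ?thesis .
  qed
  finally have eq: "2 * V * W = 2 * S2 * (2 * V / real n - V * S2) - 2 * (\<Sum>a<d. (c a)\<^sup>2)"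
    using V_pos by (simp add: W_def sum_m_sq_r2)
  have "(c a)\<^sup>2 \<le> (\<Sum>v<n. m v * (m v - 1 / real n)\<^sup>2) * (\<Sum>v<n. m v * (y v a)\<^sup>2)" for a
  proof -
    have "c a = (\<Sum>v<n. (sqrt (m v) * (m v - 1 / real n)) * (sqrt (m v) * y v a))"
    proof -
      have "(\<Sum>v<n. (sqrt (m v) * (m v - 1 / real n)) * (sqrt (m v) * y v a)) = (\<Sum>v<n. (m v)\<^sup>2 * y v a - 1 / real n * (m v * y v a))"
      proof (intro sum.cong refl)
        fix v assume "v \<in> {..<n}"
        then have "0 < m v" using m_pos by simp
        then have "(sqrt (m v) * (m v - 1 / real n)) * (sqrt (m v) * y v a) = m v * (m v - 1 / real n) * y v a"
          by (simp add: mult_ac flip: real_sqrt_mult)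
        then show "(sqrt (m v) * (m v - 1 / real n)) * (sqrt (m v) * y v a) = (m v)\<^sup>2 * y v a - 1 / real n * (m v * y v a)"
          by (simp add: algebra_simps power2_eq_square)
      qed
      also have "\<dots> = c a" by (simp add: sum_subtractf c_def centered flip: sum_divide_distrib)
      finally show ?thesis by simp
    qed
    then have "(c a)\<^sup>2 \<le> (\<Sum>v<n. (sqrt (m v) * (m v - 1 / real n))\<^sup>2) * (\<Sum>v<n. (sqrt (m v) * y v a)\<^sup>2)"
      by (simp only: Cauchy_Schwarz_ineq_sum)
    then show ?thesis using m_pos by (simp add: power_mult_distrib less_imp_le)
  qed
  then have "(\<Sum>a<d. (c a)\<^sup>2) \<le> (\<Sum>a<d. (\<Sum>v<n. m v * (m v - 1 / real n)\<^sup>2) * (\<Sum>v<n. m v * (y v a)\<^sup>2))"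
    by (intro sum_mono) auto
  also have "\<dots> = (\<Sum>v<n. m v * (m v - 1 / real n)\<^sup>2) * V"
  proof -
    have "(\<Sum>a<d. \<Sum>v<n. m v * (y v a)\<^sup>2) = V"
      unfolding V_def r2_def by (subst sum.swap) (simp add: sum_distrib_left)
    then show ?thesis by (simp flip: sum_distrib_left)
  qed
  also have "\<dots> \<le> (2 * t / real n) * V"
  proof (rule mult_right_mono)
    have "(\<Sum>v<n. m v * (m v - 1 / real n)\<^sup>2) \<le> (\<Sum>v<n. 2 / real n * (m v - 1 / real n)\<^sup>2)"
      by (intro sum_mono mult_right_mono) (use mass_le in auto)
    also have "\<dots> = 2 / real n * (\<Sum>v<n. (m v)\<^sup>2 - 2 / real n * m v + 1 / (real n)\<^sup>2)"
      unfolding sum_distrib_left[symmetric]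
      by (intro arg_cong[of _ _ "(*) (2 / real n)"] sum.cong refl) (simp add: power2_eq_square algebra_simps)
    also have "(\<Sum>v<n. (m v)\<^sup>2 - 2 / real n * m v + 1 / (real n)\<^sup>2) = t"
    proof -
      have "(\<Sum>v<n. (m v)\<^sup>2 - 2 / real n * m v + 1 / (real n)\<^sup>2) = S2 - 2 / real n * (\<Sum>v<n. m v) + real n * (1 / (real n)\<^sup>2)"
        unfolding S2_def sum_distrib_left by (simp add: sum.distrib sum_subtractf)
      then show ?thesis using n_pos by (simp add: m_sum t_def power2_eq_square)
    qed
    finally show "(\<Sum>v<n. m v * (m v - 1 / real n)\<^sup>2) \<le> 2 * t / real n" by simp
  qed (use V_pos in simp)
  finally have "(\<Sum>a<d. (c a)\<^sup>2) \<le> 2 * t / real n * V" .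
  moreover have "2 * V * (S2 * (2 / real n - S2) - 2 * t / real n)
      = 2 * S2 * (2 * V / real n - V * S2) - 2 * (2 * t / real n * V)"
    by (simp add: algebra_simps)
  ultimately have "2 * V * W \<ge> 2 * V * (S2 * (2 / real n - S2) - 2 * t / real n)"
    unfolding eq by linarith
  then have "S2 * (2 / real n - S2) - 2 * t / real n \<le> W"
    by (rule mult_left_le_imp_le) (use V_pos in simp)
  moreover have "S2 * (2 / real n - S2) = 1 / (real n)\<^sup>2 - t\<^sup>2"
    using n_pos by (simp add: t_def power2_eq_square field_simps)
  ultimately show ?thesis by simp
qed

section \<open>The stress family built from balanced masses\<close>

definition \<theta> :: "nat \<Rightarrow> real" where "\<theta> u = sqrt (m u)"

definition P :: "nat \<Rightarrow> nat \<Rightarrow> real" where "P s u = (if s = u then 1 else 0) - \<theta> s * \<theta> u"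

lemma \<theta>_sq: "u < n \<Longrightarrow> (\<theta> u)\<^sup>2 = m u" unfolding \<theta>_def using m_pos[of u] by simp

lemma \<theta>_sum: "(\<Sum>u<n. (\<theta> u)\<^sup>2) = 1" using m_sum by (simp add: \<theta>_sq)

lemma P_sym: "P s u = P u s" by (simp add: P_def)

lemma P_apply: "s < n \<Longrightarrow> (\<Sum>u<n. P s u * h u) = h s - \<theta> s * (\<Sum>u<n. \<theta> u * h u)"
  by (simp add: P_def left_diff_distrib sum_subtractf if_distrib[of "\<lambda>x. x * _"] mult.assoc
      flip: sum_distrib_left cong: if_cong)

lemma P_theta: "s < n \<Longrightarrow> (\<Sum>u<n. P s u * \<theta> u) = 0"
  using \<theta>_sum by (simp add: P_apply power2_eq_square)

lemma P_idem:
  assumes "u < n" "v < n" shows "(\<Sum>s<n. P s u * P s v) = P u v"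
proof -
  have "(\<Sum>s<n. P s u * P s v) = (\<Sum>s<n. P v s * P u s)"
    by (simp add: P_sym[of _ u] P_sym[of _ v] mult.commute)
  also have "\<dots> = P u v"
    using P_theta[OF assms(1)] by (simp add: P_apply[OF assms(2)] P_sym[of v u] mult.commute[of "\<theta> _" "P _ _"])
  finally show ?thesis .
qed

lemma P_contraction: "(\<Sum>s<n. (\<Sum>u<n. P s u * h u)\<^sup>2) \<le> (\<Sum>u<n. (h u)\<^sup>2)"
proof -
  define c where "c = (\<Sum>u<n. \<theta> u * h u)"
  have "(\<Sum>s<n. (\<Sum>u<n. P s u * h u)\<^sup>2) = (\<Sum>s<n. (h s - \<theta> s * c)\<^sup>2)"
    by (intro sum.cong refl) (simp add: P_apply c_def)
  also have "\<dots> = (\<Sum>s<n. (h s)\<^sup>2 - 2 * c * (\<theta> s * h s) + c\<^sup>2 * (\<theta> s)\<^sup>2)"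
    by (intro sum.cong refl) (simp add: power2_eq_square algebra_simps)
  also have "\<dots> = (\<Sum>s<n. (h s)\<^sup>2) - 2 * c * c + c\<^sup>2 * (\<Sum>s<n. (\<theta> s)\<^sup>2)"
    by (simp add: sum.distrib sum_subtractf c_def flip: sum_distrib_left)
  finally show ?thesis using \<theta>_sum by (simp add: power2_eq_square)
qed

text \<open>The matrix unit at \<open>s\<close>, symmetrised, with the projection \<open>P\<close> along \<open>\<theta>\<close> applied on both sides
  and rescaled by \<open>\<theta>\<close> and the edge lengths.\<close>

definition x :: "nat \<times> nat \<Rightarrow> nat \<Rightarrow> nat \<Rightarrow> real" where
  "x = (\<lambda>(s, t) u v. len u v * \<theta> u * \<theta> v * (P s u * P t v + P t u * P s v) / 2)"

lemma stress_sym: "x s u v = x s v u"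
  by (simp add: x_def len_sym[of v u] split_def algebra_simps)

text \<open>After expanding the square, the sums over \<open>s\<close> and \<open>t\<close> are
  inner products of columns of the projection \<open>P\<close>, hence again entries of
  \<open>P\<close>.\<close>

lemma stress_energy:
  assumes "u < n" "v < n" "u \<noteq> v"
  shows "(\<Sum>s\<in>{..<n} \<times> {..<n}. (x s u v)\<^sup>2)
    = m u * m v * (len u v)\<^sup>2 * ((1 - m u) * (1 - m v) + m u * m v) / 2"
proof -
  let ?c = "m u * m v * (len u v)\<^sup>2 / 4"
  have Puu: "P u u = 1 - m u" "P v v = 1 - m v"
    using assms \<theta>_sq[of u] \<theta>_sq[of v] by (auto simp: P_def power2_eq_square)
  have Puv: "(P u v)\<^sup>2 = m u * m v"
    using assms by (simp add: P_def power_mult_distrib \<theta>_sq)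
  have "(\<Sum>s\<in>{..<n} \<times> {..<n}. (x s u v)\<^sup>2) = (\<Sum>s<n. \<Sum>t<n. ?c * (P s u * P t v + P t u * P s v)\<^sup>2)"
    using assms \<theta>_sq[of u] \<theta>_sq[of v]
    by (simp add: x_def sum.cartesian_product split_def power_mult_distrib power_divide mult_ac)
  also have "\<dots> = ?c * ((\<Sum>s<n. \<Sum>t<n. P s u * P s u * (P t v * P t v)) + (\<Sum>s<n. \<Sum>t<n. P s v * P s v * (P t u * P t u))
      + 2 * (\<Sum>s<n. \<Sum>t<n. P s u * P s v * (P t u * P t v)))"
    unfolding sum_distrib_left sum.distrib[symmetric]
    by (intro sum.cong refl) (simp add: power2_eq_square algebra_simps)
  also have "\<dots> = ?c * (P u u * P v v + P v v * P u u + 2 * (P u v * P u v))"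
    unfolding sum_product[symmetric] P_idem[OF assms(1,1)] P_idem[OF assms(2,2)] P_idem[OF assms(1,2)] ..
  finally show ?thesis unfolding Puu power2_eq_square[symmetric] Puv by (simp add: field_simps)
qed

text \<open>With \<open>g\<close> encoded as a symmetric matrix \<open>G\<close>, its pairing with
  the stress \<open>(s, t)\<close> is an entry of \<open>P G P\<close>. Applying the contraction
  \<open>P\<close> on both sides does not increase the Frobenius norm of \<open>G\<close>, and
  \<open>weight_le\<close> bounds the weights in \<open>G\<close>.\<close>

lemma stress_frame: "(\<Sum>s\<in>{..<n} \<times> {..<n}. (\<Sum>e\<in>edges. g e * x s (fst e) (snd e))\<^sup>2)
    \<le> 2 * V / (real n)\<^sup>2 * (\<Sum>e\<in>edges. (g e)\<^sup>2)"
proof -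
  define G where "G u v = g (min u v, max u v) * (len u v * \<theta> u * \<theta> v) / 2" for u v
  have G_sym: "G u v = G v u" for u v by (simp add: G_def len_sym[of u v] min.commute max.commute)
  have G_diag: "G u u = 0" for u by (simp add: G_def)
  have inner: "(\<Sum>e\<in>edges. g e * x (s, t) (fst e) (snd e)) = (\<Sum>u<n. P s u * (\<Sum>v<n. P t v * G v u))" for s t
  proof -
    have "2 * (\<Sum>e\<in>edges. g e * x (s, t) (fst e) (snd e)) = 2 * (\<Sum>(u, v)\<in>edges. G u v * (P s u * P t v + P t u * P s v))"
      by (intro arg_cong[of _ _ "(*) 2"] sum.cong refl) (auto simp: edges_def x_def G_def)
    also have "\<dots> = (\<Sum>u<n. \<Sum>v<n. G u v * (P s u * P t v + P t u * P s v))"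
      unfolding edges_def by (rule sum_lessThan_pairs_symmetric[symmetric]) (auto simp: G_diag G_sym algebra_simps)
    also have "\<dots> = (\<Sum>u<n. \<Sum>v<n. G u v * (P s u * P t v)) + (\<Sum>u<n. \<Sum>v<n. G u v * (P t u * P s v))"
      by (simp add: distrib_left sum.distrib)
    also have "(\<Sum>u<n. \<Sum>v<n. G u v * (P t u * P s v)) = (\<Sum>u<n. \<Sum>v<n. G u v * (P s u * P t v))"
      by (subst sum.swap) (simp add: G_sym[of _ "_ :: nat"] mult.commute)
    also have "(\<Sum>u<n. \<Sum>v<n. G u v * (P s u * P t v)) = (\<Sum>u<n. P s u * (\<Sum>v<n. P t v * G v u))"
      unfolding sum_distrib_left by (intro sum.cong refl) (simp add: G_sym mult_ac)
    finally show ?thesis by simp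
  qed
  have "(\<Sum>s\<in>{..<n} \<times> {..<n}. (\<Sum>e\<in>edges. g e * x s (fst e) (snd e))\<^sup>2)
      = (\<Sum>t<n. \<Sum>s<n. (\<Sum>u<n. P s u * (\<Sum>v<n. P t v * G v u))\<^sup>2)"
    by (subst sum.swap) (simp add: sum.cartesian_product split_def flip: inner)
  also have "\<dots> \<le> (\<Sum>t<n. \<Sum>u<n. (\<Sum>v<n. P t v * G v u)\<^sup>2)"
    by (intro sum_mono P_contraction)
  also have "\<dots> = (\<Sum>u<n. \<Sum>t<n. (\<Sum>v<n. P t v * G v u)\<^sup>2)" by (rule sum.swap)
  also have "\<dots> \<le> (\<Sum>u<n. \<Sum>v<n. (G v u)\<^sup>2)" by (intro sum_mono P_contraction)
  also have "\<dots> = 2 * (\<Sum>(u, v)\<in>edges. (G v u)\<^sup>2)"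
    unfolding edges_def by (rule sum_lessThan_pairs_symmetric) (auto simp: G_diag G_sym)
  also have "\<dots> \<le> 2 * (\<Sum>e\<in>edges. V / (real n)\<^sup>2 * (g e)\<^sup>2)"
  proof (intro mult_left_mono sum_mono)
    fix e assume "e \<in> edges"
    then obtain u v where e: "e = (u, v)" "u < v" "v < n" by (auto simp: edges_def)
    have "(G v u)\<^sup>2 = (m u * m v * (len u v)\<^sup>2) * (g (u, v))\<^sup>2 / 4"
      using e \<theta>_sq[of u] \<theta>_sq[of v] by (simp add: G_def len_sym[of v u] power_mult_distrib power_divide mult_ac)
    also have "\<dots> \<le> 4 * V / (real n)\<^sup>2 * (g (u, v))\<^sup>2 / 4"
      using weight_le[of u v] e by (intro divide_right_mono mult_right_mono) auto
    finally show "(case e of (u, v) \<Rightarrow> (G v u)\<^sup>2) \<le> V / (real n)\<^sup>2 * (g e)\<^sup>2" using e by simp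
  qed simp
  finally show ?thesis by (simp add: sum_distrib_left sum_divide_distrib mult_ac)
qed

text \<open>The length in \<open>x\<close> cancels the normalisation of \<open>dir\<close>. The
  terms with \<open>y u\<close> then vanish because \<open>P\<close> kills \<open>\<theta>\<close>,
  while \<open>w a\<close> is orthogonal to \<open>\<theta>\<close> and hence fixed by
  \<open>P\<close>; this leaves the short formula \<open>F\<close>.\<close>

lemma stress_force: "(\<Sum>s\<in>{..<n} \<times> {..<n}. \<Sum>u<n. \<Sum>a<d. (force (x s) u a)\<^sup>2)
    = V * (1 + 2 / real n - 2 * S2) / 2"
proof -
  define w where "w a s = \<theta> s * y s a" for a s
  have w_orth: "(\<Sum>s<n. \<theta> s * w a s) = 0" for a
  proof -
    have "(\<Sum>s<n. \<theta> s * w a s) = (\<Sum>s<n. m s * y s a)"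
      by (intro sum.cong refl) (simp add: w_def power2_eq_square flip: \<theta>_sq)
    then show ?thesis by (simp add: centered)
  qed
  have Pw: "(\<Sum>v<n. P s v * w a v) = w a s" if "s < n" for s a using that by (simp add: P_apply w_orth)
  have F: "force (x (s, t)) u a = - \<theta> u * (P s u * w a t + P t u * w a s) / 2"
    if "s < n" "t < n" "u < n" "a < d" for s t u a
  proof -
    have "force (x (s, t)) u a = (\<Sum>v<n. \<theta> u * \<theta> v * (P s u * P t v + P t u * P s v) * (len u v * dir u v a) / 2)"
      by (simp add: force_def x_def mult_ac)
    also have "\<dots> = (\<Sum>v<n. \<theta> u * y u a / 2 * (P s u * (P t v * \<theta> v) + P t u * (P s v * \<theta> v))
        - \<theta> u / 2 * (P s u * (P t v * w a v) + P t u * (P s v * w a v)))"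
      unfolding len_dir[OF that(4)] y_diff[symmetric] by (intro sum.cong refl) (simp add: w_def field_simps)
    also have "\<dots> = \<theta> u * y u a / 2 * (P s u * (\<Sum>v<n. P t v * \<theta> v) + P t u * (\<Sum>v<n. P s v * \<theta> v))
        - \<theta> u / 2 * (P s u * (\<Sum>v<n. P t v * w a v) + P t u * (\<Sum>v<n. P s v * w a v))"
      by (simp only: sum_subtractf sum.distrib sum_distrib_left[symmetric])
    finally show ?thesis
      unfolding P_theta[OF that(1)] P_theta[OF that(2)] Pw[OF that(1)] Pw[OF that(2)] by (simp add: algebra_simps)
  qed
  have ww: "(\<Sum>s<n. w a s * w a s) = (\<Sum>s<n. m s * (y s a)\<^sup>2)" for a
    by (intro sum.cong refl) (simp add: w_def power2_eq_square flip: \<theta>_sq)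
  have E: "(\<Sum>s<n. \<Sum>t<n. (force (x (s, t)) u a)\<^sup>2) = m u * ((1 - m u) * (\<Sum>s<n. m s * (y s a)\<^sup>2) + m u * (y u a)\<^sup>2) / 2"
    if u: "u < n" "a < d" for u a
  proof -
    have Puu: "P u u = 1 - m u" using u \<theta>_sq[of u] by (simp add: P_def power2_eq_square)
    have Psum: "(\<Sum>s<n. P s u * w a s) = w a u" using Pw[OF u(1), of a] by (simp add: P_sym[of u])
    have "(\<Sum>s<n. \<Sum>t<n. (force (x (s, t)) u a)\<^sup>2) = (\<Sum>s<n. \<Sum>t<n. m u / 4 * (P s u * w a t + P t u * w a s)\<^sup>2)"
    proof (intro sum.cong refl)
      fix s t assume "s \<in> {..<n}" "t \<in> {..<n}"
      then show "(force (x (s, t)) u a)\<^sup>2 = m u / 4 * (P s u * w a t + P t u * w a s)\<^sup>2"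
        using u by (simp add: F power_mult_distrib power_divide \<theta>_sq)
    qed
    also have "\<dots> = m u / 4 * ((\<Sum>s<n. \<Sum>t<n. P s u * P s u * (w a t * w a t)) + (\<Sum>s<n. \<Sum>t<n. w a s * w a s * (P t u * P t u))
        + 2 * (\<Sum>s<n. \<Sum>t<n. P s u * w a s * (P t u * w a t)))"
      unfolding sum_distrib_left sum.distrib[symmetric]
      by (intro sum.cong refl) (simp add: power2_eq_square algebra_simps)
    also have "\<dots> = m u / 4 * (P u u * (\<Sum>t<n. w a t * w a t) + (\<Sum>t<n. w a t * w a t) * P u u + 2 * (w a u * w a u))"
      unfolding sum_product[symmetric] P_idem[OF u(1,1)] Psum ..
    also have "w a u * w a u = m u * (y u a)\<^sup>2"
      using u by (simp add: w_def power2_eq_square flip: \<theta>_sq)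
    finally show ?thesis unfolding Puu ww by (simp add: algebra_simps)
  qed
  have "(\<Sum>s\<in>{..<n} \<times> {..<n}. \<Sum>u<n. \<Sum>a<d. (force (x s) u a)\<^sup>2) = (\<Sum>s<n. \<Sum>t<n. \<Sum>u<n. \<Sum>a<d. (force (x (s, t)) u a)\<^sup>2)"
  proof -
    have "(\<Sum>s\<in>{..<n} \<times> {..<n}. G s) = (\<Sum>s<n. \<Sum>t<n. G (s, t))" for G :: "nat \<times> nat \<Rightarrow> real"
      by (simp add: sum.cartesian_product)
    then show ?thesis .
  qed
  also have "\<dots> = (\<Sum>u<n. \<Sum>a<d. \<Sum>s<n. \<Sum>t<n. (force (x (s, t)) u a)\<^sup>2)"
  proof -
    have "(\<Sum>s<n. \<Sum>t<n. \<Sum>u<n. \<Sum>a<d. (force (x (s, t)) u a)\<^sup>2) = (\<Sum>s<n. \<Sum>u<n. \<Sum>a<d. \<Sum>t<n. (force (x (s, t)) u a)\<^sup>2)"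
      by (rule sum.cong[OF refl], subst sum.swap, rule sum.cong[OF refl], rule sum.swap)
    also have "\<dots> = (\<Sum>u<n. \<Sum>a<d. \<Sum>s<n. \<Sum>t<n. (force (x (s, t)) u a)\<^sup>2)"
      by (subst sum.swap, rule sum.cong[OF refl], rule sum.swap)
    finally show ?thesis .
  qed
  also have "\<dots> = (\<Sum>u<n. \<Sum>a<d. m u * (1 - m u) / 2 * (\<Sum>s<n. m s * (y s a)\<^sup>2) + (m u)\<^sup>2 / 2 * (y u a)\<^sup>2)"
  proof (intro sum.cong refl)
    fix u a assume "u \<in> {..<n}" "a \<in> {..<d}"
    then have ua: "u < n" "a < d" by auto
    show "(\<Sum>s<n. \<Sum>t<n. (force (x (s, t)) u a)\<^sup>2)
      = m u * (1 - m u) / 2 * (\<Sum>s<n. m s * (y s a)\<^sup>2) + (m u)\<^sup>2 / 2 * (y u a)\<^sup>2"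
      unfolding E[OF ua] by (simp add: power2_eq_square field_simps)
  qed
  also have "\<dots> = (\<Sum>u<n. m u * (1 - m u) / 2 * V + (m u)\<^sup>2 * r2 u / 2)"
  proof -
    have "(\<Sum>a<d. \<Sum>v<n. m v * (y v a)\<^sup>2) = V"
      unfolding V_def r2_def by (subst sum.swap) (simp add: sum_distrib_left)
    then show ?thesis unfolding sum.distrib sum_distrib_left[symmetric] r2_def by simp
  qed
  also have "\<dots> = V / 2 * (\<Sum>u<n. m u - (m u)\<^sup>2) + (\<Sum>u<n. (m u)\<^sup>2 * r2 u) / 2"
    unfolding sum_distrib_left sum_divide_distrib sum.distrib[symmetric]
    by (intro sum.cong refl) (simp add: algebra_simps power2_eq_square)
  finally show ?thesis
    by (simp add: sum_m_sq_r2 sum_subtractf m_sum S2_def[symmetric]) (simp add: field_simps)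
qed

lemma stress_total_energy: "(\<Sum>s\<in>{..<n} \<times> {..<n}. \<Sum>e\<in>edges. (x s (fst e) (snd e))\<^sup>2) = V * (1 - 2 / real n + 2 * W) / 2"
proof -
  have "(\<Sum>s\<in>{..<n} \<times> {..<n}. \<Sum>e\<in>edges. (x s (fst e) (snd e))\<^sup>2)
      = (\<Sum>e\<in>edges. \<Sum>s\<in>{..<n} \<times> {..<n}. (x s (fst e) (snd e))\<^sup>2)" by (rule sum.swap)
  also have "\<dots> = (\<Sum>(u, v)\<in>edges. m u * m v * (len u v)\<^sup>2 * ((1 - m u) * (1 - m v) + m u * m v) / 2)"
    by (intro sum.cong refl) (auto simp: edges_def stress_energy)
  also have "\<dots> = (\<Sum>u<n. \<Sum>v<n. m u * m v * (len u v)\<^sup>2 * ((1 - m u) * (1 - m v) + m u * m v) / 2) / 2"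
    unfolding edges_def by (subst sum_lessThan_pairs_symmetric) (auto simp: len_sym algebra_simps)
  \<comment> \<open>Here \<open>(1 - m u) * (1 - m v) + m u * m v\<close> is expanded. All terms
    except the last are star sums, which the balance condition evaluates; the last one is
    \<open>W\<close>.\<close>
  also have "\<dots> = (\<Sum>u<n. \<Sum>v<n. m u / 4 * (m v * (len u v)\<^sup>2) - (m u)\<^sup>2 / 4 * (m v * (len u v)\<^sup>2)
      - m v / 4 * m v * (m u * (len u v)\<^sup>2) + (m u)\<^sup>2 * (m v)\<^sup>2 * (len u v)\<^sup>2 / 2)"
    unfolding sum_divide_distrib by (intro sum.cong refl) (simp add: field_simps power2_eq_square)
  also have "\<dots> = (\<Sum>u<n. m u / 4 * (r2 u + V)) - (\<Sum>u<n. (m u)\<^sup>2 / 4 * (r2 u + V))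
      - (\<Sum>u<n. \<Sum>v<n. m v / 4 * m v * (m u * (len u v)\<^sup>2)) + (\<Sum>u<n. \<Sum>v<n. (m u)\<^sup>2 * (m v)\<^sup>2 * (len u v)\<^sup>2) / 2"
    by (simp add: sum.distrib sum_subtractf star_sum flip: sum_distrib_left sum_divide_distrib)
  also have "(\<Sum>u<n. \<Sum>v<n. m v / 4 * m v * (m u * (len u v)\<^sup>2)) = (\<Sum>v<n. (m v)\<^sup>2 / 4 * (r2 v + V))"
  proof -
    have "(\<Sum>u<n. \<Sum>v<n. m v / 4 * m v * (m u * (len u v)\<^sup>2)) = (\<Sum>v<n. \<Sum>u<n. m v / 4 * m v * (m u * (len u v)\<^sup>2))"
      by (rule sum.swap)
    also have "\<dots> = (\<Sum>v<n. m v / 4 * m v * (\<Sum>u<n. m u * (len v u)\<^sup>2))"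
      unfolding sum_distrib_left by (intro sum.cong refl) (metis len_sym)
    finally show ?thesis unfolding star_sum by (simp add: power2_eq_square)
  qed
  also have "(\<Sum>v<n. (m v)\<^sup>2 / 4 * (r2 v + V)) = V / (2 * real n)"
  proof -
    have "(\<Sum>v<n. (m v)\<^sup>2 / 4 * (r2 v + V)) = (\<Sum>v<n. m v * (2 * V / real n) / 4)"
      by (intro sum.cong refl) (simp add: mass_radius[symmetric] power2_eq_square)
    also have "\<dots> = (\<Sum>v<n. m v) * (2 * V / real n) / 4"
      by (simp only: sum_distrib_right sum_divide_distrib)
    finally show ?thesis by (simp add: m_sum)
  qed
  also have "(\<Sum>u<n. m u / 4 * (r2 u + V)) = V / 2"
  proof -
    have "(\<Sum>u<n. m u / 4 * (r2 u + V)) = (\<Sum>u<n. m u * r2 u) / 4 + (\<Sum>u<n. m u) * V / 4"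
      unfolding sum_distrib_right sum_divide_distrib sum.distrib[symmetric]
      by (intro sum.cong refl) (simp add: field_simps)
    then show ?thesis by (simp add: m_sum V_def[symmetric])
  qed
  also have "(\<Sum>u<n. \<Sum>v<n. (m u)\<^sup>2 * (m v)\<^sup>2 * (len u v)\<^sup>2) = 2 * V * W"
    using V_pos by (simp add: W_def)
  finally have "(\<Sum>s\<in>{..<n} \<times> {..<n}. \<Sum>e\<in>edges. (x s (fst e) (snd e))\<^sup>2)
      = V / 2 - V / (2 * real n) - V / (2 * real n) + 2 * V * W / 2" .
  moreover have "V / (2 * real n) + V / (2 * real n) = V / real n" by (simp add: field_simps)
  moreover have "V * (1 - 2 / real n + 2 * W) / 2 = V / 2 - V / real n + 2 * V * W / 2"
    by (simp add: algebra_simps diff_divide_distrib add_divide_distrib)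
  ultimately show ?thesis by linarith
qed

end

locale balanced_eigen_framework = eigen_framework + balanced_masses
begin

text \<open>For equal masses, where \<open>t = 0\<close>, \<open>W_ge\<close> compensates the term
  \<open>2 / n\<^sup>2\<close> and the comparison of energies is the claim itself. The assumption
  \<open>e\<close> ensures that for unequal masses both sides change by at least the common factor
  \<open>1 - 2 * t\<close>.\<close>

proposition balanced_bound:
  defines "e \<equiv> 1 - 2 / real n + 2 / (real n)\<^sup>2 - 4 * (real (card edges) - real (card T)) / (real n)\<^sup>2"
  assumes n3: "3 \<le> n" and e: "5 / 2 \<le> real n * e"
  shows "\<alpha> * e \<le> 1"
proof -
  define t where "t = S2 - 1 / real n"
  have t: "0 \<le> t" using S2_ge by (simp add: t_def)
  let ?D = "real (card edges) - real (card T)"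
  have half: "A \<le> B" if "A / 2 \<le> B / 2" for A B :: real using that by simp
  have "\<alpha> * ((\<Sum>s\<in>{..<n} \<times> {..<n}. \<Sum>e\<in>edges. (x s (fst e) (snd e))\<^sup>2) - 2 * V / (real n)\<^sup>2 * ?D)
      \<le> (\<Sum>s\<in>{..<n} \<times> {..<n}. \<Sum>u<n. \<Sum>a<d. (force (x s) u a)\<^sup>2)"
    by (rule stress_family_bound[OF stress_sym stress_frame])
  then have h: "\<alpha> * (V * (1 - 2 / real n + 2 * W) / 2 - 2 * V / (real n)\<^sup>2 * ?D) \<le> V * (1 + 2 / real n - 2 * S2) / 2"
    unfolding stress_total_energy stress_force .
  have scale: "\<alpha> * (V * c / 2 - 2 * V / (real n)\<^sup>2 * ?D) = V * (\<alpha> * (c - 4 * ?D / (real n)\<^sup>2)) / 2" for c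
  proof -
    have "2 * V / (real n)\<^sup>2 * ?D = V * (4 * ?D / (real n)\<^sup>2) / 2" using n_pos by (simp add: field_simps)
    then show ?thesis by (simp only:) (simp add: algebra_simps diff_divide_distrib)
  qed
  have "V * (\<alpha> * (1 - 2 / real n + 2 * W - 4 * ?D / (real n)\<^sup>2)) \<le> V * (1 + 2 / real n - 2 * S2)"
    by (rule half) (rule h[unfolded scale])
  then have "\<alpha> * (1 - 2 / real n + 2 * W - 4 * ?D / (real n)\<^sup>2) \<le> 1 + 2 / real n - 2 * S2"
    by (rule mult_left_le_imp_le[OF _ V_pos])
  then have main: "\<alpha> * (e - 2 / (real n)\<^sup>2 + 2 * W) \<le> 1 - 2 * t"
    by (simp add: e_def t_def algebra_simps)
  define r where "r = 1 / real n"
  have r: "0 < r" using n_pos by (simp add: r_def)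
  have er: "5 / 2 * r \<le> e" using e n_pos by (simp add: r_def field_simps)
  have main': "\<alpha> * (e - 2 * r\<^sup>2 + 2 * W) \<le> 1 - 2 * t" using main by (simp add: r_def power_divide)
  \<comment> \<open>This amounts to \<open>r\<^sup>2 <= W + t * e\<close>. For small
    \<open>t\<close> it follows from \<open>W_ge\<close>; for large \<open>t\<close> the term
    \<open>t * e\<close> alone suffices, thanks to \<open>e >= 5 / 2 * r\<close>.\<close>
  have "(1 - 2 * t) * e \<le> e - 2 * r\<^sup>2 + 2 * W"
  proof (cases "t \<le> e - 2 * r")
    case True
    have "r\<^sup>2 - t\<^sup>2 - 2 * t * r \<le> W" using W_ge by (simp add: t_def r_def power_divide)
    moreover have "t * t \<le> t * (e - 2 * r)" using True t by (intro mult_left_mono)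
    ultimately show ?thesis by (simp add: algebra_simps power2_eq_square)
  next
    case False
    have "r * r \<le> (e - 2 * r) * e"
    proof -
      have "(1 / 2 * r) * (5 / 2 * r) \<le> (e - 2 * r) * e" using er r by (intro mult_mono) auto
      moreover have "(1 / 2 * r) * (5 / 2 * r) = 5 / 4 * (r * r)" by simp
      moreover have "0 \<le> r * r" by simp
      ultimately show ?thesis by linarith
    qed
    also have "\<dots> \<le> t * e" using False er r by (intro mult_right_mono) auto
    finally show ?thesis using W_nonneg by (simp add: algebra_simps power2_eq_square)
  qed
  then have "\<alpha> * ((1 - 2 * t) * e) \<le> 1 - 2 * t"
    using \<alpha>_pos main' by (meson mult_left_mono less_imp_le order.trans)
  moreover have "0 < 1 - 2 * t"
  proof -
    have "S2 \<le> (\<Sum>u<n. 2 / real n * m u)"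
      unfolding S2_def power2_eq_square by (intro sum_mono mult_right_mono) (use mass_le m_pos in \<open>auto simp: less_imp_le\<close>)
    then have "t \<le> r" unfolding sum_distrib_left[symmetric] by (simp add: m_sum t_def r_def)
    moreover have "r \<le> 1 / 3" using n3 by (simp add: r_def field_simps)
    ultimately show ?thesis by simp
  qed
  ultimately show ?thesis
    by (simp add: mult.left_commute[of \<alpha>] mult_le_cancel_left1)
qed

end

section \<open>Existence of balanced masses\<close>

text \<open>Tychonoff in the product topology on all of \<open>nat\<close>. For this reason the
  minimisation arguments bound also the coordinates that do not enter their functionals.\<close>

lemma compact_box_functions:
  fixes lo hi :: "nat \<Rightarrow> real"
  shows "compact {m. \<forall>u. lo u \<le> m u \<and> m u \<le> hi u}"
proof -
  have "compactin (product_topology (\<lambda>_. euclidean) UNIV) (PiE UNIV (\<lambda>u. {lo u..hi u}))"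
    unfolding compactin_PiE by (simp add: compactin_euclidean_iff)
  moreover have "PiE UNIV (\<lambda>u. {lo u..hi u}) = {m. \<forall>u. lo u \<le> m u \<and> m u \<le> hi u}"
    by (auto simp: PiE_def Pi_def)
  ultimately show ?thesis by (simp add: euclidean_product_topology compactin_euclidean_iff)
qed

context
  fixes n :: nat and b :: "nat \<Rightarrow> nat \<Rightarrow> real"
  assumes b_nonneg: "\<And>u v. 0 \<le> b u v" and b_sym: "\<And>u v. b u v = b v u" and b_diag: "\<And>u. b u u = 0"
    and few_zeros: "\<And>u. u < n \<Longrightarrow> 2 * card {v. v < n \<and> b u v = 0} < n"
begin

text \<open>If the largest mass \<open>M\<close> sits at \<open>u\<close>, bounded energy forces
  mass at most \<open>B / M\<close> on every vertex with \<open>b u v \<noteq> 0\<close>. Only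
  \<open>\<mu>\<close> vertices, fewer than half, escape this, so the product condition gives
  \<open>M ^ (n - 2 * \<mu>) \<le> B ^ (n - \<mu>)\<close> with a positive exponent on the
  left.\<close>

lemma unit_product_masses_bounded:
  "\<exists>h\<ge>1. \<forall>m. (\<forall>u<n. 0 < m u) \<longrightarrow> (\<Prod>u<n. m u) = 1 \<longrightarrow>
      (\<Sum>u<n. \<Sum>v<n. m u * m v * b u v) \<le> (\<Sum>u<n. \<Sum>v<n. b u v) \<longrightarrow> (\<forall>u<n. m u \<le> h)"
proof -
  define pos where "pos = {b u v |u v. u < n \<and> v < n \<and> b u v \<noteq> 0}"
  define \<delta> where "\<delta> = Min (insert 1 pos)"
  have "pos \<subseteq> (\<lambda>(u, v). b u v) ` ({..<n} \<times> {..<n})" by (auto simp: pos_def)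
  then have fin: "finite pos" by (rule finite_subset) simp
  have "0 < x" if "x \<in> insert 1 pos" for x
    using that b_nonneg by (auto simp: pos_def less_le)
  then have \<delta>: "0 < \<delta>" using fin by (simp add: \<delta>_def)
  have \<delta>_le: "\<delta> \<le> b u v" if "u < n" "v < n" "b u v \<noteq> 0" for u v
    unfolding \<delta>_def by (rule Min_le) (use fin that in \<open>auto simp: pos_def\<close>)
  define B where "B = max 1 ((\<Sum>u<n. \<Sum>v<n. b u v) / \<delta>)"
  have B1: "1 \<le> B" by (simp add: B_def)
  show ?thesis
  proof (intro exI[of _ "B ^ n"] conjI allI impI)
    show "1 \<le> B ^ n" using B1 by simp
    fix m :: "nat \<Rightarrow> real" and w
    assume m': "\<forall>u<n. 0 < m u" and prod1: "(\<Prod>u<n. m u) = 1" and w: "w < n"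
      and J: "(\<Sum>u<n. \<Sum>v<n. m u * m v * b u v) \<le> (\<Sum>u<n. \<Sum>v<n. b u v)"
    have m: "0 < m u" if "u < n" for u using m' that by simp
    have m0: "0 \<le> m u" if "u < n" for u using m[OF that] by simp
    define M where "M = Max (m ` {..<n})"
    have M_ge: "m u \<le> M" if "u < n" for u unfolding M_def by (rule Max_ge) (use that in auto)
    have "M \<in> m ` {..<n}" unfolding M_def by (rule Max_in) (use w in auto)
    then obtain u where u: "u < n" and Mu: "M = m u" by auto
    have M0: "0 < M" using m[OF u] Mu by simp
    have M1: "1 \<le> M"
    proof (rule ccontr)
      assume "\<not> 1 \<le> M"
      then have "M ^ n < 1" using M0 w by (simp add: power_less_one_iff)
      moreover have "(\<Prod>v<n. m v) \<le> (\<Prod>v<n. M)"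
        by (intro prod_mono) (use M_ge m in \<open>auto intro: less_imp_le\<close>)
      ultimately show False using prod1 by simp
    qed
    let ?Z = "{v. v < n \<and> b u v = 0}"
    define \<mu> where "\<mu> = card ?Z"
    have \<mu>: "2 * \<mu> < n" using few_zeros[OF u] by (simp add: \<mu>_def)
    have far: "m v * M \<le> B" if v: "v < n" and nz: "b u v \<noteq> 0" for v
    proof -
      have "m v * M * \<delta> \<le> m u * m v * b u v"
        using \<delta>_le[OF u v nz] m[OF u] m[OF v] by (simp add: Mu)
      also have "\<dots> \<le> (\<Sum>v<n. m u * m v * b u v)"
        by (rule member_le_sum[of v "{..<n}" "\<lambda>v. m u * m v * b u v"]) (use v u m0 b_nonneg in auto)
      also have "\<dots> \<le> (\<Sum>u<n. \<Sum>v<n. m u * m v * b u v)"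
        by (rule member_le_sum[of u "{..<n}" "\<lambda>u. \<Sum>v<n. m u * m v * b u v"]) (use u m0 b_nonneg in \<open>auto intro!: sum_nonneg\<close>)
      finally have "m v * M * \<delta> \<le> (\<Sum>u<n. \<Sum>v<n. b u v)" using J by simp
      then have "m v * M \<le> (\<Sum>u<n. \<Sum>v<n. b u v) / \<delta>" using \<delta> by (simp add: field_simps)
      then show ?thesis by (simp add: B_def)
    qed
    have split: "{..<n} = ?Z \<union> ({..<n} - ?Z)" by auto
    have card: "card ({..<n} - ?Z) = n - \<mu>" unfolding \<mu>_def by (subst card_Diff_subset) auto
    have "1 = (\<Prod>v\<in>?Z. m v) * (\<Prod>v\<in>{..<n} - ?Z. m v)"
      unfolding prod1[symmetric] by (subst split, subst prod.union_disjoint) auto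
    also have "\<dots> \<le> (\<Prod>v\<in>?Z. M) * (\<Prod>v\<in>{..<n} - ?Z. B / M)"
      by (intro mult_mono prod_mono prod_nonneg)
        (use M_ge far m M0 B1 in \<open>auto intro!: less_imp_le simp: field_simps\<close>)
    also have "\<dots> = M ^ \<mu> * (B / M) ^ (n - \<mu>)" by (simp add: card flip: \<mu>_def)
    finally have "M ^ (n - \<mu>) \<le> M ^ \<mu> * B ^ (n - \<mu>)" using M0 by (simp add: power_divide field_simps)
    moreover have "M ^ (n - \<mu>) = M ^ \<mu> * M ^ (n - 2 * \<mu>)" using \<mu> by (simp flip: power_add)
    ultimately have "M ^ (n - 2 * \<mu>) \<le> B ^ (n - \<mu>)" using M0 by simp
    moreover have "M \<le> M ^ (n - 2 * \<mu>)" using M1 \<mu> power_increasing[of 1 "n - 2 * \<mu>" M] by simp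
    moreover have "B ^ (n - \<mu>) \<le> B ^ n" using B1 by (intro power_increasing) auto
    ultimately show "m w \<le> B ^ n" using M_ge[OF w] by linarith
  qed
qed

text \<open>Multiplying \<open>m u\<close> by \<open>t\<close> and dividing \<open>m v\<close> by
  \<open>t\<close> preserves the product, and the first-order change of \<open>J\<close> at
  \<open>t = 1\<close> is proportional to \<open>R u - R v\<close>. So all \<open>R u\<close> agree
  at a minimiser, and rescaling to total mass 1 divides them by \<open>M\<^sup>2\<close>.\<close>

lemma balanced_weights_exist:
  assumes n0: "0 < n"
  obtains m \<kappa> where "\<And>u. u < n \<Longrightarrow> 0 < m u" "(\<Sum>u<n. m u) = 1"
    "\<And>u. u < n \<Longrightarrow> m u * (\<Sum>v<n. m v * b u v) = \<kappa>"
proof -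
  obtain h where h1: "1 \<le> h" and h: "\<And>m u. (\<And>u. u < n \<Longrightarrow> 0 < m u) \<Longrightarrow> (\<Prod>u<n. m u) = 1 \<Longrightarrow>
      (\<Sum>u<n. \<Sum>v<n. m u * m v * b u v) \<le> (\<Sum>u<n. \<Sum>v<n. b u v) \<Longrightarrow> u < n \<Longrightarrow> m u \<le> h"
    using unit_product_masses_bounded by blast
  define J where "J m = (\<Sum>u<n. \<Sum>v<n. m u * m v * b u v)" for m :: "nat \<Rightarrow> real"
  \<comment> \<open>When the product is 1 and no mass exceeds \<open>h\<close>, no mass is below
    \<open>1 / h ^ n\<close>; so the box only cuts off masses of high energy.\<close>
  define K where "K = {m. \<forall>u. (1 / h ^ n) \<le> m u \<and> m u \<le> h} \<inter> {m. (\<Prod>u<n. m u) = 1}"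
  have hn: "1 / h ^ n \<le> 1" using h1 by simp
  have cont: "continuous_on A (\<lambda>m. m u)" for A :: "(nat \<Rightarrow> real) set" and u
    by (rule continuous_on_product_coordinates[THEN continuous_on_subset]) simp
  have "compact K" unfolding K_def
  proof (rule compact_Int_closed[OF compact_box_functions])
    show "closed {m :: nat \<Rightarrow> real. (\<Prod>u<n. m u) = 1}"
      by (intro closed_Collect_eq continuous_on_prod cont continuous_on_const)
  qed
  moreover have "(\<lambda>_. 1) \<in> K" using h1 hn by (simp add: K_def)
  moreover have "continuous_on K J" unfolding J_def
    by (intro continuous_on_sum continuous_on_mult cont continuous_on_const)
  ultimately obtain m where mK: "m \<in> K" and min: "\<And>m'. m' \<in> K \<Longrightarrow> J m \<le> J m'"
    using continuous_attains_inf[of K J] by blast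
  have prod1: "(\<Prod>u<n. m u) = 1" using mK by (simp add: K_def)
  have m_pos: "0 < m u" for u
  proof -
    have "0 < 1 / h ^ n" using h1 by simp
    also have "\<dots> \<le> m u" using mK by (simp add: K_def)
    finally show ?thesis .
  qed
  have J1: "J (\<lambda>_. 1) = (\<Sum>u<n. \<Sum>v<n. b u v)" by (simp add: J_def)
  \<comment> \<open>A competitor either has more energy than the constant masses 1, which lie in
    \<open>K\<close>, or satisfies the bounds of \<open>K\<close> once its coordinates from
    \<open>n\<close> on are reset to 1.\<close>
  have gmin: "J m \<le> J m'" if pos: "\<And>u. u < n \<Longrightarrow> 0 < m' u" and one: "(\<Prod>u<n. m' u) = 1" for m'
  proof (cases "J m' \<le> (\<Sum>u<n. \<Sum>v<n. b u v)")
    case True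
    note up = h[OF pos one True[unfolded J_def]]
    have low: "1 / h ^ n \<le> m' u" if u: "u < n" for u
    proof -
      have "1 = m' u * (\<Prod>v\<in>{..<n} - {u}. m' v)" unfolding one[symmetric] by (rule prod.remove) (use u in auto)
      also have "\<dots> \<le> m' u * (\<Prod>v\<in>{..<n} - {u}. h)"
        by (intro mult_left_mono prod_mono) (use pos up u in \<open>auto simp: less_imp_le\<close>)
      also have "\<dots> \<le> m' u * h ^ n"
        using h1 pos[OF u] u by (auto intro!: mult_left_mono power_increasing simp: less_imp_le)
      finally show ?thesis using h1 by (simp add: field_simps)
    qed
    let ?m = "\<lambda>u. if u < n then m' u else 1"
    have "?m \<in> K" using one up low hn h1 by (auto simp: K_def)
    moreover have "J ?m = J m'" by (simp add: J_def)
    ultimately show ?thesis using min by fastforce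
  next
    case False
    then show ?thesis using min[OF \<open>(\<lambda>_. 1) \<in> K\<close>] J1 by simp
  qed
  define R where "R u = m u * (\<Sum>v<n. m v * b u v)" for u
  have R_nonneg: "0 \<le> R u" for u
    unfolding R_def using m_pos b_nonneg by (intro mult_nonneg_nonneg sum_nonneg) (auto simp: less_imp_le)
  have le: "R v \<le> R u" if u: "u < n" and v: "v < n" for u v
  proof (rule ccontr)
    assume less: "\<not> R v \<le> R u"
    then have uv: "u \<noteq> v" by auto
    \<comment> \<open>Small enough that \<open>t * R u\<close> stays below \<open>R v\<close>; the
      \<open>+ 1\<close> keeps the divisor positive when \<open>R u = 0\<close>.\<close>
    define s where "s = (R v - R u) / (2 * (R u + 1))"
    define t where "t = 1 + s"
    have t1: "1 < t" using less R_nonneg[of u] by (simp add: t_def s_def)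
    \<comment> \<open>The relative change of the masses: \<open>1 + e x\<close> is \<open>t\<close>
      at \<open>u\<close>, \<open>1 / t\<close> at \<open>v\<close> and \<open>1\<close>
      elsewhere.\<close>
    define e where "e x = (if x = u then t - 1 else 0) + (if x = v then 1 / t - 1 else 0)" for x
    define w where "w x y = m x * m y * b x y" for x y
    have R_w: "R x = (\<Sum>y<n. w x y)" for x by (simp add: R_def w_def sum_distrib_left mult_ac)
    have w_sym: "w x y = w y x" for x y using b_sym[of x y] by (simp add: w_def)
    have w_diag: "w x x = 0" for x by (simp add: w_def b_diag)
    have row: "(\<Sum>x<n. e x * f x) = (t - 1) * f u + (1 / t - 1) * f v" for f
      using u v by (simp add: e_def distrib_right sum.distrib if_distrib[of "\<lambda>c. c * _"] cong: if_cong)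
    have e1: "1 + e x = (if x = u then t else 1) * (if x = v then 1 / t else 1)" for x
      using uv by (simp add: e_def)
    have "J m \<le> J (\<lambda>x. (1 + e x) * m x)"
    proof (rule gmin)
      show "0 < (1 + e x) * m x" for x using t1 m_pos by (simp add: e1)
      have "(\<Prod>x<n. 1 + e x) = 1" using u v t1 by (simp add: e1 prod.distrib)
      then show "(\<Prod>x<n. (1 + e x) * m x) = 1" by (simp add: prod.distrib prod1)
    qed
    also have "J (\<lambda>x. (1 + e x) * m x) = J m + 2 * (\<Sum>x<n. e x * R x) + (\<Sum>x<n. e x * (\<Sum>y<n. e y * w x y))"
    proof -
      have "J (\<lambda>x. (1 + e x) * m x) = J m + (\<Sum>x<n. e x * R x) + (\<Sum>x<n. \<Sum>y<n. e y * w y x)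
          + (\<Sum>x<n. e x * (\<Sum>y<n. e y * w x y))"
        unfolding J_def R_w sum_distrib_left sum.distrib[symmetric]
        by (intro sum.cong refl) (simp add: w_sym[of _ x for x], simp add: w_def algebra_simps)
      also have "(\<Sum>x<n. \<Sum>y<n. e y * w y x) = (\<Sum>x<n. e x * R x)"
        unfolding R_w sum_distrib_left by (rule sum.swap)
      finally show ?thesis by simp
    qed
    also have "(\<Sum>x<n. e x * (\<Sum>y<n. e y * w x y)) = 2 * ((t - 1) * (1 / t - 1) * w u v)"
      unfolding row by (simp add: w_diag w_sym[of v u])
    finally have "0 \<le> (t - 1) * R u + (1 / t - 1) * R v + (t - 1) * (1 / t - 1) * w u v"
      unfolding row by simp
    also have "\<dots> = (t - 1) / t * (t * R u - R v - (t - 1) * w u v)"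
      using t1 by (simp add: field_simps)
    finally have "0 \<le> t * R u - R v - (t - 1) * w u v" using t1 by (simp add: zero_le_mult_iff zero_le_divide_iff)
    moreover have "0 \<le> (t - 1) * w u v"
      using t1 m_pos[of u] m_pos[of v] b_nonneg[of u v] by (simp add: w_def)
    moreover have "t * R u < R v"
    proof -
      have "s * R u \<le> (R v - R u) / 2"
        using less R_nonneg[of u] by (simp add: s_def field_simps)
      then have "t * R u \<le> R u + (R v - R u) / 2" by (simp add: t_def distrib_right)
      also have "\<dots> < R v" using less by (simp add: field_simps)
      finally show ?thesis .
    qed
    ultimately show False by simp
  qed
  define M where "M = (\<Sum>u<n. m u)"
  have M: "0 < M" unfolding M_def by (rule sum_pos) (use n0 m_pos in auto)
  show ?thesis
  proof (rule that[of "\<lambda>u. m u / M" "R 0 / M\<^sup>2"])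
    show "0 < m u / M" for u using m_pos M by simp
    show "(\<Sum>u<n. m u / M) = 1" using M by (simp add: M_def flip: sum_divide_distrib)
    show "m u / M * (\<Sum>v<n. m v / M * b u v) = R 0 / M\<^sup>2" if u: "u < n" for u
    proof -
      have "m u / M * (\<Sum>v<n. m v / M * b u v) = R u / M\<^sup>2"
        by (simp add: R_def sum_divide_distrib[symmetric] power2_eq_square)
      moreover have "R u = R 0" using le[of u 0] le[of 0 u] u by simp
      ultimately show ?thesis by simp
    qed
  qed
qed

end

lemma (in bar_framework) balanced_masses_exist:
  assumes few: "\<And>u. u < n \<Longrightarrow> 2 * card {v. v < n \<and> len u v = 0} < n"
  obtains m \<kappa> where "balanced_masses n d q m \<kappa>"
proof -
  obtain m \<kappa> where m: "\<And>u. u < n \<Longrightarrow> 0 < m u" "(\<Sum>u<n. m u) = 1"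
      "\<And>u. u < n \<Longrightarrow> m u * (\<Sum>v<n. m v * (len u v)\<^sup>2) = \<kappa>"
    by (rule balanced_weights_exist[of "\<lambda>u v. (len u v)\<^sup>2" n])
      (use few n_pos in \<open>auto simp: len_sym\<close>)
  have "\<exists>v<n. len 0 v \<noteq> 0"
  proof (rule ccontr)
    assume "\<not> ?thesis"
    then have "{v. v < n \<and> len 0 v = 0} = {..<n}" by auto
    then show False using few[OF n_pos] n_pos by simp
  qed
  then show thesis using that[of m \<kappa>] m n_pos
    by (auto simp: balanced_masses_def balanced_masses_axioms_def bar_framework_axioms)
qed

section \<open>The geometric median\<close>

context bar_framework
begin

definition ip :: "(nat \<Rightarrow> real) \<Rightarrow> (nat \<Rightarrow> real) \<Rightarrow> real" where
  "ip x y = (\<Sum>a<d. x a * y a)"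

lemma ip_commute: "ip x y = ip y x" by (simp add: ip_def mult.commute)

lemma ip_self_nonneg: "0 \<le> ip x x" by (simp add: ip_def sum_nonneg)

lemma ip_cong_right: "(\<And>a. a < d \<Longrightarrow> y a = y' a) \<Longrightarrow> ip x y = ip x y'" by (simp add: ip_def)

lemma ip_add_right: "ip x (\<lambda>a. y a + z a) = ip x y + ip x z"
  by (simp add: ip_def distrib_left sum.distrib)

lemma ip_diff_right: "ip x (\<lambda>a. y a - z a) = ip x y - ip x z"
  by (simp add: ip_def right_diff_distrib sum_subtractf)

lemma ip_scale_right: "ip x (\<lambda>a. k * y a) = k * ip x y"
  by (simp add: ip_def sum_distrib_left mult_ac)

lemma ip_minus_right: "ip x (\<lambda>a. - y a) = - ip x y"
  by (simp add: ip_def sum_negf)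

lemmas ip_linear = ip_add_right ip_diff_right ip_scale_right ip_minus_right

lemma ip_sum_right: "ip x (\<lambda>a. \<Sum>i\<in>A. y i a) = (\<Sum>i\<in>A. ip x (y i))"
  unfolding ip_def sum_distrib_left by (rule sum.swap)

lemma ip_le_1:
  assumes "ip x x \<le> 1" "ip y y \<le> 1"
  shows "\<bar>ip x y\<bar> \<le> 1"
proof -
  have "(ip x y)\<^sup>2 \<le> ip x x * ip y y"
    unfolding ip_def using Cauchy_Schwarz_ineq_sum[of x y "{..<d}"] by (simp add: power2_eq_square)
  also have "\<dots> \<le> 1" using assms ip_self_nonneg by (simp add: mult_le_one)
  finally show ?thesis by (simp add: abs_square_le_1)
qed

text \<open>With \<open>A = r\<^sup>2 + t\<^sup>2\<close>, \<open>B = 2 r t\<close>, \<open>c = ip x y\<close> the left-hand side is \<open>A (1 - c\<^sup>2) / (A - B c)\<close>.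
  The constants make \<open>c\<^sup>2 + 5 c / 6 + 25 / 144\<close> a square, which settles the extreme case \<open>B = 0\<close>.\<close>

lemma transversal_residual_le:
  assumes x: "ip x x = 1" and y: "ip y y = 1" and D: "ip D D = 1" and pos: "0 < r" "0 < t" "0 < L"
    and LD: "\<And>a. a < d \<Longrightarrow> L * D a = r * x a - t * y a"
  shows "2 - (ip x D)\<^sup>2 - (ip y D)\<^sup>2 \<le> 169 / 144 + 5 / 6 * ip x y"
proof -
  define c where "c = ip x y"
  have c1: "c \<le> 1" using ip_le_1[of x y] x y by (simp add: c_def)
  have L: "L * ip z D = r * ip z x - t * ip z y" for z
    using ip_cong_right[of "\<lambda>a. L * D a" "\<lambda>a. r * x a - t * y a" z] LD by (simp add: ip_linear)
  have Lx: "L * ip x D = r - t * c" and Ly: "L * ip y D = r * c - t"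
    using L[of x] L[of y] x y by (simp_all add: c_def ip_commute[of y x])
  have "L\<^sup>2 = L * (L * ip D D)" using D by (simp add: power2_eq_square)
  also have "\<dots> = r * (L * ip x D) - t * (L * ip y D)"
    unfolding L[of D] by (simp add: ip_commute[of D] algebra_simps)
  also have "\<dots> = r\<^sup>2 + t\<^sup>2 - 2 * r * t * c" unfolding Lx Ly by (simp add: power2_eq_square algebra_simps)
  finally have L2: "L\<^sup>2 = r\<^sup>2 + t\<^sup>2 - 2 * r * t * c" .
  \<comment> \<open>Obtained by writing
    \<open>L\<^sup>2 = (r - t)\<^sup>2 + 2 * r * t * (1 - c)\<close> and collecting terms. The last
    factor is nonnegative because \<open>c / 6 <= 24 / 144\<close>.\<close>
  have "0 \<le> (r - t)\<^sup>2 * (c + 5 / 12)\<^sup>2 + 2 * r * t * ((1 - c) * (25 / 144 - c / 6))"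
    using c1 pos by (intro add_nonneg_nonneg mult_nonneg_nonneg) auto
  also have "\<dots> = L\<^sup>2 * (169 / 144 + 5 / 6 * c) - 2 * L\<^sup>2 + (r - t * c)\<^sup>2 + (r * c - t)\<^sup>2"
    unfolding L2 by (simp add: power2_eq_square field_simps)
  also have "\<dots> = L\<^sup>2 * (169 / 144 + 5 / 6 * c - (2 - (ip x D)\<^sup>2 - (ip y D)\<^sup>2))"
    unfolding Lx[symmetric] Ly[symmetric] by (simp add: power_mult_distrib algebra_simps)
  finally show ?thesis using pos(3) by (simp add: zero_le_mult_iff c_def)
qed

section \<open>Existence of the median and its first-order condition\<close>

text \<open>Clamping every coordinate of \<open>c'\<close> to a box that contains all points does
  not increase any distance, so the minimum over the compact box is global.\<close>

lemma geometric_median_exists: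
  "\<exists>c. \<forall>c'. (\<Sum>u<n. sqrt (\<Sum>a<d. (q u a - c a)\<^sup>2)) \<le> (\<Sum>u<n. sqrt (\<Sum>a<d. (q u a - c' a)\<^sup>2))"
proof -
  define \<Phi> where "\<Phi> c = (\<Sum>u<n. sqrt (\<Sum>a<d. (q u a - c a)\<^sup>2))" for c :: "nat \<Rightarrow> real"
  define B where "B = (\<Sum>u<n. \<Sum>a<d. \<bar>q u a\<bar>)"
  have B: "\<bar>q u a\<bar> \<le> B" if "u < n" "a < d" for u a
  proof -
    have "\<bar>q u a\<bar> \<le> (\<Sum>a<d. \<bar>q u a\<bar>)" by (rule member_le_sum) (use that in auto)
    also have "\<dots> \<le> B" unfolding B_def
      by (rule member_le_sum[of u "{..<n}" "\<lambda>u. \<Sum>a<d. \<bar>q u a\<bar>"]) (use that in \<open>auto intro: sum_nonneg\<close>)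
    finally show ?thesis .
  qed
  have B0: "0 \<le> B" unfolding B_def by (intro sum_nonneg) auto
  let ?K = "{c :: nat \<Rightarrow> real. \<forall>a. - B \<le> c a \<and> c a \<le> B}"
  have cont: "continuous_on ?K (\<lambda>m. m a)" for a :: nat
    by (rule continuous_on_product_coordinates[THEN continuous_on_subset]) simp
  have "continuous_on ?K \<Phi>" unfolding \<Phi>_def
    by (intro continuous_on_sum continuous_on_real_sqrt continuous_on_power continuous_on_diff cont continuous_on_const)
  moreover have "(\<lambda>_. 0) \<in> ?K" using B0 by simp
  ultimately obtain c where c: "\<And>c'. c' \<in> ?K \<Longrightarrow> \<Phi> c \<le> \<Phi> c'"
    using continuous_attains_inf[OF compact_box_functions, of "\<lambda>_. - B" "\<lambda>_. B" \<Phi>] by blast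
  have "\<Phi> c \<le> \<Phi> c'" for c'
  proof -
    have "\<Phi> c \<le> \<Phi> (\<lambda>a. max (- B) (min B (c' a)))" by (rule c) (use B0 in auto)
    also have "\<dots> \<le> \<Phi> c'" unfolding \<Phi>_def
    proof (intro sum_mono real_sqrt_le_mono)
      fix u a assume "u \<in> {..<n}" "a \<in> {..<d}"
      then have "\<bar>q u a\<bar> \<le> B" using B by simp
      then show "(q u a - max (- B) (min B (c' a)))\<^sup>2 \<le> (q u a - c' a)\<^sup>2"
        by (intro abs_le_square_iff[THEN iffD1]) auto
    qed
    finally show ?thesis .
  qed
  then show ?thesis unfolding \<Phi>_def by blast
qed

definition radius :: "(nat \<Rightarrow> real) \<Rightarrow> nat \<Rightarrow> real" where
  "radius c u = sqrt (\<Sum>a<d. (q u a - c a)\<^sup>2)"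

definition radial :: "(nat \<Rightarrow> real) \<Rightarrow> nat \<Rightarrow> nat \<Rightarrow> real" where
  "radial c u a = (q u a - c a) / radius c u"

lemma radius_nonneg: "0 \<le> radius c u" by (simp add: radius_def sum_nonneg)

lemma radius_sq: "(radius c u)\<^sup>2 = (\<Sum>a<d. (q u a - c a)\<^sup>2)" by (simp add: radius_def sum_nonneg)

lemma radius_eq_0D: "radius c u = 0 \<Longrightarrow> a < d \<Longrightarrow> q u a = c a"
  by (auto simp: radius_def sum_nonneg_eq_0_iff)

lemma radius_radial: "a < d \<Longrightarrow> radius c u * radial c u a = q u a - c a"
  using radius_eq_0D[of c u a] by (cases "radius c u = 0") (auto simp: radial_def)

text \<open>First-order condition: the Fermat sum \<open>\<Sum>u. radius c u\<close> of the minimiser cannot decrease when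
  \<open>c\<close> moves in the direction of the sum of the unit vectors.  The vertices at \<open>c\<close> itself, where
  \<open>radial c u = 0\<close> by division by zero, account for the right-hand side.\<close>

lemma geometric_median_unit_sum:
  obtains c where "ip (\<lambda>a. \<Sum>u<n. radial c u a) (\<lambda>a. \<Sum>u<n. radial c u a) \<le> (real (card {u. u < n \<and> radius c u = 0}))\<^sup>2"
proof -
  obtain c where c: "\<And>c'. (\<Sum>u<n. sqrt (\<Sum>a<d. (q u a - c a)\<^sup>2)) \<le> (\<Sum>u<n. sqrt (\<Sum>a<d. (q u a - c' a)\<^sup>2))"
    using geometric_median_exists by blast
  define r where "r = radius c"
  define x where "x = radial c"
  define g where "g a = (\<Sum>u<n. x u a)" for a
  define G where "G = ip g g"
  define K where "K = (\<Sum>u<n. if r u = 0 then 0 else 1 / (2 * r u))"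
  let ?U = "{u. u < n \<and> r u = 0}"
  define \<mu> where "\<mu> = real (card ?U)"
  have r0: "0 \<le> r u" for u by (simp add: r_def radius_nonneg)
  have G0: "0 \<le> G" by (simp add: G_def ip_self_nonneg)
  note rx = radius_radial[of _ c, folded r_def x_def] and r_sq = radius_sq[of c, folded r_def]
  \<comment> \<open>The Fermat sum at \<open>c + t * g\<close> is expanded to second order in
    \<open>t\<close>. A vertex at \<open>c\<close> costs \<open>t * sqrt G\<close>, the others
    together gain \<open>t * G\<close>, and \<open>K\<close> collects the curvatures.\<close>
  have step: "G - \<mu> * sqrt G \<le> t * (G * K)" if t: "0 < t" for t
  proof -
    have "sqrt (\<Sum>a<d. (q u a - (c a + t * g a))\<^sup>2)
        \<le> r u - t * ip (x u) g + (if r u = 0 then t * sqrt G else 0) + t\<^sup>2 * G * (if r u = 0 then 0 else 1 / (2 * r u))"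
      (is "sqrt ?s \<le> _") for u
    proof -
      have s: "?s = (r u)\<^sup>2 - 2 * t * (r u * ip (x u) g) + t\<^sup>2 * G"
      proof -
        have "?s = (\<Sum>a<d. (q u a - c a)\<^sup>2 - 2 * t * (r u * (x u a * g a)) + t\<^sup>2 * (g a * g a))"
          by (intro sum.cong refl) (simp add: mult.assoc[symmetric] rx, simp add: power2_eq_square algebra_simps)
        then show ?thesis by (simp add: sum.distrib sum_subtractf r_sq G_def ip_def sum_distrib_left)
      qed
      show ?thesis
      proof (cases "r u = 0")
        case True
        have "ip (x u) g = 0" using True by (simp add: ip_def x_def radial_def r_def)
        then show ?thesis using s True t by (simp add: real_sqrt_mult)
      next
        case False
        then have rp: "0 < r u" using r0[of u] by simp
        \<comment> \<open>This square encodes the tangent-line bound for the square root at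
          \<open>(r u)\<^sup>2\<close>.\<close>
        have "0 \<le> (sqrt ?s - r u)\<^sup>2" by simp
        also have "\<dots> = (sqrt ?s)\<^sup>2 + (r u)\<^sup>2 - 2 * r u * sqrt ?s"
          by (simp only: power2_diff) simp
        also have "(sqrt ?s)\<^sup>2 = ?s" by (intro real_sqrt_pow2 sum_nonneg) simp
        finally have "2 * r u * sqrt ?s \<le> 2 * (r u)\<^sup>2 - 2 * t * (r u * ip (x u) g) + t\<^sup>2 * G"
          unfolding s by simp
        then have "sqrt ?s \<le> (2 * (r u)\<^sup>2 - 2 * t * (r u * ip (x u) g) + t\<^sup>2 * G) / (2 * r u)"
          using rp by (simp add: field_simps)
        also have "\<dots> = r u - t * ip (x u) g + t\<^sup>2 * G * (1 / (2 * r u))"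
          using rp by (simp add: field_simps power2_eq_square)
        finally show ?thesis using False by simp
      qed
    qed
    then have "(\<Sum>u<n. sqrt (\<Sum>a<d. (q u a - (c a + t * g a))\<^sup>2))
      \<le> (\<Sum>u<n. r u - t * ip (x u) g + (if r u = 0 then t * sqrt G else 0) + t\<^sup>2 * G * (if r u = 0 then 0 else 1 / (2 * r u)))"
      by (intro sum_mono)
    also have "\<dots> = (\<Sum>u<n. r u) - t * G + \<mu> * (t * sqrt G) + t\<^sup>2 * G * K"
    proof -
      have "(\<Sum>u<n. if r u = 0 then t * sqrt G else 0) = \<mu> * (t * sqrt G)"
        by (simp add: sum.If_cases \<mu>_def Int_def)
      moreover have "(\<Sum>u<n. ip (x u) g) = G"
      proof -
        have "G = ip g (\<lambda>a. \<Sum>u<n. x u a)" unfolding G_def by (rule ip_cong_right) (simp add: g_def)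
        then show ?thesis by (simp add: ip_sum_right ip_commute[of g])
      qed
      ultimately show ?thesis
        by (simp add: sum.distrib sum_subtractf K_def flip: sum_distrib_left)
    qed
    finally have "t * G \<le> \<mu> * (t * sqrt G) + t\<^sup>2 * G * K"
      using c[of "\<lambda>a. c a + t * g a"] by (simp add: r_def radius_def)
    then have "t * G \<le> t * (\<mu> * sqrt G + t * (G * K))" by (simp add: power2_eq_square algebra_simps)
    then show ?thesis using t by simp
  qed
  have "G \<le> \<mu> * sqrt G"
  proof (rule ccontr)
    assume "\<not> ?thesis"
    then have p: "0 < G - \<mu> * sqrt G" by simp
    have GK: "0 \<le> G * K" using G0 r0 by (simp add: K_def sum_nonneg)
    \<comment> \<open>The step length is chosen so that the quadratic error is at most half of the
      linear gain.\<close>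
    have "G - \<mu> * sqrt G \<le> (G - \<mu> * sqrt G) / (2 * (G * K + 1)) * (G * K)"
      by (rule step) (use p GK in simp)
    also have "\<dots> = (G - \<mu> * sqrt G) * (G * K / (2 * (G * K + 1)))" by simp
    also have "\<dots> \<le> (G - \<mu> * sqrt G) * (1 / 2)"
      using p GK by (intro mult_left_mono) (auto simp: divide_simps)
    finally show False using p by simp
  qed
  then have "sqrt G * sqrt G \<le> \<mu> * sqrt G" using G0 by simp
  then have "sqrt G \<le> \<mu>" using G0 by (cases "G = 0") (simp_all only: mult_le_cancel_right, auto simp: \<mu>_def)
  then have "G \<le> \<mu>\<^sup>2" using G0 by (metis real_sqrt_ge_zero real_sqrt_pow2 power_mono)
  then show thesis
    by (intro that[of c]) (simp add: G_def g_def[abs_def] x_def r_def \<mu>_def)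
qed

end

context eigen_framework
begin

section \<open>The bound from the geometric median\<close>

text \<open>Besides the unit vectors \<open>w u\<close> of the trace bound there are vectors
  \<open>h u\<close>, equal to \<open>w u\<close> off the median and shortened on it so that they
  sum to zero exactly. The pair estimates are affine in \<open>ip (h u) (h v)\<close>, so the inner
  products disappear in the total.\<close>

proposition geometric_median_bound:
  assumes d0: "0 < d"
  shows "\<alpha> * (real (card T) - (real n - 1)) \<le> (real n - 1) * (169 * real n - 120) / 288"
proof -
  obtain c where c: "ip (\<lambda>a. \<Sum>u<n. radial c u a) (\<lambda>a. \<Sum>u<n. radial c u a) \<le> (real (card {u. u < n \<and> radius c u = 0}))\<^sup>2"
    by (rule geometric_median_unit_sum)
  define r where "r = radius c"
  define x where "x = radial c"
  define g where "g = (\<lambda>a. \<Sum>u<n. x u a)"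
  define G where "G = ip g g"
  define \<mu> where "\<mu> = real (card {u. u < n \<and> r u = 0})"
  have G0: "0 \<le> G" by (simp add: G_def ip_self_nonneg)
  have G\<mu>: "G \<le> \<mu>\<^sup>2" using c by (simp add: G_def g_def \<mu>_def r_def x_def)
  have \<mu>0: "0 \<le> \<mu>" by (simp add: \<mu>_def)
  have r0: "0 \<le> r u" for u by (simp add: r_def radius_nonneg)
  note q_c = radius_eq_0D[of c, folded r_def] and r_x = radius_radial[of _ c, folded r_def x_def]
  have x_unit: "ip (x u) (x u) = 1" if "r u \<noteq> 0" for u
    using that by (simp add: ip_def x_def r_def radial_def power2_eq_square[symmetric] power_divide radius_sq[symmetric] flip: sum_divide_distrib)
  \<comment> \<open>The direction of the sum \<open>g\<close> of the unit vectors; if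
    \<open>g\<close> vanishes any unit vector will do, and the first basis vector exists as
    \<open>d > 0\<close>.\<close>
  define e where "e = (\<lambda>a. if G = 0 then (if a = 0 then 1 else 0) else g a / sqrt G)"
  have e_unit: "ip e e = 1"
  proof (cases "G = 0")
    case True
    then show ?thesis using d0 by (simp add: ip_def e_def if_distrib[of "\<lambda>x. x * _"] cong: if_cong)
  next
    case False
    have "ip e e = (\<Sum>a<d. g a * g a) / G" using False G0 by (simp add: ip_def e_def flip: sum_divide_distrib)
    then show ?thesis using False by (simp add: G_def ip_def)
  qed
  have g_e: "g a = sqrt G * e a" if "a < d" for a
  proof (cases "G = 0")
    case True
    then have "g a * g a = 0" using that by (simp add: G_def ip_def sum_nonneg_eq_0_iff)
    then show ?thesis using True by simp
  qed (use G0 in \<open>simp add: e_def\<close>)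
  \<comment> \<open>The fraction that makes \<open>\<mu>\<close> copies of \<open>- s * e\<close>
    cancel \<open>g\<close>. It is at most 1 by the first-order condition; without vertices at the
    median, \<open>G = 0\<close> and division by zero gives \<open>s = 0\<close>.\<close>
  define s where "s = sqrt G / \<mu>"
  have sG: "\<mu> * s = sqrt G" using G\<mu> G0 by (cases "\<mu> = 0") (auto simp: s_def)
  have s0: "0 \<le> s" using G0 \<mu>0 by (simp add: s_def)
  have s1: "s \<le> 1"
  proof -
    have "sqrt G \<le> \<mu>" using G\<mu> \<mu>0 by (simp add: real_le_lsqrt)
    then show ?thesis using \<mu>0 by (cases "\<mu> = 0") (auto simp: s_def)
  qed
  define h where "h u = (if r u = 0 then (\<lambda>a. - s * e a) else x u)" for u
  define w where "w u = (if r u = 0 then e else x u)" for u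
  define Z where "Z u = (if r u = 0 then 1 else 0 :: real)" for u
  have sumZ: "(\<Sum>u<n. Z u) = \<mu>" by (simp add: Z_def \<mu>_def sum.If_cases Int_def)
  have h_sum: "(\<Sum>u<n. h u a) = 0" if "a < d" for a
  proof -
    have "(\<Sum>u<n. h u a) = (\<Sum>u<n. x u a - Z u * (s * e a))"
      by (intro sum.cong refl) (simp add: h_def Z_def x_def radial_def r_def)
    also have "\<dots> = g a - \<mu> * (s * e a)"
      by (simp add: sum_subtractf g_def sumZ flip: sum_distrib_right)
    finally show ?thesis using sG g_e[OF that] by (simp add: mult.assoc[symmetric])
  qed
  have h_total: "(\<Sum>u<n. \<Sum>v<n. ip (h u) (h v)) = 0"
    unfolding ip_sum_right[symmetric] by (intro sum.neutral) (simp add: ip_def h_sum)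
  have h_le1: "ip (h u) (h u) \<le> 1" for u
  proof (cases "r u = 0")
    case True
    have "ip (h u) (h u) = s * s * ip e e" by (simp add: h_def True ip_def sum_distrib_left mult_ac)
    then show ?thesis using s0 s1 by (simp add: e_unit mult_le_one)
  qed (simp add: h_def x_unit)
  have ip_swap_dir: "ip y (dir v u) = - ip y (dir u v)" for y u v
    by (subst ip_minus_right[symmetric], rule ip_cong_right) (rule dir_antisym)
  have ip_dir_swap: "ip (dir v u) (dir v u) = ip (dir u v) (dir u v)" for u v
    by (simp add: ip_def dir_antisym[of v u])
  have dir_0: "ip y (dir u v) = 0" if "len u v = 0" for y u v by (simp add: ip_def dir_def that)
  \<comment> \<open>The slack on pairs without a direction: two vertices at the median leave at
    least \<open>169 / 144\<close>, and a diagonal pair elsewhere leaves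
    \<open>169 / 144 + 5 / 6 = 289 / 144\<close>.\<close>
  define \<delta> where "\<delta> u v = 169 / 144 * Z u * Z v + (if u = v then 289 / 144 * (1 - Z u) else 0)" for u v
  have mixed: "2 * ip (dir u v) (dir u v) - (ip (w u) (dir u v))\<^sup>2 - (ip (w v) (dir u v))\<^sup>2 \<le> 169 / 144 + 5 / 6 * ip (h u) (h v)"
    if u: "r u = 0" and v: "r v \<noteq> 0" for u v
  proof -
    have "len u v = r v" unfolding len_def r_def radius_def
      by (intro arg_cong[of _ _ sqrt] sum.cong) (auto simp: q_c[OF u] power2_commute)
    then have D: "dir u v a = - x v a" if "a < d" for a
      using q_c[OF u that] by (simp add: dir_def x_def radial_def flip: r_def) (simp only: minus_divide_left minus_diff_eq)
    have ipD: "ip y (dir u v) = - ip y (x v)" for y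
      using ip_cong_right[of "dir u v" "\<lambda>a. - x v a" y] D by (simp add: ip_minus_right)
    define b where "b = ip e (x v)"
    have b: "b\<^sup>2 \<le> 1" using ip_le_1[of e "x v"] e_unit x_unit[OF v] by (simp add: b_def abs_square_le_1)
    have "ip (h u) (h v) = - s * b"
      by (simp add: h_def u v b_def ip_def sum_distrib_left mult_ac sum_negf)
    moreover have "2 * ip (dir u v) (dir u v) - (ip (w u) (dir u v))\<^sup>2 - (ip (w v) (dir u v))\<^sup>2 = 1 - b\<^sup>2"
      using x_unit[OF v] by (simp add: ipD ip_commute[of "dir u v"] w_def u v b_def)
    \<comment> \<open>Completes the square in
      \<open>1 - b\<^sup>2 <= 169 / 144 - 5 / 6 * s * b\<close>.\<close>
    moreover have "0 \<le> (b - 5 / 12 * s)\<^sup>2 + 25 / 144 * (1 - s * s)"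
      using s0 s1 by (intro add_nonneg_nonneg) (auto simp: mult_le_one)
    ultimately show ?thesis by (simp add: power2_eq_square field_simps)
  qed
  have pair: "2 * ip (dir u v) (dir u v) - (ip (w u) (dir u v))\<^sup>2 - (ip (w v) (dir u v))\<^sup>2
      \<le> 169 / 144 + 5 / 6 * ip (h u) (h v) - \<delta> u v" for u v
  proof -
    consider "r u = 0" "r v = 0" | "r u \<noteq> 0" "u = v" | "r u = 0" "r v \<noteq> 0" | "r u \<noteq> 0" "r v = 0"
      | "r u \<noteq> 0" "r v \<noteq> 0" "u \<noteq> v" "len u v = 0" | "r u \<noteq> 0" "r v \<noteq> 0" "u \<noteq> v" "len u v \<noteq> 0" by blast
    then show ?thesis
    proof cases
      case 1
      then have "len u v = 0" using q_c by (simp add: len_eq_0_iff)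
      moreover have "ip (h u) (h v) = s * s * ip e e" by (simp add: h_def 1 ip_def sum_distrib_left mult_ac)
      ultimately show ?thesis using 1 s0 by (simp add: dir_0 \<delta>_def Z_def e_unit)
    next
      case 2
      then show ?thesis using dir_0[of u v] x_unit[of u] by (simp add: \<delta>_def Z_def h_def)
    next
      case 3
      then show ?thesis using mixed[of u v] by (auto simp: \<delta>_def Z_def)
    next
      case 4
      then have "\<delta> u v = 0" by (auto simp: \<delta>_def Z_def)
      then show ?thesis using mixed[OF 4(2,1)]
        unfolding ip_swap_dir[of _ u v] ip_dir_swap[of v u] ip_commute[of "h v"] by simp
    next
      \<comment> \<open>Distinct vertices at one point off the median: the left-hand side is 0, and
        \<open>169 / 144\<close> exceeds \<open>5 / 6\<close>.\<close>
      case 5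
      then show ?thesis using ip_le_1[OF h_le1 h_le1, of u v] by (simp add: dir_0 \<delta>_def Z_def)
    next
      case 6
      have D: "ip (dir u v) (dir u v) = 1" using dir_sq_sum[of u v] 6 by (simp add: ip_def power2_eq_square)
      have "len u v * dir u v a = r u * x u a - r v * x v a" if "a < d" for a
        using len_dir[OF that, of u v] r_x[OF that] by simp
      then have "2 - (ip (x u) (dir u v))\<^sup>2 - (ip (x v) (dir u v))\<^sup>2 \<le> 169 / 144 + 5 / 6 * ip (x u) (x v)"
        using 6 r0[of u] r0[of v] len_nonneg[of u v]
        by (intro transversal_residual_le[of _ _ _ "r u" "r v" "len u v"]) (auto simp: x_unit D less_le)
      then show ?thesis using 6 D by (simp add: \<delta>_def Z_def h_def w_def)
    qed
  qed
  let ?X = "\<Sum>u<n. \<Sum>v<n. ip (dir u v) (dir u v) - (ip (w u) (dir u v))\<^sup>2"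
  \<comment> \<open>The trace treats the ends of an edge asymmetrically; averaging over both orders
    brings it into the form of \<open>pair\<close>.\<close>
  have "?X = (\<Sum>v<n. \<Sum>u<n. ip (dir u v) (dir u v) - (ip (w u) (dir u v))\<^sup>2)" by (rule sum.swap)
  also have "\<dots> = (\<Sum>u<n. \<Sum>v<n. ip (dir u v) (dir u v) - (ip (w v) (dir u v))\<^sup>2)"
  proof (intro sum.cong refl)
    fix u v
    show "ip (dir v u) (dir v u) - (ip (w v) (dir v u))\<^sup>2 = ip (dir u v) (dir u v) - (ip (w v) (dir u v))\<^sup>2"
      unfolding ip_swap_dir[of _ u v] ip_dir_swap[of v u] by simp
  qed
  finally have "2 * ?X = (\<Sum>u<n. \<Sum>v<n. 2 * ip (dir u v) (dir u v) - (ip (w u) (dir u v))\<^sup>2 - (ip (w v) (dir u v))\<^sup>2)"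
    by (simp add: sum.distrib sum_subtractf flip: sum_distrib_left)
  also have "\<dots> \<le> (\<Sum>u<n. \<Sum>v<n. 169 / 144 + 5 / 6 * ip (h u) (h v) - \<delta> u v)"
    by (intro sum_mono pair)
  also have "\<dots> = 169 / 144 * (real n)\<^sup>2 - (169 / 144 * \<mu>\<^sup>2 + 289 / 144 * (real n - \<mu>))"
  proof -
    have "(\<Sum>u<n. \<Sum>v<n. \<delta> u v) = (\<Sum>u<n. 169 / 144 * \<mu> * Z u + 289 / 144 * (1 - Z u))"
    proof (rule sum.cong[OF refl])
      fix u assume u: "u \<in> {..<n}"
      have "(\<Sum>v<n. \<delta> u v) = 169 / 144 * Z u * (\<Sum>v<n. Z v) + (\<Sum>v<n. if u = v then 289 / 144 * (1 - Z u) else 0)"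
        unfolding \<delta>_def sum.distrib sum_distrib_left ..
      then show "(\<Sum>v<n. \<delta> u v) = 169 / 144 * \<mu> * Z u + 289 / 144 * (1 - Z u)"
        using u by (simp add: sumZ)
    qed
    also have "\<dots> = 169 / 144 * \<mu>\<^sup>2 + 289 / 144 * (real n - \<mu>)"
      unfolding sum.distrib sum_distrib_left[symmetric] sum_subtractf sumZ by (simp add: power2_eq_square)
    finally show ?thesis
      unfolding sum.distrib sum_subtractf sum_distrib_left[symmetric] h_total by (simp add: power2_eq_square)
  qed
  also have "\<dots> \<le> (real n - 1) * (169 * real n - 120) / 144"
  proof -
    \<comment> \<open>Negative only strictly between \<open>120 / 169\<close> and \<open>1\<close>,
      where no cardinality lies.\<close>
    have "0 \<le> (\<mu> - 1) * (169 * \<mu> - 120)"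
    proof (cases "\<mu> = 0")
      case False
      moreover have "1 \<le> real k" if "real k \<noteq> 0" for k using that by (cases k) auto
      ultimately have "1 \<le> \<mu>" unfolding \<mu>_def by blast
      then show ?thesis by simp
    qed simp
    then show ?thesis by (simp add: power2_eq_square field_simps)
  qed
  finally have X: "?X \<le> (real n - 1) * (169 * real n - 120) / 288" by simp
  have "(\<Sum>a<d. (w u a)\<^sup>2) = 1" for u
    using e_unit x_unit[of u] by (auto simp: w_def ip_def power2_eq_square)
  then have "\<alpha> * (real (card T) - (real n - 1)) \<le> ?X"
    using transversal_trace_bound[of w] by (simp add: ip_def power2_eq_square)
  then show ?thesis using X by linarith
qed

section \<open>The case without missing dimensions\<close>

text \<open>The stress alternates in sign along the cycle \<open>a b c e\<close>, so the force at
  each vertex is a difference of two edge vectors, that is, a diagonal: at \<open>a\<close> it is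
  \<open>q e - q b\<close>. The sides make up the energy of the stress.\<close>

lemma four_cycle_bound:
  assumes full: "card edges \<le> card T" and abce: "distinct [a, b, c, e]" "a < n" "b < n" "c < n" "e < n"
  shows "\<alpha> * ((len a b)\<^sup>2 + (len b c)\<^sup>2 + (len c e)\<^sup>2 + (len e a)\<^sup>2) \<le> 2 * ((len a c)\<^sup>2 + (len b e)\<^sup>2)"
proof -
  define \<sigma> where "\<sigma> u v = (if (u, v) \<in> {(a, b), (b, a), (c, e), (e, c)} then 1
    else if (u, v) \<in> {(b, c), (c, b), (e, a), (a, e)} then - 1 else 0 :: real)" for u v
  define x where "x u v = \<sigma> u v * len u v" for u v
  have "(u, v) \<in> {(a, b), (b, a), (c, e), (e, c)} \<longleftrightarrow> (v, u) \<in> {(a, b), (b, a), (c, e), (e, c)}"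
    "(u, v) \<in> {(b, c), (c, b), (e, a), (a, e)} \<longleftrightarrow> (v, u) \<in> {(b, c), (c, b), (e, a), (a, e)}" for u v by blast+
  then have \<sigma>_sym: "\<sigma> u v = \<sigma> v u" for u v unfolding \<sigma>_def by presburger
  have sum4: "(\<Sum>u<n. f u) = f a + f b + f c + f e" if "\<And>u. u \<notin> {a, b, c, e} \<Longrightarrow> f u = 0" for f :: "nat \<Rightarrow> real"
  proof -
    have "(\<Sum>u<n. f u) = (\<Sum>u\<in>{a, b, c, e}. f u)"
      by (rule sum.mono_neutral_right) (use abce that in auto)
    then show ?thesis using abce(1) by auto
  qed
  have "card T \<le> card edges"
    using card_T_le card_mono[of edges "{e \<in> edges. len (fst e) (snd e) \<noteq> 0}"] by auto
  then have eq: "real (card edges) - real (card T) = 0" using full by simp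
  have stress_sym: "x u v = x v u" for u v by (simp add: x_def \<sigma>_sym[of u v] len_sym[of u v])
  let ?x2 = "\<Sum>f\<in>edges. (x (fst f) (snd f))\<^sup>2"
  \<comment> \<open>A family of one stress. The crude frame constant from Cauchy-Schwarz does no
    harm, as it is multiplied by the defect 0.\<close>
  have "\<alpha> * ((\<Sum>s\<in>{()}. ?x2) - ?x2 * (real (card edges) - real (card T))) \<le> (\<Sum>s\<in>{()}. \<Sum>u<n. \<Sum>i<d. (force x u i)\<^sup>2)"
  proof (rule stress_family_bound)
    fix g :: "nat \<times> nat \<Rightarrow> real"
    show "(\<Sum>s\<in>{()}. (\<Sum>e\<in>edges. g e * x (fst e) (snd e))\<^sup>2) \<le> ?x2 * (\<Sum>e\<in>edges. (g e)\<^sup>2)"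
      using Cauchy_Schwarz_ineq_sum[of g "\<lambda>e. x (fst e) (snd e)" edges] by (simp add: mult.commute)
  qed (rule stress_sym)
  then have bound: "\<alpha> * ?x2 \<le> (\<Sum>u<n. \<Sum>i<d. (force x u i)\<^sup>2)" by (simp add: eq)
  have "(\<Sum>u<n. \<Sum>v<n. (x u v)\<^sup>2) = 2 * ?x2"
    unfolding edges_def by (subst sum_lessThan_pairs_symmetric) (auto simp: stress_sym x_def split_def)
  moreover have "(\<Sum>u<n. \<Sum>v<n. (x u v)\<^sup>2) = 2 * ((len a b)\<^sup>2 + (len b c)\<^sup>2 + (len c e)\<^sup>2 + (len e a)\<^sup>2)"
  proof -
    have "(\<Sum>v<n. (x u v)\<^sup>2) = (x u a)\<^sup>2 + (x u b)\<^sup>2 + (x u c)\<^sup>2 + (x u e)\<^sup>2" for u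
      by (rule sum4) (auto simp: x_def \<sigma>_def)
    then have "(\<Sum>u<n. \<Sum>v<n. (x u v)\<^sup>2) = (\<Sum>u<n. (x u a)\<^sup>2 + (x u b)\<^sup>2 + (x u c)\<^sup>2 + (x u e)\<^sup>2)" by simp
    also have "\<dots> = 2 * ((len a b)\<^sup>2 + (len b c)\<^sup>2 + (len c e)\<^sup>2 + (len e a)\<^sup>2)"
      by (subst sum4) (use abce(1) in \<open>auto simp: x_def \<sigma>_def len_sym[of b a] len_sym[of c b] len_sym[of e c] len_sym[of a e]\<close>)
    finally show ?thesis .
  qed
  ultimately have x2: "?x2 = (len a b)\<^sup>2 + (len b c)\<^sup>2 + (len c e)\<^sup>2 + (len e a)\<^sup>2" by simp
  have force: "force x u i = \<sigma> u a * (q u i - q a i) + \<sigma> u b * (q u i - q b i) + \<sigma> u c * (q u i - q c i) + \<sigma> u e * (q u i - q e i)"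
    if "i < d" for u i
  proof -
    have "force x u i = (\<Sum>v<n. \<sigma> u v * (q u i - q v i))"
      unfolding force_def x_def by (intro sum.cong refl) (simp add: mult.assoc len_dir that)
    also have "\<dots> = \<sigma> u a * (q u i - q a i) + \<sigma> u b * (q u i - q b i) + \<sigma> u c * (q u i - q c i) + \<sigma> u e * (q u i - q e i)"
      by (rule sum4) (auto simp: \<sigma>_def)
    finally show ?thesis .
  qed
  have "(\<Sum>u<n. \<Sum>i<d. (force x u i)\<^sup>2) = (\<Sum>i<d. (force x a i)\<^sup>2) + (\<Sum>i<d. (force x b i)\<^sup>2) + (\<Sum>i<d. (force x c i)\<^sup>2) + (\<Sum>i<d. (force x e i)\<^sup>2)"
  proof (rule sum4)
    fix u assume "u \<notin> {a, b, c, e}"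
    then show "(\<Sum>i<d. (force x u i)\<^sup>2) = 0" by (intro sum.neutral) (auto simp: force \<sigma>_def)
  qed
  also have "\<dots> = 2 * ((len a c)\<^sup>2 + (len b e)\<^sup>2)"
  proof -
    have "(\<Sum>i<d. (force x a i)\<^sup>2) = (len b e)\<^sup>2" "(\<Sum>i<d. (force x c i)\<^sup>2) = (len b e)\<^sup>2"
      "(\<Sum>i<d. (force x b i)\<^sup>2) = (len a c)\<^sup>2" "(\<Sum>i<d. (force x e i)\<^sup>2) = (len a c)\<^sup>2"
      unfolding len_sq
      by (intro sum.cong refl; use abce(1) in \<open>auto simp: force \<sigma>_def power2_commute\<close>)+
    then show ?thesis by simp
  qed
  finally show ?thesis using bound x2 by simp
qed

text \<open>In the three four-cycles on the vertices 0 to 3 every pair is a side twice and a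
  diagonal once, so both sides add up to multiples of \<open>\<Lambda>\<close>. Without missing
  dimensions no edge has length zero, so \<open>\<Lambda>\<close> can be cancelled.\<close>

lemma simplex_bound:
  assumes full: "card edges \<le> card T" and n4: "4 \<le> n"
  shows "\<alpha> \<le> 1"
proof -
  define \<Lambda> where "\<Lambda> = (len 0 1)\<^sup>2 + (len 0 2)\<^sup>2 + (len 0 3)\<^sup>2 + (len 1 2)\<^sup>2 + (len 1 3)\<^sup>2 + (len 2 3)\<^sup>2"
  have "\<alpha> * (2 * \<Lambda>) \<le> 2 * \<Lambda>"
    using four_cycle_bound[OF full, of 0 1 2 3] four_cycle_bound[OF full, of 0 1 3 2] four_cycle_bound[OF full, of 0 2 1 3] n4
    by (simp add: \<Lambda>_def len_sym[of "Suc 0" 0] len_sym[of 2 0] len_sym[of 3 0] len_sym[of 2 "Suc 0"] len_sym[of 3 "Suc 0"] len_sym[of 3 2] algebra_simps)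
  moreover have "0 < \<Lambda>"
  proof -
    have "{e \<in> edges. len (fst e) (snd e) \<noteq> 0} = edges"
      by (rule card_seteq) (use full card_T_le in auto)
    moreover have "(0, 1) \<in> edges" using n4 by (simp add: edges_def)
    ultimately have "len 0 1 \<noteq> 0" by force
    then show ?thesis unfolding \<Lambda>_def by (intro add_pos_nonneg) auto
  qed
  ultimately show ?thesis by simp
qed

text \<open>Pairs inside a class of coinciding vertices are edges of length zero and carry no mode.
  This limits the class size, as required for the existence of balanced masses.\<close>

lemma coincident_card_le:
  assumes "u < n"
  shows "2 * card T + card {v. v < n \<and> len u v = 0} * (card {v. v < n \<and> len u v = 0} - 1) \<le> n * (n - 1)"
proof -
  let ?Z = "{v. v < n \<and> len u v = 0}" and ?N = "{e \<in> edges. len (fst e) (snd e) \<noteq> 0}"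
  let ?P = "{(v, w). v < w \<and> v \<in> ?Z \<and> w \<in> ?Z}"
  have "len v w = 0" if "v \<in> ?Z" "w \<in> ?Z" for v w
    using that by (auto simp: len_eq_0_iff)
  then have P: "?P \<subseteq> edges - ?N" by (auto simp: edges_def)
  have card_P: "2 * card ?P = card ?Z * (card ?Z - 1)"
  proof -
    have "card {(v, w). v \<in> ?Z \<and> w \<in> ?Z \<and> v \<noteq> w} = card (?P \<union> {(v, w). w < v \<and> v \<in> ?Z \<and> w \<in> ?Z})"
      by (rule arg_cong[of _ _ card]) auto
    also have "\<dots> = card ?P + card {(v, w). w < v \<and> v \<in> ?Z \<and> w \<in> ?Z}"
      by (rule card_Un_disjoint) (auto intro: finite_subset[of _ "{..<n} \<times> {..<n}"])
    also have "card {(v, w). w < v \<and> v \<in> ?Z \<and> w \<in> ?Z} = card ?P"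
      by (rule bij_betw_same_card[of prod.swap], rule bij_betwI[of _ _ _ prod.swap]) auto
    finally have "2 * card ?P = card {(v, w). v \<in> ?Z \<and> w \<in> ?Z \<and> v \<noteq> w}" by simp
    also have "{(v, w). v \<in> ?Z \<and> w \<in> ?Z \<and> v \<noteq> w} = ?Z \<times> ?Z - (\<lambda>v. (v, v)) ` ?Z" by auto
    also have "card \<dots> = card ?Z * card ?Z - card ?Z"
      by (subst card_Diff_subset) (auto simp: card_image inj_on_def card_cartesian_product)
    finally show ?thesis by (simp add: diff_mult_distrib2)
  qed
  have "card ?P + card T \<le> card (edges - ?N) + card ?N"
    by (intro add_mono card_mono[OF _ P] card_T_le) auto
  also have "\<dots> = card edges"
    by (subst card_Un_disjoint[symmetric]) (auto intro!: arg_cong[of _ _ card])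
  finally have "2 * card ?P + 2 * card T \<le> 2 * card edges" by simp
  also have "\<dots> \<le> n * (n - 1)" by (simp add: card_edges)
  finally show ?thesis using card_P by simp
qed

section \<open>Choosing among the three bounds\<close>

theorem large_eigenvalue_bound:
  assumes d3: "3 \<le> d" and nd: "d + 1 \<le> n" and card_T: "card T + (d + 1 choose 2) = d * n"
  shows "\<alpha> \<le> 2 * real n / (3 * (real d - 1)) + 1 / 3"
proof -
  obtain k where k: "n = d + 1 + k" using nd le_Suc_ex by blast
  define N D K where "N = real n" and "D = real d" and "K = real k"
  have N: "N = D + 1 + K" and D3: "3 \<le> D" and K0: "0 \<le> K" using k d3 by (simp_all add: N_def D_def K_def)
  have target: "2 * real n / (3 * (real d - 1)) + 1 / 3 = (2 * N + D - 1) / (3 * (D - 1))"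
    using D3 by (simp add: N_def D_def field_simps)
  have edgesN: "2 * real (card edges) = N * (N - 1)"
  proof -
    have "2 * card edges = n * (n - 1)" unfolding card_edges by (rule dvd_mult_div_cancel) (cases n; auto)
    then have "2 * real (card edges) = real (n * (n - 1))" by (metis of_nat_mult of_nat_numeral)
    then show ?thesis using n_pos by (simp add: N_def of_nat_diff)
  qed
  have "2 * real (d + 1 choose 2) = (D + 1) * D"
  proof -
    have "2 * (d + 1 choose 2) = (d + 1) * d" by (simp add: choose_two)
    then have "2 * real (d + 1 choose 2) = real ((d + 1) * d)" by (metis of_nat_mult of_nat_numeral)
    then show ?thesis by (simp add: D_def algebra_simps)
  qed
  moreover have "real (card T) + real (d + 1 choose 2) = D * N"
    using card_T by (metis N_def D_def of_nat_add of_nat_mult)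
  ultimately have TD: "2 * real (card T) = 2 * D * N - (D + 1) * D" by linarith
  have defect: "2 * (real (card edges) - real (card T)) = K * (K + 1)"
    using edgesN TD by (simp add: N algebra_simps)
  \<comment> \<open>As \<open>n = d + 1 + k\<close>, the condition \<open>3 * d + 1 <= 2 * n\<close>
    means \<open>n <= 3 * k + 2\<close>. The pair \<open>d = 3\<close>, \<open>n = 5\<close> is
    moved to the third case because the median bound is too weak there.\<close>
  consider "k = 0" | "3 * d + 1 \<le> 2 * n" "\<not> (d = 3 \<and> n = 5)" | "1 \<le> k" "3 * k + 3 \<le> n \<or> k = 1 \<and> n = 5"
    using k by linarith
  then show ?thesis
  proof cases
    case 1
    then have "card edges \<le> card T" using defect by (simp add: K_def)
    then have "\<alpha> \<le> 1" by (rule simplex_bound) (use d3 nd in simp)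
    also have "1 \<le> (2 * N + D - 1) / (3 * (D - 1))" using D3 N K0 by (simp add: field_simps)
    finally show ?thesis unfolding target .
  next
    case 2
    have "\<alpha> * (real (card T) - (real n - 1)) \<le> (real n - 1) * (169 * real n - 120) / 288"
      by (rule geometric_median_bound) (use d3 in simp)
    moreover have "real (card T) - (real n - 1) = (D - 1) * (2 * N - D - 2) / 2"
      using TD by (simp add: N_def field_simps)
    ultimately have "\<alpha> * ((D - 1) * (2 * N - D - 2) / 2) \<le> (N - 1) * (169 * N - 120) / 288" by (simp add: N_def)
    also have "\<dots> \<le> (2 * N + D - 1) / (3 * (D - 1)) * ((D - 1) * (2 * N - D - 2) / 2)"
    proof -
      \<comment> \<open>The difference of the two sides of \<open>poly\<close> below. It is
        \<open>-20\<close> at \<open>D = 3\<close>, \<open>N = 5\<close>. For \<open>d\<close> equal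
        to 3 or 4 the integrality of \<open>n\<close> is used, and from 5 on
        \<open>N >= (3 * D + 1) / 2\<close> suffices.\<close>
      have "0 \<le> 23 * N\<^sup>2 + N - 48 * D\<^sup>2 - 48 * D - 24"
      proof (cases "5 \<le> d")
        case True
        have "(3 * D + 1) / 2 \<le> N" using 2 by (simp add: N_def D_def)
        then have "((3 * D + 1) / 2)\<^sup>2 \<le> N\<^sup>2" using D3 by (intro power_mono) auto
        moreover have "0 \<le> (D - 5) * (15 * D + 27)" using True by (simp add: D_def)
        ultimately show ?thesis using \<open>(3 * D + 1) / 2 \<le> N\<close> by (simp add: power2_eq_square field_simps)
      next
        case False
        then have "d = 3 \<and> 6 \<le> N \<or> d = 4 \<and> 7 \<le> N" using 2 d3 by (auto simp: N_def)
        moreover have "36 \<le> N\<^sup>2" if "6 \<le> N" using power_mono[OF that, of 2] by simp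
        moreover have "49 \<le> N\<^sup>2" if "7 \<le> N" using power_mono[OF that, of 2] by simp
        ultimately show ?thesis by (auto simp: D_def)
      qed
      then have poly: "(N - 1) * (169 * N - 120) \<le> 48 * ((2 * N + D - 1) * (2 * N - D - 2))"
        by (simp add: power2_eq_square algebra_simps)
      have cancel: "x / (3 * b) * (b * y / 2) = x * y / 6" if "b \<noteq> 0" for x y b :: real
        using that by (simp add: field_simps)
      have "(2 * N + D - 1) / (3 * (D - 1)) * ((D - 1) * (2 * N - D - 2) / 2) = (2 * N + D - 1) * (2 * N - D - 2) / 6"
        by (rule cancel) (use D3 in simp)
      with poly show ?thesis by linarith
    qed
    finally show ?thesis unfolding target
      by (rule mult_right_le_imp_le) (use D3 N K0 in simp)
  next
    case 3
    have kn: "2 * k + 2 < n" using 3 by linarith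
    obtain m \<kappa> where "balanced_masses n d q m \<kappa>"
    proof (rule balanced_masses_exist)
      fix u assume u: "u < n"
      define \<mu> where "\<mu> = card {v. v < n \<and> len u v = 0}"
      \<comment> \<open>Only \<open>k * (k + 1) / 2\<close> edges can be spared, so at most
        \<open>k + 1\<close> vertices coincide, which by \<open>kn\<close> is less than
        half.\<close>
      have "real (\<mu> * (\<mu> - 1)) \<le> K * (K + 1)"
      proof -
        have "real (2 * card T + \<mu> * (\<mu> - 1)) \<le> real (n * (n - 1))"
          unfolding of_nat_le_iff \<mu>_def by (rule coincident_card_le[OF u])
        then show ?thesis using defect edgesN n_pos by (simp add: N_def of_nat_diff)
      qed
      moreover have "K * (K + 1) = real (k * (k + 1))" by (simp add: K_def algebra_simps)
      ultimately have "\<mu> * (\<mu> - 1) \<le> k * (k + 1)" by (simp only: of_nat_le_iff)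
      moreover have "k * (k + 1) < \<mu> * (\<mu> - 1)" if "k + 2 \<le> \<mu>"
      proof -
        have "(k + 2) * (k + 1) \<le> \<mu> * (\<mu> - 1)" by (rule mult_le_mono) (use that in auto)
        then show ?thesis by simp
      qed
      ultimately have "\<mu> \<le> k + 1" by linarith
      then show "2 * card {v. v < n \<and> len u v = 0} < n" using kn by (simp add: \<mu>_def)
    qed
    then interpret balanced_eigen_framework n d q z lam I T \<alpha> m \<kappa>
      by (intro balanced_eigen_framework.intro eigen_framework_axioms)
    have N3: "3 * K + 3 \<le> N \<or> K = 1 \<and> N = 5" and K1: "1 \<le> K"
      using 3 by (auto simp: N_def K_def)
    have Npos: "0 < N" using n_pos by (simp add: N_def)
    define e where "e = 1 - 2 / real n + 2 / (real n)\<^sup>2 - 4 * (real (card edges) - real (card T)) / (real n)\<^sup>2"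
    have e: "e = (N\<^sup>2 - 2 * N + 2 - 2 * K * (K + 1)) / N\<^sup>2"
    proof -
      have "4 * (real (card edges) - real (card T)) = 2 * K * (K + 1)" using defect by (simp add: algebra_simps)
      then show ?thesis
        using Npos unfolding e_def N_def[symmetric] by (simp only:) (simp add: field_simps power2_eq_square)
    qed
    \<comment> \<open>The hypothesis of \<open>balanced_bound\<close>. It is nearly tight for
      \<open>k = 1\<close>, \<open>n = 5\<close>, where it reads \<open>12.5 <= 13\<close>.\<close>
    have "5 / 2 * N \<le> N\<^sup>2 - 2 * N + 2 - 2 * K * (K + 1)"
      using N3
    proof
      assume N3: "3 * K + 3 \<le> N"
      have "0 \<le> (N - (3 * K + 3)) * (N + 3 * K - 3 / 2)" using N3 K1 by (intro mult_nonneg_nonneg) auto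
      moreover have "0 \<le> (K - 1) * (14 * K + 19)" using K1 by simp
      ultimately show ?thesis using K1 by (simp add: power2_eq_square field_simps)
    qed (simp add: power2_eq_square)
    moreover have "N * e = (N\<^sup>2 - 2 * N + 2 - 2 * K * (K + 1)) / N" by (simp add: e power2_eq_square)
    ultimately have Ne: "5 / 2 \<le> N * e" using Npos by (simp add: pos_le_divide_eq)
    then have e1: "\<alpha> * e \<le> 1" unfolding e_def N_def by (intro balanced_bound) (use d3 nd in auto)
    have e0: "0 < e" using Ne Npos by (metis less_le_trans zero_less_mult_pos zero_less_divide_iff zero_less_numeral)
    \<comment> \<open>The target inequality with denominators cleared and \<open>D\<close>
      eliminated. The factor \<open>N - (3 * K + 3)\<close> carries the case assumption; for
      \<open>N = 5\<close> the factor \<open>K - 1\<close> vanishes instead.\<close>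
    have "0 \<le> (K - 1) * ((N - (3 * K + 3)) * (2 * N - 4)) + 2 * K ^ 3 - 6 * K\<^sup>2 + 2 * K + 8"
    proof -
      have "0 \<le> (K - 1) * ((N - (3 * K + 3)) * (2 * N - 4))"
        using N3
      proof
        assume "3 * K + 3 \<le> N"
        then show ?thesis using K1 by (intro mult_nonneg_nonneg) auto
      qed simp
      moreover have "0 \<le> 2 * K ^ 3 - 6 * K\<^sup>2 + 2 * K + 8"
      proof -
        consider "k = 1" | "k = 2" | "3 \<le> k" using 3 by linarith
        then show ?thesis
        proof cases
          case 3
          then have "0 \<le> 2 * K\<^sup>2 * (K - 3)" by (simp add: K_def)
          then show ?thesis using K0 by (simp add: power2_eq_square power3_eq_cube algebra_simps)
        qed (simp_all add: K_def)
      qed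
      ultimately show ?thesis by linarith
    qed
    also have "\<dots> = (2 * N + D - 1) * (N\<^sup>2 - 2 * N + 2 - 2 * K * (K + 1)) - 3 * (D - 1) * N\<^sup>2"
      unfolding N by (simp add: power2_eq_square power3_eq_cube algebra_simps)
    finally have "3 * (D - 1) \<le> (2 * N + D - 1) * e" using Npos by (simp add: e field_simps)
    then have "1 \<le> (2 * N + D - 1) / (3 * (D - 1)) * e" using D3 by (simp add: field_simps)
    with e1 have "\<alpha> * e \<le> (2 * N + D - 1) / (3 * (D - 1)) * e" by linarith
    then show ?thesis unfolding target by (rule mult_right_le_imp_le[OF _ e0])
  qed
qed

end

section \<open>The stiffness matrix\<close>

text \<open>Coordinate \<open>a\<close> of vertex \<open>u\<close> has index
  \<open>u * d + a\<close>, following \<open>kronecker_vec\<close>.\<close>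

lemma sum_blocks: "(\<Sum>i<d * n. f i) = (\<Sum>u<n. \<Sum>a<d. f (u * d + a))"
  for f :: "nat \<Rightarrow> real"
proof -
  have "(\<Sum>i<d * n. f i) = (\<Sum>u<n. sum f {u * d..<u * d + d})"
    by (simp add: sum.nat_group mult.commute)
  moreover have "sum f {u * d..<u * d + d} = (\<Sum>a<d. f (u * d + a))" for u
    using sum.shift_bounds_nat_ivl[of f 0 "u * d" d] by (simp add: atLeast0LessThan add.commute)
  ultimately show ?thesis by simp
qed

lemma block_index_less:
  fixes u a n d :: nat
  assumes "u < n" "a < d"
  shows "u * d + a < d * n"
proof -
  have "u * d + a < Suc u * d" using assms by simp
  also have "\<dots> \<le> n * d" using assms by (intro mult_le_mono1) simp
  finally show ?thesis by (simp add: mult.commute)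
qed

lemma sum_edge_list_complete:
  "(\<Sum>e\<leftarrow>edge_list n (complete_graph_edges n). f e) = (\<Sum>(u, v)\<in>{(u, v). u < v \<and> v < n}. f (u, v))"
  for f :: "nat \<times> nat \<Rightarrow> real"
proof -
  have "edge_list n (complete_graph_edges n) = concat (map (\<lambda>u. map (Pair u) [Suc u..<n]) [0..<n])"
  proof -
    have "concat (map (\<lambda>v. if {u, v} \<in> complete_graph_edges n then [(u, v)] else []) [Suc u..<n]) = map (Pair u) [Suc u..<n]" for u
    proof -
      have "map (\<lambda>v. if {u, v} \<in> complete_graph_edges n then [(u, v)] else []) [Suc u..<n] = map (\<lambda>v. [(u, v)]) [Suc u..<n]"
        by (intro map_cong refl) (auto simp: complete_graph_edges_def)
      then show ?thesis by (simp only: concat_map_singleton)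
    qed
    then show ?thesis unfolding edge_list_def by simp
  qed
  moreover have "sum_list (concat xss) = sum_list (map sum_list xss)" for xss :: "real list list"
    by (induct xss) simp_all
  ultimately have "(\<Sum>e\<leftarrow>edge_list n (complete_graph_edges n). f e) = (\<Sum>u\<leftarrow>[0..<n]. \<Sum>v\<leftarrow>[Suc u..<n]. f (u, v))"
    by (simp add: map_concat comp_def)
  also have "\<dots> = (\<Sum>u<n. \<Sum>v\<in>{Suc u..<n}. f (u, v))"
    by (simp add: sum_list_distinct_conv_sum_set atLeast0LessThan)
  also have "\<dots> = (\<Sum>(u, v)\<in>(SIGMA u:{..<n}. {Suc u..<n}). f (u, v))"
    by (rule sum.Sigma) auto
  also have "(SIGMA u:{..<n}. {Suc u..<n}) = {(u, v). u < v \<and> v < n}" by auto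
  finally show ?thesis .
qed

context
  fixes d n :: nat and p :: "nat \<Rightarrow> real vec"
  assumes d_pos: "0 < d" and n_pos: "0 < n" and p: "\<And>v. v < n \<Longrightarrow> p v \<in> carrier_vec d"
begin

interpretation bar_framework n d "\<lambda>u a. p u $ a" by unfold_locales (rule n_pos)

lemma edge_direction_eq_dir:
  assumes "u < n" "v < n" "a < d"
  shows "edge_direction d p u v $ a = dir u v a"
proof -
  have c: "p u \<in> carrier_vec d" "p v \<in> carrier_vec d" using p assms by auto
  have "eucl_norm (p u - p v) = len u v"
    unfolding eucl_norm_def len_def scalar_prod_def using c
    by (intro arg_cong[of _ _ sqrt]) (auto simp: power2_eq_square atLeast0LessThan intro!: sum.cong)
  then show ?thesis
    using assms c by (auto simp: edge_direction_def dir_def)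
qed

lemma edge_direction_carrier: "u < n \<Longrightarrow> v < n \<Longrightarrow> edge_direction d p u v \<in> carrier_vec d"
  using p by (auto simp: edge_direction_def)

lemma rigidity_carrier: "rigidity_matrix d n E p \<in> carrier_mat (d * n) (length (edge_list n E))"
  unfolding rigidity_matrix_def by (rule carrier_matI) auto

lemma stiffness_carrier: "stiffness_matrix d n E p \<in> carrier_mat (d * n) (d * n)"
  unfolding stiffness_matrix_def using rigidity_carrier[of E] by simp

lemma stiffness_symmetric: "transpose_mat (stiffness_matrix d n E p) = stiffness_matrix d n E p"
  unfolding stiffness_matrix_def
  by (subst transpose_mult[OF rigidity_carrier]) (use rigidity_carrier in auto)

lemma stiffness_entry:
  assumes w: "w < n" "a < d" and j: "u' < n" "b < d"
  shows "stiffness_matrix d n (complete_graph_edges n) p $$ (w * d + a, u' * d + b) =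
    (\<Sum>(u, v)\<in>edges. ((of_bool (w = u) - of_bool (w = v)) * dir u v a) * ((of_bool (u' = u) - of_bool (u' = v)) * dir u v b))"
proof -
  let ?E = "edge_list n (complete_graph_edges n)"
  let ?k = "\<lambda>(u, v). kronecker_vec (unit_vec n u - unit_vec n v) (edge_direction d p u v)"
  let ?R = "rigidity_matrix d n (complete_graph_edges n) p"
  note idx = block_index_less
  have R: "?R $$ (i, l) = ?k (?E ! l) $ i" if "i < d * n" "l < length ?E" for i l
    unfolding rigidity_matrix_def using that by (simp add: mat_of_cols_index)
  have dims: "dim_row ?R = d * n" "dim_col ?R = length ?E"
    unfolding rigidity_matrix_def by auto
  have k: "?k (u, v) $ (w * d + a) = (of_bool (w = u) - of_bool (w = v)) * dir u v a"
    if "u < v" "v < n" "w < n" "a < d" for u v w a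
    using that idx[of w n a d] edge_direction_carrier[of u v] d_pos
    by (auto simp: kronecker_vec_def edge_direction_eq_dir mult.commute)
  have "stiffness_matrix d n (complete_graph_edges n) p $$ (w * d + a, u' * d + b)
      = (\<Sum>l<length ?E. ?R $$ (w * d + a, l) * ?R $$ (u' * d + b, l))"
    unfolding stiffness_matrix_def using idx[OF w] idx[OF j] dims
    by (simp add: scalar_prod_def atLeast0LessThan)
  also have "\<dots> = (\<Sum>l<length ?E. (\<lambda>e. ?k e $ (w * d + a) * ?k e $ (u' * d + b)) (?E ! l))"
    by (intro sum.cong refl) (simp add: R idx w j)
  also have "\<dots> = (\<Sum>e\<leftarrow>?E. ?k e $ (w * d + a) * ?k e $ (u' * d + b))"
    by (simp add: sum_list_sum_nth atLeast0LessThan)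
  also have "\<dots> = (\<Sum>(u, v)\<in>edges. ?k (u, v) $ (w * d + a) * ?k (u, v) $ (u' * d + b))"
    unfolding sum_edge_list_complete edges_def ..
  also have "\<dots> = (\<Sum>(u, v)\<in>edges. ((of_bool (w = u) - of_bool (w = v)) * dir u v a) * ((of_bool (u' = u) - of_bool (u' = v)) * dir u v b))"
  proof (rule sum.cong[OF refl], unfold split_paired_all case_prod_conv)
    fix u v assume "(u, v) \<in> edges"
    then have uv: "u < v" "v < n" by (auto simp: edges_def)
    show "kronecker_vec (unit_vec n u - unit_vec n v) (edge_direction d p u v) $ (w * d + a)
        * kronecker_vec (unit_vec n u - unit_vec n v) (edge_direction d p u v) $ (u' * d + b)
      = (of_bool (w = u) - of_bool (w = v)) * dir u v a * ((of_bool (u' = u) - of_bool (u' = v)) * dir u v b)"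
      using k[OF uv w] k[OF uv j] by simp
  qed
  finally show ?thesis .
qed

text \<open>The factorisation of the stiffness matrix into the rigidity matrix and its transpose, in
  coordinates. It connects the matrix of the definition with the framework locales.\<close>

lemma stiffness_mult_eq_force:
  assumes w: "w < n" "a < d"
  shows "(\<Sum>u<n. \<Sum>b<d. stiffness_matrix d n (complete_graph_edges n) p $$ (w * d + a, u * d + b) * y u b) = force (strain y) w a"
proof -
  define s where "s u v = of_bool (w = u) - (of_bool (w = v) :: real)" for u v
  have y: "(\<Sum>x<n. \<Sum>b<d. ((of_bool (x = u) - of_bool (x = v)) * dir u v b) * y x b) = strain y u v"
    if "u < n" "v < n" for u v
  proof -
    have "(\<Sum>b<d. ((of_bool (x = u) - of_bool (x = v)) * dir u v b) * y x b)
        = (if x = u then \<Sum>b<d. dir u v b * y u b else 0) - (if x = v then \<Sum>b<d. dir u v b * y v b else 0)" for x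
      by (auto simp: sum_negf)
    then show ?thesis using that
      by (simp add: sum_subtractf strain_def right_diff_distrib)
  qed
  have "(\<Sum>u<n. \<Sum>b<d. stiffness_matrix d n (complete_graph_edges n) p $$ (w * d + a, u * d + b) * y u b)
    = (\<Sum>x<n. \<Sum>b<d. \<Sum>(u, v)\<in>edges. s u v * dir u v a * (((of_bool (x = u) - of_bool (x = v)) * dir u v b) * y x b))"
    by (intro sum.cong refl) (simp add: stiffness_entry w sum_distrib_right s_def mult.assoc case_prod_unfold)
  also have "\<dots> = (\<Sum>(u, v)\<in>edges. \<Sum>x<n. \<Sum>b<d. s u v * dir u v a * (((of_bool (x = u) - of_bool (x = v)) * dir u v b) * y x b))"
    unfolding case_prod_unfold by (subst (2) sum.swap, subst sum.swap) (rule refl)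
  also have "\<dots> = (\<Sum>(u, v)\<in>edges. s u v * dir u v a * strain y u v)"
    unfolding sum_distrib_left[symmetric] by (intro sum.cong refl) (auto simp: edges_def y)
  finally have "2 * (\<Sum>u<n. \<Sum>b<d. stiffness_matrix d n (complete_graph_edges n) p $$ (w * d + a, u * d + b) * y u b)
    = (\<Sum>u<n. \<Sum>v<n. s u v * dir u v a * strain y u v)"
    unfolding edges_def
  proof (subst sum_lessThan_pairs_symmetric)
    fix u v
    show "s u v * dir u v a * strain y u v = s v u * dir v u a * strain y v u"
      unfolding strain_sym[of y v u] dir_antisym[of v u] by (simp add: s_def algebra_simps)
  qed auto
  also have "\<dots> = (\<Sum>u<n. \<Sum>v<n. of_bool (w = u) * (dir u v a * strain y u v)) - (\<Sum>u<n. \<Sum>v<n. of_bool (w = v) * (dir u v a * strain y u v))"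
    by (simp add: s_def sum_subtractf left_diff_distrib mult.assoc)
  also have "(\<Sum>u<n. \<Sum>v<n. of_bool (w = u) * (dir u v a * strain y u v)) = force (strain y) w a"
  proof -
    have "(\<Sum>v<n. of_bool (w = u) * (dir u v a * strain y u v)) = (if w = u then force (strain y) w a else 0)" for u
      by (simp add: force_def mult.commute)
    then show ?thesis using w by simp
  qed
  also have "(\<Sum>u<n. \<Sum>v<n. of_bool (w = v) * (dir u v a * strain y u v)) = - force (strain y) w a"
  proof -
    have "(\<Sum>u<n. \<Sum>v<n. of_bool (w = v) * (dir u v a * strain y u v)) = (\<Sum>u<n. dir u w a * strain y u w)"
      using w by (simp add: of_bool_def if_distrib[of "\<lambda>c. c * _"] cong: if_cong)
    also have "\<dots> = (\<Sum>u<n. - (strain y w u * dir w u a))"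
    proof (intro sum.cong refl)
      fix u show "dir u w a * strain y u w = - (strain y w u * dir w u a)"
        unfolding strain_sym[of y u w] dir_antisym[of u w] by simp
    qed
    finally show ?thesis by (simp add: force_def sum_negf)
  qed
  finally show ?thesis by simp
qed

proposition stiffness_eigenvalue_bound:
  assumes d3: "3 \<le> d" and nd: "d + 1 \<le> n"
  shows "nth_smallest_eigenvalue ((d + 1 choose 2) + 1) (stiffness_matrix d n (complete_graph_edges n) p)
    \<le> 2 * real n / (3 * (real d - 1)) + 1 / 3"
proof -
  let ?L = "stiffness_matrix d n (complete_graph_edges n) p"
  let ?C = "d + 1 choose 2"
  define es where "es = sorted_list_of_multiset (proots (char_poly ?L))"
  \<comment> \<open>Lists are indexed from 0, so position \<open>?C\<close> holds the eigenvalue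
    with number \<open>?C + 1\<close>.\<close>
  define \<alpha> where "\<alpha> = es ! ?C"
  note splits = symmetric_char_poly_splits[OF stiffness_carrier stiffness_symmetric, of "complete_graph_edges n", folded es_def]
  have nth: "nth_smallest_eigenvalue (?C + 1) ?L = \<alpha>"
    by (simp add: nth_smallest_eigenvalue_def \<alpha>_def es_def)
  have C: "?C \<le> d * n"
  proof -
    have "?C \<le> (d + 1) * d" by (simp add: choose_two)
    also have "\<dots> \<le> n * d" using nd by (rule mult_le_mono1)
    finally show ?thesis by (simp add: mult.commute)
  qed
  show ?thesis
  proof (cases "0 < \<alpha>")
    case False
    have "0 \<le> 2 * real n / (3 * (real d - 1))" using d3 by simp
    then show ?thesis using False nth by linarith
  next
    case True
    obtain P where P: "P \<in> carrier_mat (d * n) (d * n)" and PP: "transpose_mat P * P = 1\<^sub>m (d * n)"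
      and PLP: "transpose_mat P * ?L * P = mat_diag (d * n) (\<lambda>i. es ! i)"
      using symmetric_diagonalizable[OF stiffness_carrier stiffness_symmetric splits(1)] by blast
    have Pt: "transpose_mat P \<in> carrier_mat (d * n) (d * n)" using P by simp
    have PPt: "P * transpose_mat P = 1\<^sub>m (d * n)" by (rule mat_mult_left_right_inverse[OF Pt P PP])
    note L = stiffness_carrier[of "complete_graph_edges n"]
    have LP: "?L * P = P * mat_diag (d * n) (\<lambda>i. es ! i)"
    proof -
      have "P * mat_diag (d * n) (\<lambda>i. es ! i) = P * (transpose_mat P * (?L * P))"
        unfolding PLP[symmetric] by (subst assoc_mult_mat[OF Pt L P]) (rule refl)
      also have "\<dots> = P * transpose_mat P * (?L * P)"
        by (rule assoc_mult_mat[symmetric, OF P Pt]) (use P L in auto)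
      finally show ?thesis using P L by (simp add: PPt)
    qed
    note idx = block_index_less
    define z where "z i u a = P $$ (u * d + a, i)" for i u a
    \<comment> \<open>The columns of \<open>P\<close> are the eigenvectors. As \<open>es\<close> is
      sorted, all positions from \<open>?C\<close> on carry eigenvalues of at least
      \<open>\<alpha>\<close>, which supplies \<open>T\<close>.\<close>
    interpret eigen_framework n d "\<lambda>u a. p u $ a" z "\<lambda>i. es ! i" "{..<d * n}" "{?C..<d * n}" \<alpha>
    proof unfold_locales
      fix i j assume ij: "i \<in> {..<d * n}" "j \<in> {..<d * n}"
      have "(\<Sum>u<n. \<Sum>a<d. z i u a * z j u a) = (transpose_mat P * P) $$ (i, j)"
        using ij P by (simp add: z_def scalar_prod_def atLeast0LessThan sum_blocks)
      then show "(\<Sum>u<n. \<Sum>a<d. z i u a * z j u a) = (if i = j then 1 else 0)"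
        using ij by (simp add: PP)
    next
      fix u v a b assume uv: "u < n" "v < n" "a < d" "b < d"
      have "(\<Sum>i<d * n. z i u a * z i v b) = (P * transpose_mat P) $$ (u * d + a, v * d + b)"
        using uv P by (simp add: z_def scalar_prod_def atLeast0LessThan idx)
      also have "\<dots> = (if u * d + a = v * d + b then 1 else 0)" using uv by (simp add: PPt idx)
      also have "u * d + a = v * d + b \<longleftrightarrow> u = v \<and> a = b"
      proof
        assume eq: "u * d + a = v * d + b"
        from arg_cong[OF eq, of "\<lambda>x. x div d"] arg_cong[OF eq, of "\<lambda>x. x mod d"] show "u = v \<and> a = b" using uv by simp
      qed simp
      finally show "(\<Sum>i<d * n. z i u a * z i v b) = (if u = v \<and> a = b then 1 else 0)" .
    next
      fix i u a assume i: "i \<in> {..<d * n}" and u: "u < n" "a < d"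
      have "force (strain (z i)) u a = (?L * P) $$ (u * d + a, i)"
        using i P L idx[OF u] by (simp add: stiffness_mult_eq_force[symmetric] u z_def scalar_prod_def atLeast0LessThan sum_blocks)
      also have "\<dots> = es ! i * z i u a"
        unfolding LP using i idx[OF u] by (simp add: mat_diag_mult_right[OF P] z_def mult.commute)
      finally show "force (strain (z i)) u a = es ! i * z i u a" .
    next
      fix i assume "i \<in> {?C..<d * n}"
      then show "\<alpha> \<le> es ! i"
        unfolding \<alpha>_def by (intro sorted_nth_mono) (auto simp: splits(2), simp add: es_def)
    qed (use True in auto)
    have "\<alpha> \<le> 2 * real n / (3 * (real d - 1)) + 1 / 3"
      by (rule large_eigenvalue_bound[OF d3 nd]) (use C in simp)
    then show ?thesis using nth by simp
  qed
qed

end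

theorem theorem1p6:
  fixes d n :: nat
  assumes "d \<ge> 3" and "n \<ge> d + 1"
  shows "algebraic_connectivity d n (complete_graph_edges n)
           \<le> 2 * real n / (3 * (real d - 1)) + 1 / 3"
  unfolding algebraic_connectivity_def
proof (rule cSUP_least)
  show "{p :: nat \<Rightarrow> real vec. \<forall>v\<in>{0..<n}. p v \<in> carrier_vec d} \<noteq> {}"
    by (rule ex_in_conv[THEN iffD1, OF exI[of _ "\<lambda>_. 0\<^sub>v d"]]) simp
next
  fix p :: "nat \<Rightarrow> real vec"
  assume "p \<in> {p. \<forall>v\<in>{0..<n}. p v \<in> carrier_vec d}"
  then show "nth_smallest_eigenvalue ((d + 1 choose 2) + 1) (stiffness_matrix d n (complete_graph_edges n) p)
      \<le> 2 * real n / (3 * (real d - 1)) + 1 / 3"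
    using assms by (intro stiffness_eigenvalue_bound) auto
qed

end
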